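(* Let $G$ be a Hodge group with complex Lie algebra $\mathfrak{g}_{\mathbb C}=\mathfrak{sl}_4\mathbb{C}$. Assume that $(V,\varphi)$ is a Hodge representation of $G$ with the property that $V_{\mathbb R}$ is an irreducible $G_{\mathbb R}$-module. Let $\mathtt{T}_\varphi$ be the associated grading element, and assume the normalization $\sigma_i(\mathtt{T}_\varphi)\ge 0$ for $i=1,2,3$. Then the Hodge representation is principal if and only if $V_{\mathbb C}=\mathbb{C}^4\oplus(\mathbb{C}^4)^*$ and $\mathtt{T}_\varphi$ is one of $$3\,\mathtt{T}^1+2\,\mathtt{T}^2+\mathtt{T}^3\quad\text{or}\quad \mathtt{T}^1+2\,\mathtt{T}^2+3\,\mathtt{T}^3.$$
   Context: Hodge representations. Let $V$ be a (finite-dimensional) rational vector space, $w\in\mathbb{Z}$, and $Q:V\times V\to\mathbb{Q}$ a nondegenerate bilinear form with $Q(u,v)=(-1)^wQ(v,u)$. A $Q$-polarized Hodge structure of weight $w$ on $V$ is a nonconstant homomorphism $\phi:S^1\to\mathrm{Aut}(V_{\mathbb R},Q)$ of $\mathbb{R}$-algebraic groups with $\phi(-1)=(-1)^w\mathrm{Id}$ and $Q(v,\phi(\mathbf{i})\overline v)>0$ for all $0\ne v\in V_{\mathbb C}$. Its Hodge decomposition is $V_{\mathbb C}=\bigoplus_{p+q=w}V^{p,q}$, $V^{p,q}=\{v\in V_{\mathbb C}\mid \phi(z)v=z^{p-q}v\ \forall z\in S^1\}$. Let $G$ be a $\mathbb{Q}$-algebraic group, $\pi:G\to\mathrm{Aut}(V,Q)$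 a homomorphism of $\mathbb{Q}$-algebraic groups such that $\pi_*:\mathfrak{g}_{\mathbb C}\to\mathrm{End}(V_{\mathbb C},Q)$ is injective, and $\varphi:S^1\to G_{\mathbb R}$ a nonconstant homomorphism of $\mathbb{R}$-algebraic groups. Then $(V,Q,\pi,\varphi)$, abbreviated $(V,\varphi)$, is a Hodge representation of $G$ if $\pi\circ\varphi$ is a $Q$-polarized Hodge structure on $V$. A $\mathbb{Q}$-algebraic group admitting a Hodge representation is a Hodge group. Grading element. Given $(V,\varphi)$, the grading element $\mathtt{T}_\varphi\in\mathbf{i}\,\mathfrak{g}_{\mathbb R}$ is the semisimple element (tangent, up to scaling, to $\varphi(S^1)$) that acts on $V^{p,q}$ with eigenvalue $(p-q)/2$. Let $V_\ell\subset V_{\mathbb C}$ be the $\ell$-eigenspace of $\mathtt{T}_\varphi$. Fix a compact maximal torus $T\subset G_{\mathbb R}$ with $\varphi(S^1)\subset T$ and $\dim_{\mathbb R}T=\mathrm{rank}(G_{\mathbb R})$; let $\mathfrak{t}_{\mathbb C}\subset\mathfrak{g}_{\mathbb C}$ be the corresponding Cartan subalgebra, so $\mathtt{T}_\varphi\in\mathfrak{t}_{\mathbb C}$. One chooses a Borel subalgebra containing $\mathfrak{t}_{\mathbb C}$ and contained in the sum of the eigenspaces of $\mathrm{ad}\,\mathtt{T}_\varphi$ with nonnegative eigenvalue; let $\sigma_1,\sigma_2,\sigma_3$ be the corresponding simple roots (in the standard order along the Dynkin diagram) and $\mathtt{T}^1,\mathtt{T}^2,\mathtt{T}^3\in\mathfrak{t}_{\mathbb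 C}$ the basis dual to the simple roots, $\sigma_i(\mathtt{T}^j)=\delta_i^j$. Then $\mathtt{T}_\varphi=\sum_i n_i\mathtt{T}^i$ with $n_i=\sigma_i(\mathtt{T}_\varphi)\in\mathbb{Z}_{\ge 0}$ (this nonnegativity is the normalization). The standard representation $\mathbb{C}^4$ has highest weight the first fundamental weight $\omega_1=\tfrac14(3\sigma_1+2\sigma_2+\sigma_3)$. Principal. Let $m$ be the largest $\mathtt{T}_\varphi$-eigenvalue on $V_{\mathbb C}$, so $V_{\mathbb C}=V_m\oplus V_{m-1}\oplus\cdots\oplus V_{1-m}\oplus V_{-m}$. The Hodge representation is principal if its Hodge numbers are $(1,1,\dots,1)$, i.e. $\dim_{\mathbb C}V_\ell=1$ for $\ell=m,m-1,\dots,-m$. *)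

theory Defs
  imports "HOL-Analysis.Analysis"
begin

text \<open>
  Conventions. An algebraic group over a subfield \<open>K\<close> of the complex numbers is linear and is
  represented by its group of complex points, a subgroup of \<open>GL\<^sub>N(\<complex>)\<close> cut out by polynomials with
  coefficients in \<open>K\<close>. This loses no generality here: a group with a representation whose
  differential is injective is finite over a linear group, hence is linear. The rational
  vector space \<open>V\<close> is \<open>\<rat>\<^sup>n\<close>, with \<open>V\<^sub>\<real> = \<real>\<^sup>n\<close> and \<open>V\<^sub>\<complex> = \<complex>\<^sup>n\<close>; real objects are regarded inside
  the complex ones as those with real coordinates.
\<close>

section \<open>Complex matrices as a vector space and as a Lie algebra\<close>

definition cscale :: "complex \<Rightarrow> complex^'n^'m \<Rightarrow> complex^'n^'m" where
  "cscale c A = (\<chi> i j. c * A $ i $ j)"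

interpretation cmat: vector_space "cscale :: complex \<Rightarrow> complex^'n^'m \<Rightarrow> complex^'n^'m"
  by unfold_locales (simp_all add: cscale_def vec_eq_iff algebra_simps)

definition bracket :: "complex^'n^'n \<Rightarrow> complex^'n^'n \<Rightarrow> complex^'n^'n" where
  "bracket A B = A ** B - B ** A"

definition lie_subalgebra :: "(complex^'n^'n) set \<Rightarrow> bool" where
  "lie_subalgebra h \<longleftrightarrow> cmat.subspace h \<and> (\<forall>X\<in>h. \<forall>Y\<in>h. bracket X Y \<in> h)"

definition lie_commutator :: "(complex^'n^'n) set \<Rightarrow> (complex^'n^'n) set \<Rightarrow> (complex^'n^'n) set" where
  "lie_commutator h k = cmat.span {bracket X Y | X Y. X \<in> h \<and> Y \<in> k}"

definition lie_solvable :: "(complex^'n^'n) set \<Rightarrow> bool" where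
  "lie_solvable h \<longleftrightarrow> (\<exists>n. ((\<lambda>k. lie_commutator k k) ^^ n) h \<subseteq> {0})"

definition lie_nilpotent :: "(complex^'n^'n) set \<Rightarrow> bool" where
  "lie_nilpotent h \<longleftrightarrow> (\<exists>n. (lie_commutator h ^^ n) h \<subseteq> {0})"

definition cartan_subalgebra :: "(complex^'n^'n) set \<Rightarrow> (complex^'n^'n) set \<Rightarrow> bool" where
  "cartan_subalgebra g h \<longleftrightarrow> lie_subalgebra h \<and> h \<subseteq> g \<and> lie_nilpotent h \<and>
     (\<forall>X\<in>g. (\<forall>Y\<in>h. bracket X Y \<in> h) \<longrightarrow> X \<in> h)"

definition borel_subalgebra :: "(complex^'n^'n) set \<Rightarrow> (complex^'n^'n) set \<Rightarrow> bool" where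
  "borel_subalgebra g b \<longleftrightarrow> lie_subalgebra b \<and> b \<subseteq> g \<and> lie_solvable b \<and>
     (\<forall>c. lie_subalgebra c \<and> c \<subseteq> g \<and> lie_solvable c \<and> b \<subseteq> c \<longrightarrow> c = b)"

definition lie_isomorphism ::
    "(complex^'n^'n) set \<Rightarrow> (complex^'m^'m) set \<Rightarrow> (complex^'n^'n \<Rightarrow> complex^'m^'m) \<Rightarrow> bool" where
  "lie_isomorphism g h f \<longleftrightarrow> bij_betw f g h \<and>
     (\<forall>X\<in>g. \<forall>Y\<in>g. f (X + Y) = f X + f Y) \<and>
     (\<forall>c. \<forall>X\<in>g. f (cscale c X) = cscale c (f X)) \<and>
     (\<forall>X\<in>g. \<forall>Y\<in>g. f (bracket X Y) = bracket (f X) (f Y))"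

definition sl4 :: "(complex^4^4) set" where
  "sl4 = {A. trace A = 0}"

section \<open>Roots\<close>

text \<open>
  An element of the dual of \<open>t\<close> is encoded as a function on all matrices that is linear on \<open>t\<close> and
  zero off \<open>t\<close>, so that equality of functions is equality in the dual and sums are pointwise.
\<close>

definition dual_space :: "(complex^'n^'n) set \<Rightarrow> (complex^'n^'n \<Rightarrow> complex) set" where
  "dual_space t = {\<alpha>. (\<forall>H\<in>t. \<forall>H'\<in>t. \<alpha> (H + H') = \<alpha> H + \<alpha> H') \<and>
     (\<forall>c. \<forall>H\<in>t. \<alpha> (cscale c H) = c * \<alpha> H) \<and> (\<forall>H. H \<notin> t \<longrightarrow> \<alpha> H = 0)}"

definition root_space ::
    "(complex^'n^'n) set \<Rightarrow> (complex^'n^'n) set \<Rightarrow> (complex^'n^'n \<Rightarrow> complex) \<Rightarrow> (complex^'n^'n) set" where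
  "root_space g t \<alpha> = {X\<in>g. \<forall>H\<in>t. bracket H X = cscale (\<alpha> H) X}"

definition roots ::
    "(complex^'n^'n) set \<Rightarrow> (complex^'n^'n) set \<Rightarrow> (complex^'n^'n \<Rightarrow> complex) set" where
  "roots g t = {\<alpha> \<in> dual_space t. \<alpha> \<noteq> (\<lambda>_. 0) \<and> root_space g t \<alpha> \<noteq> {0}}"

definition positive_roots ::
    "(complex^'n^'n) set \<Rightarrow> (complex^'n^'n) set \<Rightarrow> (complex^'n^'n) set
      \<Rightarrow> (complex^'n^'n \<Rightarrow> complex) set" where
  "positive_roots g t b = {\<alpha> \<in> roots g t. root_space g t \<alpha> \<subseteq> b}"

definition simple_roots ::
    "(complex^'n^'n) set \<Rightarrow> (complex^'n^'n) set \<Rightarrow> (complex^'n^'n) set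
      \<Rightarrow> (complex^'n^'n \<Rightarrow> complex) set" where
  "simple_roots g t b = {\<alpha> \<in> positive_roots g t b.
     \<not> (\<exists>\<beta>\<in>positive_roots g t b. \<exists>\<gamma>\<in>positive_roots g t b. \<alpha> = (\<lambda>H. \<beta> H + \<gamma> H))}"

text \<open>
  The numbering \<open>\<sigma> 1, \<sigma> 2, \<sigma> 3\<close> of the simple roots along the Dynkin diagram of type \<open>A\<^sub>3\<close>. Two
  distinct simple roots are joined in the diagram if and only if their sum is a root (their
  difference never is one, so the Cartan integer is minus the length of the root string).
\<close>

definition ordered_simple_roots ::
    "(complex^'n^'n) set \<Rightarrow> (complex^'n^'n) set \<Rightarrow> (complex^'n^'n) set
      \<Rightarrow> (nat \<Rightarrow> complex^'n^'n \<Rightarrow> complex) \<Rightarrow> bool" where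
  "ordered_simple_roots g t b \<sigma> \<longleftrightarrow> bij_betw \<sigma> {1..3} (simple_roots g t b) \<and>
     (\<lambda>H. \<sigma> 1 H + \<sigma> 2 H) \<in> roots g t \<and>
     (\<lambda>H. \<sigma> 2 H + \<sigma> 3 H) \<in> roots g t \<and>
     (\<lambda>H. \<sigma> 1 H + \<sigma> 3 H) \<notin> roots g t"

text \<open>
  \<open>\<mu>\<close> is the highest weight of the irreducible \<open>g\<close>-module \<open>\<complex>\<^sup>k\<close> given by \<open>\<iota>\<close>.
\<close>

definition highest_weight ::
    "(complex^'n^'n) set \<Rightarrow> (complex^'n^'n) set \<Rightarrow> (complex^'n^'n) set
      \<Rightarrow> (complex^'n^'n \<Rightarrow> complex^'k^'k) \<Rightarrow> (complex^'n^'n \<Rightarrow> complex) \<Rightarrow> bool" where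
  "highest_weight g t b \<iota> \<mu> \<longleftrightarrow> (\<exists>x. x \<noteq> 0 \<and>
     (\<forall>H\<in>t. \<iota> H *v x = \<mu> H *s x) \<and>
     (\<forall>\<alpha>\<in>positive_roots g t b. \<forall>X\<in>root_space g t \<alpha>. \<iota> X *v x = 0))"

section \<open>Algebraic groups\<close>

inductive polyfun :: "complex set \<Rightarrow> (complex^'n^'n \<Rightarrow> complex) \<Rightarrow> bool" for K where
  const: "c \<in> K \<Longrightarrow> polyfun K (\<lambda>_. c)"
| entry: "polyfun K (\<lambda>A. A $ i $ j)"
| add: "polyfun K f \<Longrightarrow> polyfun K g \<Longrightarrow> polyfun K (\<lambda>A. f A + g A)"
| mult: "polyfun K f \<Longrightarrow> polyfun K g \<Longrightarrow> polyfun K (\<lambda>A. f A * g A)"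

definition matrix_group :: "(complex^'n^'n) set \<Rightarrow> bool" where
  "matrix_group G \<longleftrightarrow> (\<forall>g\<in>G. invertible g \<and> matrix_inv g \<in> G) \<and> mat 1 \<in> G \<and>
     (\<forall>g\<in>G. \<forall>h\<in>G. g ** h \<in> G)"

definition algebraic_group :: "complex set \<Rightarrow> (complex^'n^'n) set \<Rightarrow> bool" where
  "algebraic_group K G \<longleftrightarrow> matrix_group G \<and>
     (\<exists>S. (\<forall>f\<in>S. polyfun K f) \<and> G = {g. invertible g \<and> (\<forall>f\<in>S. f g = 0)})"

definition real_points :: "(complex^'n^'n) set \<Rightarrow> (complex^'n^'n) set" where
  "real_points G = {g\<in>G. \<forall>i j. g $ i $ j \<in> \<real>}"

definition dir_deriv :: "(complex^'n^'n \<Rightarrow> complex) \<Rightarrow> complex^'n^'n \<Rightarrow> complex" where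
  "dir_deriv f X = deriv (\<lambda>z. f (mat 1 + cscale z X)) 0"

text \<open>
  The Zariski tangent space at the identity, i.e. the complex Lie algebra of the Zariski closure
  of \<open>G\<close>. Applied to a compact group of real matrices, it gives the complexification of the real
  Lie algebra.
\<close>

definition lie_algebra :: "(complex^'n^'n) set \<Rightarrow> (complex^'n^'n) set" where
  "lie_algebra G = {X. \<forall>f. polyfun UNIV f \<and> (\<forall>g\<in>G. f g = 0) \<longrightarrow> dir_deriv f X = 0}"

text \<open>Matrix-valued regular functions on the general linear group.\<close>

definition gl_regular :: "complex set \<Rightarrow> (complex^'n^'n \<Rightarrow> complex^'v^'v) \<Rightarrow> bool" where
  "gl_regular K F \<longleftrightarrow> (\<forall>i j. \<exists>p k. polyfun K p \<and>
     (\<forall>g. invertible g \<longrightarrow> F g $ i $ j = p g / det g ^ k))"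

definition algebraic_hom ::
    "complex set \<Rightarrow> (complex^'n^'n) set \<Rightarrow> (complex^'v^'v) set
      \<Rightarrow> (complex^'n^'n \<Rightarrow> complex^'v^'v) \<Rightarrow> bool" where
  "algebraic_hom K G H \<pi> \<longleftrightarrow> (\<forall>g\<in>G. \<pi> g \<in> H) \<and>
     (\<forall>g\<in>G. \<forall>h\<in>G. \<pi> (g ** h) = \<pi> g ** \<pi> h) \<and>
     (\<exists>F. gl_regular K F \<and> (\<forall>g\<in>G. F g = \<pi> g))"

text \<open>
  The differential at the identity, computed from any regular extension of \<open>\<pi>\<close> to the general
  linear group; the lemma \<open>differential_eq\<close> below shows that the choice does not matter.
\<close>

definition differential ::
    "(complex^'n^'n) set \<Rightarrow> (complex^'n^'n \<Rightarrow> complex^'v^'v) \<Rightarrow> complex^'n^'n \<Rightarrow> complex^'v^'v" where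
  "differential G \<pi> X = (THE Y. \<exists>F. gl_regular UNIV F \<and> (\<forall>g\<in>G. F g = \<pi> g) \<and>
     Y = (\<chi> i j. dir_deriv (\<lambda>g. F g $ i $ j) X))"

lemma polyfun_differentiable:
  fixes A X :: "complex^'n^'n"
  assumes "polyfun K f"
  shows "(\<lambda>z. f (A + cscale z X)) field_differentiable (at z)"
  using assms
proof induction
  case (entry i j)
  have "(\<lambda>z. (A + cscale z X) $ i $ j) = (\<lambda>z. A $ i $ j + z * X $ i $ j)"
    by (simp add: cscale_def)
  then show ?case
    by (simp add: field_differentiable_add field_differentiable_mult)
qed (simp_all add: field_differentiable_add field_differentiable_mult)

lemma polyfun_sum:
  "finite I \<Longrightarrow> (\<And>i. i \<in> I \<Longrightarrow> polyfun UNIV (f i)) \<Longrightarrow> polyfun UNIV (\<lambda>A. \<Sum>i\<in>I. f i A)"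
  by (induction I rule: finite_induct) (auto intro: polyfun.intros)

lemma polyfun_prod:
  "finite I \<Longrightarrow> (\<And>i. i \<in> I \<Longrightarrow> polyfun UNIV (f i)) \<Longrightarrow> polyfun UNIV (\<lambda>A. \<Prod>i\<in>I. f i A)"
  by (induction I rule: finite_induct) (auto intro: polyfun.intros)

lemma polyfun_det: "polyfun UNIV det"
  unfolding det_def [abs_def]
  by (intro polyfun_sum polyfun.mult polyfun.const polyfun_prod polyfun.entry) auto

lemma polyfun_power: "polyfun UNIV f \<Longrightarrow> polyfun UNIV (\<lambda>A. f A ^ k)"
  by (induction k) (auto intro: polyfun.intros)

lemma polyfun_diff:
  assumes "polyfun UNIV f" "polyfun UNIV g"
  shows "polyfun UNIV (\<lambda>A. f A - g A)"
proof -
  have "polyfun UNIV (\<lambda>A. f A + (- 1) * g A)"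
    by (intro polyfun.intros assms) auto
  then show ?thesis by simp
qed

lemma differential_eq:
  fixes F :: "complex^'n^'n \<Rightarrow> complex^'v^'v"
  assumes one: "mat 1 \<in> G" and X: "X \<in> lie_algebra G"
    and F: "gl_regular UNIV F" and F_eq: "\<forall>g\<in>G. F g = \<pi> g"
    and inv: "\<forall>g\<in>G. invertible g"
  shows "differential G \<pi> X = (\<chi> i j. dir_deriv (\<lambda>g. F g $ i $ j) X)"
proof -
  define D where "D = (\<lambda>z. det (mat 1 + cscale z X))"
  have D0: "D 0 = 1"
    by (simp add: D_def)
  have D_holo: "D field_differentiable (at z)" for z
    unfolding D_def by (rule polyfun_differentiable[OF polyfun_det])
  have "continuous (at 0) D"
    by (rule field_differentiable_imp_continuous_at) (rule D_holo)
  then have ev: "eventually (\<lambda>z. D z \<noteq> 0) (nhds 0)"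
    using tendsto_imp_eventually_ne[of D "D 0" "at 0" 0] D0
    by (auto simp: isCont_def eventually_nhds_conv_at)
  have "dir_deriv (\<lambda>g. F' g $ i $ j) X = dir_deriv (\<lambda>g. F g $ i $ j) X"
    if F': "gl_regular UNIV F'" "\<forall>g\<in>G. F' g = \<pi> g" for F' :: "complex^'n^'n \<Rightarrow> complex^'v^'v" and i j
  proof -
    obtain p k where p: "polyfun UNIV p" "\<And>g. invertible g \<Longrightarrow> F g $ i $ j = p g / det g ^ k"
      using F unfolding gl_regular_def by metis
    obtain p' k' where p': "polyfun UNIV p'" "\<And>g. invertible g \<Longrightarrow> F' g $ i $ j = p' g / det g ^ k'"
      using F' unfolding gl_regular_def by metis
    define P where "P = (\<lambda>z. p (mat 1 + cscale z X))"
    define P' where "P' = (\<lambda>z. p' (mat 1 + cscale z X))"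
    have P: "P field_differentiable (at z)" and P': "P' field_differentiable (at z)" for z
      unfolding P_def P'_def by (rule polyfun_differentiable, fact)+
    have "polyfun UNIV (\<lambda>A. p A * det A ^ k' - p' A * det A ^ k)"
      by (intro polyfun_diff polyfun.mult polyfun_power polyfun_det p p')
    moreover have van: "p g * det g ^ k' - p' g * det g ^ k = 0" if "g \<in> G" for g
    proof -
      have "p g / det g ^ k = p' g / det g ^ k'"
        using p(2) p'(2) inv F_eq F'(2) that by metis
      moreover have "det g \<noteq> 0" using inv that invertible_det_nz by blast
      ultimately show ?thesis by (simp add: field_simps)
    qed
    ultimately have "dir_deriv (\<lambda>A. p A * det A ^ k' - p' A * det A ^ k) X = 0"
      using X unfolding lie_algebra_def by blast
    then have "deriv (\<lambda>z. P z * D z ^ k' - P' z * D z ^ k) 0 = 0"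
      by (simp add: dir_deriv_def P_def P'_def D_def)
    moreover have "P 0 = P' 0"
      using van[OF one] by (simp add: P_def P'_def)
    moreover
    obtain d e e' where der: "(D has_field_derivative d) (at 0)"
      "(P has_field_derivative e) (at 0)" "(P' has_field_derivative e') (at 0)"
      using D_holo P P' unfolding field_differentiable_def by blast
    have dd: "((\<lambda>z. D z ^ n) has_field_derivative of_nat n * d) (at 0)" for n
      using DERIV_power[OF der(1), of n] by (simp add: D0)
    have "((\<lambda>z. P z * D z ^ k' - P' z * D z ^ k) has_field_derivative
        (e + P 0 * (of_nat k' * d)) - (e' + P' 0 * (of_nat k * d))) (at 0)"
      using DERIV_diff[OF DERIV_mult[OF der(2) dd[of k']] DERIV_mult[OF der(3) dd[of k]]]
      by (simp add: D0 algebra_simps)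
    ultimately have eq: "e + P 0 * (of_nat k' * d) = e' + P 0 * (of_nat k * d)"
      by (simp add: DERIV_imp_deriv)
    have gl: "invertible (mat 1 + cscale z X)" if "D z \<noteq> 0" for z
      using that by (simp add: D_def invertible_det_nz)
    have "dir_deriv (\<lambda>g. F g $ i $ j) X = deriv (\<lambda>z. P z / D z ^ k) 0"
      unfolding dir_deriv_def
      by (rule deriv_cong_ev[OF eventually_mono[OF ev]]) (auto simp: P_def D_def p gl)
    also have "\<dots> = e - P 0 * (of_nat k * d)"
      using DERIV_divide[OF der(2) dd[of k]] by (intro DERIV_imp_deriv) (simp add: D0)
    also have "\<dots> = e' - P' 0 * (of_nat k' * d)"
      using eq \<open>P 0 = P' 0\<close> by (simp add: algebra_simps)
    also have "\<dots> = deriv (\<lambda>z. P' z / D z ^ k') 0"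
      using DERIV_divide[OF der(3) dd[of k']] by (intro DERIV_imp_deriv [symmetric]) (simp add: D0)
    also have "\<dots> = dir_deriv (\<lambda>g. F' g $ i $ j) X"
      unfolding dir_deriv_def
      by (rule deriv_cong_ev[OF eventually_mono[OF ev]]) (auto simp: P'_def D_def p' gl)
    finally show ?thesis by simp
  qed
  note indep = this
  show ?thesis
    unfolding differential_def
  proof (rule the_equality)
    show "\<exists>F'. gl_regular UNIV F' \<and> (\<forall>g\<in>G. F' g = \<pi> g) \<and>
        (\<chi> i j. dir_deriv (\<lambda>g. F g $ i $ j) X) = (\<chi> i j. dir_deriv (\<lambda>g. F' g $ i $ j) X)"
      using F F_eq by blast
  next
    fix Y
    assume "\<exists>F'. gl_regular UNIV F' \<and> (\<forall>g\<in>G. F' g = \<pi> g) \<and>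
        Y = (\<chi> i j. dir_deriv (\<lambda>g. F' g $ i $ j) X)"
    then obtain F' where F': "gl_regular UNIV F'" "\<forall>g\<in>G. F' g = \<pi> g"
      and Y: "Y = (\<chi> i j. dir_deriv (\<lambda>g. F' g $ i $ j) X)" by blast
    show "Y = (\<chi> i j. dir_deriv (\<lambda>g. F g $ i $ j) X)"
      unfolding Y by (simp only: indep[OF F'])
  qed
qed

section \<open>Hodge representations\<close>

text \<open>
  The circle as a real algebraic group: regular functions on it are the restrictions of real
  polynomials in the real and imaginary part.
\<close>

definition circle_hom :: "(complex^'n^'n) set \<Rightarrow> (complex \<Rightarrow> complex^'n^'n) \<Rightarrow> bool" where
  "circle_hom G \<psi> \<longleftrightarrow> (\<forall>z\<in>sphere 0 1. \<psi> z \<in> real_points G) \<and>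
     (\<forall>z\<in>sphere 0 1. \<forall>u\<in>sphere 0 1. \<psi> (z * u) = \<psi> z ** \<psi> u) \<and>
     (\<forall>i j. \<exists>p. real_polynomial_function p \<and> (\<forall>z\<in>sphere 0 1. \<psi> z $ i $ j = of_real (p z)))"

definition bilinear_form :: "'a::comm_ring_1^'v^'v \<Rightarrow> 'a^'v \<Rightarrow> 'a^'v \<Rightarrow> 'a" where
  "bilinear_form Q u v = (\<Sum>i\<in>UNIV. \<Sum>j\<in>UNIV. u $ i * Q $ i $ j * v $ j)"

definition complex_form :: "rat^'v^'v \<Rightarrow> complex^'v \<Rightarrow> complex^'v \<Rightarrow> complex" where
  "complex_form Q = bilinear_form (map_matrix of_rat Q)"

definition aut_form :: "rat^'v^'v \<Rightarrow> (complex^'v^'v) set" where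
  "aut_form Q = {A. invertible A \<and>
     (\<forall>u v. complex_form Q (A *v u) (A *v v) = complex_form Q u v)}"

definition polarization_form :: "rat^'v^'v \<Rightarrow> int \<Rightarrow> bool" where
  "polarization_form Q w \<longleftrightarrow>
     (\<forall>u. (\<forall>v. bilinear_form Q u v = 0) \<longrightarrow> u = 0) \<and>
     (\<forall>u v. bilinear_form Q u v = (- 1) powi w * bilinear_form Q v u)"

definition cnj_vec :: "complex^'v \<Rightarrow> complex^'v" where
  "cnj_vec v = (\<chi> i. cnj (v $ i))"

definition polarized_hodge_structure ::
    "rat^'v^'v \<Rightarrow> int \<Rightarrow> (complex \<Rightarrow> complex^'v^'v) \<Rightarrow> bool" where
  "polarized_hodge_structure Q w \<psi> \<longleftrightarrow> polarization_form Q w \<and>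
     circle_hom (aut_form Q) \<psi> \<and> \<not> \<psi> constant_on sphere 0 1 \<and>
     \<psi> (- 1) = cscale ((- 1) powi w) (mat 1) \<and>
     (\<forall>v. v \<noteq> 0 \<longrightarrow> complex_form Q v (\<psi> \<i> *v cnj_vec v) \<in> \<real> \<and>
                    0 < Re (complex_form Q v (\<psi> \<i> *v cnj_vec v)))"

definition hodge_space :: "(complex \<Rightarrow> complex^'v^'v) \<Rightarrow> int \<Rightarrow> int \<Rightarrow> (complex^'v) set" where
  "hodge_space \<psi> p q = {v. \<forall>z\<in>sphere 0 1. \<psi> z *v v = z powi (p - q) *s v}"

text \<open>
  \<open>G\<close> is a Hodge group if some tuple satisfies the following predicate.
\<close>

definition hodge_representation ::
    "(complex^'n^'n) set \<Rightarrow> rat^'v^'v \<Rightarrow> int \<Rightarrow> (complex^'n^'n \<Rightarrow> complex^'v^'v)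
      \<Rightarrow> (complex \<Rightarrow> complex^'n^'n) \<Rightarrow> bool" where
  "hodge_representation G Q w \<pi> \<phi> \<longleftrightarrow> algebraic_group \<rat> G \<and>
     algebraic_hom \<rat> G (aut_form Q) \<pi> \<and> inj_on (differential G \<pi>) (lie_algebra G) \<and>
     circle_hom G \<phi> \<and> \<not> \<phi> constant_on sphere 0 1 \<and>
     polarized_hodge_structure Q w (\<pi> \<circ> \<phi>)"

text \<open>
  Irreducibility of \<open>V\<^sub>\<real>\<close> as a module of the real algebraic group \<open>G\<^sub>\<real>\<close>: a submodule is a real
  subspace whose complexification is stable under the complex points. For connected \<open>G\<close> this is
  the same as stability under the real points, which are then Zariski dense; in general fewer
  subspaces are submodules in this sense.
\<close>

definition complexification :: "(real^'v) set \<Rightarrow> (complex^'v) set" where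
  "complexification W = {v. (\<chi> i. Re (v $ i)) \<in> W \<and> (\<chi> i. Im (v $ i)) \<in> W}"

definition irreducible_real_module ::
    "(complex^'n^'n) set \<Rightarrow> (complex^'n^'n \<Rightarrow> complex^'v^'v) \<Rightarrow> bool" where
  "irreducible_real_module G \<pi> \<longleftrightarrow> (\<forall>W. subspace W \<and>
     (\<forall>g\<in>G. \<forall>v\<in>complexification W. \<pi> g *v v \<in> complexification W) \<longrightarrow> W = {0} \<or> W = UNIV)"

text \<open>
  The grading element lies in \<open>\<i> \<cdot> g\<^sub>\<real>\<close> and acts on \<open>V\<^sup>p\<^sup>,\<^sup>q\<close> by \<open>(p - q) / 2\<close>. It is unique, since
  \<open>V\<^sub>\<complex>\<close> is the sum of the \<open>V\<^sup>p\<^sup>,\<^sup>q\<close> and the differential of \<open>\<pi>\<close> is injective; it is the derivative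
  of \<open>\<phi>\<close> along the circle at 1, divided by \<open>2 \<cdot> \<i>\<close>.
\<close>

definition grading_element ::
    "(complex^'n^'n) set \<Rightarrow> int \<Rightarrow> (complex^'n^'n \<Rightarrow> complex^'v^'v)
      \<Rightarrow> (complex \<Rightarrow> complex^'n^'n) \<Rightarrow> complex^'n^'n \<Rightarrow> bool" where
  "grading_element G w \<pi> \<phi> T \<longleftrightarrow>
     (\<exists>X\<in>real_points (lie_algebra G). T = cscale \<i> X) \<and>
     (\<forall>p q. p + q = w \<longrightarrow> (\<forall>v\<in>hodge_space (\<pi> \<circ> \<phi>) p q.
        differential G \<pi> T *v v = (of_int (p - q) / 2) *s v))"

definition grading_eigenspace ::
    "(complex^'n^'n) set \<Rightarrow> (complex^'n^'n \<Rightarrow> complex^'v^'v) \<Rightarrow> complex^'n^'n \<Rightarrow> real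
      \<Rightarrow> (complex^'v) set" where
  "grading_eigenspace G \<pi> T l = {v. differential G \<pi> T *v v = of_real l *s v}"

definition principal ::
    "(complex^'n^'n) set \<Rightarrow> (complex^'n^'n \<Rightarrow> complex^'v^'v) \<Rightarrow> complex^'n^'n \<Rightarrow> bool" where
  "principal G \<pi> T \<longleftrightarrow> (\<exists>m. grading_eigenspace G \<pi> T m \<noteq> {0} \<and>
     (\<forall>l>m. grading_eigenspace G \<pi> T l = {0}) \<and>
     (\<forall>k::nat. real k \<le> 2 * m \<longrightarrow> vec.dim (grading_eigenspace G \<pi> T (m - real k)) = 1))"

definition nonneg_ad_part ::
    "(complex^'n^'n) set \<Rightarrow> complex^'n^'n \<Rightarrow> (complex^'n^'n) set" where
  "nonneg_ad_part g T =
     cmat.span (\<Union>l\<in>{0::real..}. {X\<in>g. bracket T X = cscale (of_real l) X})"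

definition compact_torus :: "(complex^'n^'n) set \<Rightarrow> bool" where
  "compact_torus S \<longleftrightarrow> matrix_group S \<and> compact S \<and> connected S \<and>
     (\<forall>g\<in>S. \<forall>h\<in>S. g ** h = h ** g)"

text \<open>
  The last conjunct is the condition \<open>dim S = rank G\<^sub>\<real>\<close>, the rank being the dimension of a Cartan
  subalgebra of the complex Lie algebra.
\<close>

definition compact_maximal_torus :: "(complex^'n^'n) set \<Rightarrow> (complex^'n^'n) set \<Rightarrow> bool" where
  "compact_maximal_torus G S \<longleftrightarrow> compact_torus S \<and> S \<subseteq> real_points G \<and>
     (\<forall>S'. compact_torus S' \<and> S' \<subseteq> real_points G \<and> S \<subseteq> S' \<longrightarrow> S' = S) \<and>
     cartan_subalgebra (lie_algebra G) (lie_algebra S)"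

text \<open>
  \<open>V\<^sub>\<complex>\<close> is isomorphic, as a module over \<open>g\<^sub>\<complex>\<close> identified with \<open>sl4\<close> through \<open>\<iota>\<close>, to the sum of
  the standard module and its dual; on the dual a matrix \<open>A\<close> acts by minus its transpose.
\<close>

definition iso_standard_plus_dual ::
    "(complex^'n^'n) set \<Rightarrow> (complex^'n^'n \<Rightarrow> complex^'v^'v) \<Rightarrow> (complex^'n^'n \<Rightarrow> complex^4^4)
      \<Rightarrow> bool" where
  "iso_standard_plus_dual G \<pi> \<iota> \<longleftrightarrow> (\<exists>F :: complex^'v \<Rightarrow> (complex^4) \<times> (complex^4). bij F \<and>
     (\<forall>u v. F (u + v) = F u + F v) \<and>
     (\<forall>c v. F (c *s v) = (c *s fst (F v), c *s snd (F v))) \<and>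
     (\<forall>X\<in>lie_algebra G. \<forall>v. F (differential G \<pi> X *v v) =
        (\<iota> X *v fst (F v), - (transpose (\<iota> X) *v snd (F v)))))"

end

theory Submission
  imports Defs "HOL-Computational_Algebra.Fundamental_Theorem_Algebra"
begin

text \<open>
  The grading element lies in the Cartan subalgebra, where it is \<open>diag t\<close> with \<open>t 1 \<ge> t 2 \<ge> t 3 \<ge> t 4\<close>, so
  it acts on the weight space of \<open>\<mu>\<close> by the level \<open>\<Sum>k. t k * \<mu> k\<close>. If the representation is principal,
  distinct weights have distinct levels and all weight spaces are lines. Multiplicity one excludes the
  weight zero (every root string through it would have the same length in each \<open>sl\<^sub>3\<close>) and forces
  highest weights to be multiples of one fundamental weight. As zero is no weight, the levels are half
  integers, the weight of the Hodge structure is odd and the polarization is skew; hence the weights of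
  \<open>\<Lambda>\<^sup>2 \<complex>\<^sup>4\<close> do not occur, which leaves multiples of the first and the last fundamental weight. After
  passing to the dual if necessary, the top level belongs to \<open>a \<omega>\<^sub>1\<close>. The weight one level below the top is
  again a highest weight, which can only be the dual weight \<open>a \<omega>\<^sub>3\<close>; hence \<open>a (t 1 + t 4) = 1\<close>, and \<open>a = 1\<close>
  because \<open>2 \<omega>\<^sub>1\<close> has weights of \<open>\<Lambda>\<^sup>2 \<complex>\<^sup>4\<close> below it. Comparing the next levels shows that only the
  weights of \<open>\<complex>\<^sup>4\<close> and \<open>(\<complex>\<^sup>4)\<^sup>*\<close> occur and determines \<open>t\<close>.
\<close>

section \<open>Strings of one-dimensional weight spaces\<close>

text \<open>In a principal grading every eigenspace is a line, so an operator that preserves the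
  level acts on each of them by a scalar. Hence every eigenvector of the grading element is a weight
  vector, and any word in root operators that returns to its starting level is a scalar there. All
  root string arguments rest on this. The second difficulty is to reach coordinates at all. The
  isomorphism with \<open>sl4\<close> is arbitrary, and the Cartan subalgebra is known only as
  nilpotent and self-normalizing, so its elements must first be diagonalized together. The element
  100 T^1 + 10 T^2 + T^3 serves for this: root vectors shift its eigenvalues by 100, 10 and 1, which
  forces four distinct eigenvalues in dimension four. The formula for \<omega>_1 in terms of the
  simple roots then fixes the orientation of the Dynkin diagram, that is, it separates the standard
  module from its dual. On the group side no basis of the Lie algebra is available; each identity is
  derived by writing it as a polynomial that vanishes on the group and applying tangent vectors to
  it.\<close>

locale sl2_triple =
  fixes e f h :: "complex^'v \<Rightarrow> complex^'v"
  assumes e_add: "e (x + y) = e x + e y" and e_scale: "e (c *s x) = c *s e x"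
    and f_add: "f (x + y) = f x + f y" and f_scale: "f (c *s x) = c *s f x"
    and h_scale: "h (c *s x) = c *s h x"
    and ef: "e (f x) = f (e x) + h x"
    and he: "h (e x) = e (h x) + 2 *s e x"
    and hf: "h (f x) = f (h x) - 2 *s f x"
begin

lemma f_zero: "f 0 = 0" and e_zero: "e 0 = 0"
  using f_scale[of 0 0] e_scale[of 0 0] by simp_all

lemma f_pow_scale: "(f ^^ k) (c *s x) = c *s (f ^^ k) x"
  and e_pow_scale: "(e ^^ k) (c *s x) = c *s (e ^^ k) x"
  by (induction k) (simp_all add: f_scale e_scale)

lemma f_pow_zero: "(f ^^ k) 0 = 0" and e_pow_zero: "(e ^^ k) 0 = 0"
  by (induction k) (simp_all add: f_zero e_zero)

lemma e_neg: "e (- x) = - e x" and f_neg: "f (- x) = - f x"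
  using e_scale[of "- 1" x] f_scale[of "- 1" x] by simp_all

lemma h_pow_f: "h x = c *s x \<Longrightarrow> h ((f ^^ k) x) = (c - 2 * of_nat k) *s (f ^^ k) x"
proof (induction k)
  case (Suc k)
  have "f (h ((f ^^ k) x)) = (c - 2 * of_nat k) *s f ((f ^^ k) x)"
    using Suc by (simp only: f_scale)
  then show ?case by (simp add: hf vec_eq_iff algebra_simps)
qed simp

lemma h_pow_e: "h x = c *s x \<Longrightarrow> h ((e ^^ k) x) = (c + 2 * of_nat k) *s (e ^^ k) x"
proof (induction k)
  case (Suc k)
  have "e (h ((e ^^ k) x)) = (c + 2 * of_nat k) *s e ((e ^^ k) x)"
    using Suc by (simp only: e_scale)
  then show ?case by (simp add: he vec_eq_iff algebra_simps)
qed simp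

lemma e_f_pow:
  assumes "e u = 0" "h u = d *s u"
  shows "e ((f ^^ Suc k) u) = (of_nat (Suc k) * (d - of_nat k)) *s (f ^^ k) u"
proof (induction k)
  case 0
  then show ?case by (simp add: ef assms f_zero)
next
  case (Suc k)
  have "e ((f ^^ Suc (Suc k)) u) = f (e ((f ^^ Suc k) u)) + h ((f ^^ Suc k) u)"
    using ef by simp
  also have "\<dots> = (of_nat (Suc k) * (d - of_nat k)) *s (f ^^ Suc k) u
      + (d - 2 * of_nat (Suc k)) *s (f ^^ Suc k) u"
    by (simp only: Suc.IH f_scale h_pow_f[OF assms(2)]) simp
  finally show ?case
    by (simp add: vec_eq_iff algebra_simps)
qed

lemma first_zero:
  fixes g :: "complex^'v \<Rightarrow> complex^'v"
  assumes "x \<noteq> 0" "(g ^^ n) x = 0"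
  obtains p where "(g ^^ p) x \<noteq> 0" "(g ^^ Suc p) x = 0"
proof -
  define q where "q = (LEAST n. (g ^^ n) x = 0)"
  have q: "(g ^^ q) x = 0" unfolding q_def using assms(2) by (rule LeastI)
  with assms(1) have "q \<noteq> 0" by (cases q) auto
  then obtain p where p: "q = Suc p" using not0_implies_Suc by blast
  moreover have "(g ^^ p) x \<noteq> 0"
    using not_less_Least[of p "\<lambda>n. (g ^^ n) x = 0"] p by (auto simp: q_def)
  ultimately show ?thesis using that q by blast
qed

text \<open>Applying \<open>e\<close> to the first vanishing power \<open>(f ^^ Suc q) u\<close> and
  using \<open>e_f_pow\<close> gives (q+1)(d-q) = 0, so the weight of \<open>u\<close> is the length
  of its string.\<close>

lemma highest_string:
  assumes u: "u \<noteq> 0" "e u = 0" "h u = d *s u" and nil: "(f ^^ n) u = 0"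
  obtains q where "d = of_nat q" "\<And>k. k \<le> q \<Longrightarrow> (f ^^ k) u \<noteq> 0" "(f ^^ Suc q) u = 0"
proof -
  obtain q where q: "(f ^^ q) u \<noteq> 0" "(f ^^ Suc q) u = 0"
    using first_zero[OF u(1) nil] .
  have "(of_nat (Suc q) * (d - of_nat q)) *s (f ^^ q) u = 0"
    using e_f_pow[OF u(2,3), of q] q(2) by (simp add: e_zero del: funpow.simps)
  then have "of_nat (Suc q) * (d - of_nat q) = 0"
    using q(1) by (simp only: vec.scale_eq_0_iff) simp
  then have "d = of_nat q" by (simp del: of_nat_Suc)
  moreover have "(f ^^ k) u \<noteq> 0" if "k \<le> q" for k
  proof
    assume "(f ^^ k) u = 0"
    moreover have "(f ^^ q) u = (f ^^ (q - k)) ((f ^^ k) u)"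
      using that funpow_add[of "q - k" k f] by simp
    ultimately show False using q(1) by (simp add: f_pow_zero)
  qed
  ultimately show ?thesis using that q(2) by blast
qed

lemma opposite: "sl2_triple f e (\<lambda>x. - h x)"
  by unfold_locales
    (simp_all add: e_add e_scale f_add f_scale h_scale ef he hf e_neg f_neg vec_eq_iff)

text \<open>
  The string through \<open>v\<close>: \<open>d\<close> is the highest weight of the irreducible module generated by \<open>v\<close>, and
  \<open>v\<close> lies \<open>p\<close> steps below its top. Only the weight spaces reached by going up and back down (or
  down and back up) need to be lines.
\<close>

lemma string:
  assumes v: "v \<noteq> 0" "h v = c *s v"
    and line: "\<And>k. \<exists>\<kappa>. (f ^^ k) ((e ^^ k) v) = \<kappa> *s v" "\<And>k. \<exists>\<kappa>. (e ^^ k) ((f ^^ k) v) = \<kappa> *s v"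
    and nil: "\<exists>n. (e ^^ n) v = 0" "\<exists>n. (f ^^ n) v = 0"
      "\<And>k. \<exists>n. (f ^^ n) ((e ^^ k) v) = 0" "\<And>k. \<exists>n. (e ^^ n) ((f ^^ k) v) = 0"
  obtains d p :: nat where "p \<le> d" "c = of_nat d - 2 * of_nat p"
    "\<And>k. k \<le> p \<Longrightarrow> (e ^^ k) v \<noteq> 0" "(e ^^ Suc p) v = 0"
    "\<And>k. k \<le> d - p \<Longrightarrow> (f ^^ k) v \<noteq> 0"
    "e (f v) = (of_nat (Suc p) * (of_nat d - of_nat p)) *s v"
proof -
  obtain n where n: "(e ^^ n) v = 0" using nil by blast
  obtain p where p: "(e ^^ p) v \<noteq> 0" "(e ^^ Suc p) v = 0"
    using first_zero[OF v(1) n] .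
  have e_le: "(e ^^ k) v \<noteq> 0" if "k \<le> p" for k
  proof
    assume "(e ^^ k) v = 0"
    moreover have "(e ^^ p) v = (e ^^ (p - k)) ((e ^^ k) v)"
      using that funpow_add[of "p - k" k e] by simp
    ultimately show False using p(1) by (simp add: e_pow_zero)
  qed
  define u where "u = (e ^^ p) v"
  have u: "u \<noteq> 0" "e u = 0" "h u = (c + 2 * of_nat p) *s u"
    using p h_pow_e[OF v(2)] by (simp_all add: u_def)
  obtain n where n: "(f ^^ n) u = 0" using nil(3) by (metis u_def)
  obtain d where d: "c + 2 * of_nat p = of_nat d" "\<And>k. k \<le> d \<Longrightarrow> (f ^^ k) u \<noteq> 0"
    using highest_string[OF u n] by metis
  have c: "c = of_nat d - 2 * of_nat p" using d(1) by (simp add: algebra_simps)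
  \<comment> \<open>The same analysis from the bottom of the string gives a length \<open>d'\<close>
    with 2p + 2p' = d + d'. If d < p, then d' is at least p' + p + 1, so one can climb p + 1 steps
    beyond \<open>v\<close>, against the choice of \<open>p\<close>.\<close>
  have "p \<le> d"
  proof (rule ccontr)
    assume "\<not> p \<le> d"
    then have pd: "d < p" by simp
    interpret op: sl2_triple f e "\<lambda>x. - h x" by (rule opposite)
    obtain n where n: "(f ^^ n) v = 0" using nil by blast
    obtain p' where p': "(f ^^ p') v \<noteq> 0" "(f ^^ Suc p') v = 0"
      using first_zero[OF v(1) n] .
    define u' where "u' = (f ^^ p') v"
    have u': "u' \<noteq> 0" "f u' = 0" "- h u' = (2 * of_nat p' - c) *s u'"
      using p' h_pow_f[OF v(2), of p'] by (simp_all add: u'_def vec_eq_iff algebra_simps)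
    obtain n where n: "(e ^^ n) u' = 0" using nil(4) by (metis u'_def)
    obtain d' where d': "2 * of_nat p' - c = of_nat d'" "\<And>k. k \<le> d' \<Longrightarrow> (e ^^ k) u' \<noteq> 0"
      using op.highest_string[OF u' n] by metis
    have "of_nat (2 * p' + 2 * p) = (of_nat (d + d') :: complex)"
      using d'(1) c by (simp add: algebra_simps)
    then have eq: "2 * p' + 2 * p = d + d'" by (simp only: of_nat_eq_iff)
    obtain \<kappa> where \<kappa>: "(e ^^ p') u' = \<kappa> *s v" using line(2) by (metis u'_def)
    have "p' + Suc p \<le> d'" using eq pd by simp
    then have "(e ^^ (Suc p + p')) u' \<noteq> 0" using d'(2) by (metis add.commute)
    then have "(e ^^ Suc p) (\<kappa> *s v) \<noteq> 0" using \<kappa> funpow_add[of "Suc p" p' e] by (metis comp_apply)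
    then show False using p(2) by (simp add: e_pow_scale e_scale del: funpow.simps)
  qed
  \<comment> \<open>Descending from the top by \<open>p\<close> steps returns a nonzero multiple of
    \<open>v\<close>, so what is known along the chain below \<open>u\<close> passes to
    \<open>v\<close>.\<close>
  obtain \<kappa> where \<kappa>: "(f ^^ p) u = \<kappa> *s v" using line(1) by (metis u_def)
  have "\<kappa> \<noteq> 0" using d(2)[OF \<open>p \<le> d\<close>] \<kappa> by auto
  have f_le: "(f ^^ k) v \<noteq> 0" if "k \<le> d - p" for k
  proof -
    have "(f ^^ (k + p)) u \<noteq> 0" using d(2) that \<open>p \<le> d\<close> by simp
    then have "(f ^^ k) (\<kappa> *s v) \<noteq> 0" using \<kappa> funpow_add[of k p f] by simp
    then show ?thesis by (auto simp: f_pow_scale)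
  qed
  have "e (f (\<kappa> *s v)) = e ((f ^^ Suc p) u)" by (simp add: \<kappa>)
  also have "\<dots> = (of_nat (Suc p) * (of_nat d - of_nat p)) *s (\<kappa> *s v)"
    using e_f_pow[OF u(2,3), of p] d(1) \<kappa> by simp
  finally have "\<kappa> *s e (f v) = \<kappa> *s ((of_nat (Suc p) * (of_nat d - of_nat p)) *s v)"
    by (simp add: e_scale f_scale vec_eq_iff mult_ac)
  then have "e (f v) = (of_nat (Suc p) * (of_nat d - of_nat p)) *s v"
    using \<open>\<kappa> \<noteq> 0\<close> vec.scale_cancel_left by blast
  with that[OF \<open>p \<le> d\<close> c e_le p(2) f_le] show ?thesis by blast
qed

end

section \<open>Principal gradings of self-dual modules\<close>

text \<open>
  \<open>E i j\<close> is the action of the matrix unit of \<open>gl\<^sub>4\<close>, with scalar matrices acting by zero. The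
  grading element is the diagonal matrix with entries \<open>t\<close>; its eigenvalues on the module are
  \<open>N/2, N/2 - 1, \<dots>, - N/2\<close>, each simple. \<open>B\<close> is the invariant form, of sign \<open>s\<close>.
\<close>

locale principal_module =
  fixes E :: "4 \<Rightarrow> 4 \<Rightarrow> complex^'v \<Rightarrow> complex^'v" and t :: "4 \<Rightarrow> real"
    and B :: "complex^'v \<Rightarrow> complex^'v \<Rightarrow> complex" and s :: complex and N :: nat
  assumes E_add: "E i j (x + y) = E i j x + E i j y"
    and E_scale: "E i j (c *s x) = c *s E i j x"
    and comm: "E i j (E p q x) = E p q (E i j x) + (if j = p then E i q x else 0)
        - (if q = i then E p j x else 0)"
    and trace0: "(\<Sum>k\<in>UNIV. E k k x) = 0"
    and t_mono: "t 1 \<ge> t 2" "t 2 \<ge> t 3" "t 3 \<ge> t 4" and t_sum: "(\<Sum>k\<in>UNIV. t k) = 0"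
    and B_add: "B (x + y) z = B x z + B y z" and B_scale: "B (c *s x) z = c * B x z"
    and B_sym: "B x y = s * B y x"
    and B_inv: "B (E i j x) y = - B x (E i j y)"
    and B_nondeg: "x \<noteq> 0 \<Longrightarrow> \<exists>y. B x y \<noteq> 0"
    and spanning: "x \<in> vec.span {v. \<exists>l. (\<Sum>k\<in>UNIV. of_real (t k) *s E k k v) = of_real l *s v}"
    and simple: "x \<noteq> 0 \<Longrightarrow> (\<Sum>k\<in>UNIV. of_real (t k) *s E k k x) = of_real l *s x \<Longrightarrow>
        (\<Sum>k\<in>UNIV. of_real (t k) *s E k k y) = of_real l *s y \<Longrightarrow> \<exists>c. y = c *s x"
    and level_range: "x \<noteq> 0 \<Longrightarrow> (\<Sum>k\<in>UNIV. of_real (t k) *s E k k x) = of_real l *s x \<Longrightarrow>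
        \<exists>k\<le>N. l = real N / 2 - real k"
    and level_ex: "n \<le> N \<Longrightarrow>
        \<exists>x. x \<noteq> 0 \<and> (\<Sum>k\<in>UNIV. of_real (t k) *s E k k x) = of_real (real N / 2 - real n) *s x"
    and sign: "odd N \<Longrightarrow> s = - 1"
    and no_invariants: "(\<And>i j. E i j x = 0) \<Longrightarrow> x = 0"
    and nontrivial: "i \<noteq> j \<Longrightarrow> \<exists>x. E i j x \<noteq> 0"
begin

section \<open>Levels, weights and root strings of the graded module\<close>

definition lev :: "real \<Rightarrow> complex^'v \<Rightarrow> bool" where
  "lev l x \<longleftrightarrow> (\<Sum>k\<in>UNIV. of_real (t k) *s E k k x) = of_real l *s x"

lemma E_zero: "E i j 0 = 0"
  using E_scale[of i j 0 0] by simp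

lemma E_neg: "E i j (- x) = - E i j x"
  using E_scale[of i j "- 1" x] by simp

lemma E_diff: "E i j (x - y) = E i j x - E i j y"
  using E_add[of i j x "- y"] by (simp add: E_neg)

lemma E_sum: "E i j (\<Sum>k\<in>A. g k) = (\<Sum>k\<in>A. E i j (g k))"
  by (induction A rule: infinite_finite_induct) (simp_all add: E_zero E_add)

lemma B_add_right: "B x (y + z) = B x y + B x z" and B_scale_right: "B x (c *s y) = c * B x y"
  using B_sym[of x "y + z"] B_sym[of x y] B_sym[of x z] B_sym[of x "c *s y"]
  by (simp_all add: B_add B_scale algebra_simps)

lemma B_zero_right: "B x 0 = 0"
  using B_scale_right[of x 0 0] by simp

lemma grading_E:
  "(\<Sum>k\<in>UNIV. of_real (t k) *s E k k (E i j x)) =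
     E i j (\<Sum>k\<in>UNIV. of_real (t k) *s E k k x) + of_real (t i - t j) *s E i j x"
proof -
  have "(\<Sum>k\<in>UNIV. of_real (t k) *s E k k (E i j x)) =
    (\<Sum>k\<in>UNIV. of_real (t k) *s E i j (E k k x)) +
    (\<Sum>k\<in>UNIV. if k = i then of_real (t k) *s E i j x else 0) -
    (\<Sum>k\<in>UNIV. if k = j then of_real (t k) *s E i j x else 0)"
    unfolding sum.distrib[symmetric] sum_subtractf[symmetric]
  proof (rule sum.cong[OF refl])
    fix k
    show "of_real (t k) *s E k k (E i j x) = of_real (t k) *s E i j (E k k x) +
        (if k = i then of_real (t k) *s E i j x else 0) -
        (if k = j then of_real (t k) *s E i j x else 0)"
    proof -
      have "E k k (E i j x) = E i j (E k k x) + (if k = i then E i j x else 0) -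
          (if k = j then E i j x else 0)"
        using comm[of k k i j x] by auto
      then show ?thesis
        by (simp add: vec.scale_right_distrib vec.scale_right_diff_distrib)
    qed
  qed
  then show ?thesis
    by (simp add: E_sum E_scale vec.scale_left_diff_distrib)
qed

lemma lev_E: "lev l x \<Longrightarrow> lev (l + (t i - t j)) (E i j x)"
  by (simp add: lev_def grading_E E_scale vec.scale_left_distrib)

lemma lev_pow: "lev l x \<Longrightarrow> lev (l + real n * (t i - t j)) ((E i j ^^ n) x)"
proof (induction n)
  case (Suc n)
  have "l + real n * (t i - t j) + (t i - t j) = l + real (Suc n) * (t i - t j)"
    by (simp add: algebra_simps)
  then show ?case using lev_E[OF Suc.IH[OF Suc.prems], of i j] by (metis funpow.simps(2) comp_apply)
qed simp

lemma simple_lev: "x \<noteq> 0 \<Longrightarrow> lev l x \<Longrightarrow> lev l y \<Longrightarrow> \<exists>c. y = c *s x"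
  unfolding lev_def by (rule simple)

text \<open>Eigenvectors of the grading element span, so an additive map that kills all of them
  vanishes. The codomain is a bare abelian group because the lemma serves for the operators
  \<open>E i j\<close> and for the functional \<open>B v\<close> alike.\<close>

lemma ex_eigenvector:
  assumes add: "\<And>x y. P (x + y) = P x + (P y :: 'b::ab_group_add)"
    and scale: "\<And>c x. P x = 0 \<Longrightarrow> P (c *s x) = 0" and "P x \<noteq> 0"
  shows "\<exists>v l. lev l v \<and> P v \<noteq> 0"
proof (rule ccontr)
  assume none: "\<not> ?thesis"
  have "P x = 0"
    using spanning[of x]
  proof (induction rule: vec.span_induct_alt)
    case base
    have "P 0 = P 0 + P 0" using add[of 0 0] by simp
    then show ?case by simp
  next
    case (step c v y)
    then have "P v = 0" using none by (auto simp: lev_def)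
    with step show ?case by (simp add: add scale)
  qed
  with assms show False by simp
qed

text \<open>Some eigenvector survives \<open>E i j\<close>; its level before and after lies in N/2
  minus a natural number.\<close>

lemma t_diff_int: "t i - t j \<in> \<int>"
proof (cases "i = j")
  case False
  then obtain v l where v: "lev l v" "E i j v \<noteq> 0"
    using ex_eigenvector[of "E i j"] nontrivial E_add E_scale by (metis vec.scale_zero_right)
  then have "v \<noteq> 0" using E_zero by auto
  obtain k where "l = real N / 2 - real k" using level_range \<open>v \<noteq> 0\<close> v(1) unfolding lev_def by blast
  moreover obtain k' where "l + (t i - t j) = real N / 2 - real k'"
    using level_range v lev_E unfolding lev_def by blast
  ultimately have "t i - t j = real k - real k'" by simp
  then show ?thesis by simp
qed simp

lemma E_diag_eigen:
  assumes "v \<noteq> 0" "lev l v"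
  shows "\<exists>c. E k k v = c *s v"
  using simple_lev[OF assms] lev_E[OF assms(2), of k k] by simp

text \<open>With equal entries \<open>E i j\<close> would preserve a line on which
  \<open>E i i\<close> acts by a scalar, so the two would commute there; but their commutator is
  \<open>E i j\<close>, which is nonzero on a suitable line.\<close>

lemma t_neq:
  assumes "i \<noteq> j"
  shows "t i \<noteq> t j"
proof
  assume eq: "t i = t j"
  obtain v l where v: "lev l v" "E i j v \<noteq> 0"
    using ex_eigenvector[of "E i j"] nontrivial E_add E_scale assms by (metis vec.scale_zero_right)
  then have "v \<noteq> 0" using E_zero by auto
  obtain c where c: "E i j v = c *s v"
    using simple_lev[OF \<open>v \<noteq> 0\<close> v(1)] lev_E[OF v(1), of i j] eq by auto
  obtain a where a: "E i i v = a *s v" using E_diag_eigen \<open>v \<noteq> 0\<close> v(1) by blast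
  have "E i i (E i j v) = E i j (E i i v) + E i j v"
    using comm[of i i i j v] assms by simp
  then show False using a c v by (simp add: E_scale mult.commute)
qed

text \<open>Each application shifts the level by the same nonzero amount, and levels are
  bounded.\<close>

lemma nilpotent:
  assumes "lev l x" "i \<noteq> j"
  shows "\<exists>n. (E i j ^^ n) x = 0"
proof (rule ccontr)
  assume none: "\<not> ?thesis"
  have "\<bar>t i - t j\<bar> > 0" using t_neq[OF assms(2)] by simp
  then obtain n where n: "\<bar>l\<bar> + real N < real n * \<bar>t i - t j\<bar>"
    using reals_Archimedean3 by blast
  obtain k where k: "k \<le> N" "l + real n * (t i - t j) = real N / 2 - real k"
    using level_range none lev_pow[OF assms(1)] unfolding lev_def by blast
  have "real n * \<bar>t i - t j\<bar> = \<bar>real n * (t i - t j)\<bar>" by (simp add: abs_mult)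
  moreover have "\<bar>real N / 2 - real k\<bar> \<le> real N" using k by (auto simp: abs_if)
  ultimately show False using n k by linarith
qed

definition wv :: "(4 \<Rightarrow> real) \<Rightarrow> complex^'v \<Rightarrow> bool" where
  "wv \<mu> v \<longleftrightarrow> v \<noteq> 0 \<and> (\<forall>k. E k k v = of_real (\<mu> k) *s v)"

definition wts :: "(4 \<Rightarrow> real) set" where
  "wts = {\<mu>. \<exists>v. wv \<mu> v}"

definition lvl :: "(4 \<Rightarrow> real) \<Rightarrow> real" where
  "lvl \<mu> = (\<Sum>k\<in>UNIV. t k * \<mu> k)"

text \<open>Translation by the root of \<open>E i j\<close>. It is meant for
  \<open>i \<noteq> j\<close>; for equal indices the second update overrides the first.\<close>

definition sh :: "4 \<Rightarrow> 4 \<Rightarrow> (4 \<Rightarrow> real) \<Rightarrow> 4 \<Rightarrow> real" where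
  "sh i j \<mu> = \<mu>(i := \<mu> i + 1, j := \<mu> j - 1)"

text \<open>Going up and down equally often returns to level \<open>l\<close>, whose eigenspace is a
  line, so the hypotheses of \<open>string\<close> hold. Eigenvalues are complex here because the
  reality of weights is deduced from this lemma.\<close>

lemma string_complex:
  assumes "i \<noteq> j" "v \<noteq> 0" "lev l v" "E i i v = a *s v" "E j j v = b *s v"
  obtains d p :: nat where "p \<le> d" "a - b = of_nat d - 2 * of_nat p"
    "\<And>k. k \<le> p \<Longrightarrow> (E i j ^^ k) v \<noteq> 0" "(E i j ^^ Suc p) v = 0"
    "\<And>k. k \<le> d - p \<Longrightarrow> (E j i ^^ k) v \<noteq> 0"
    "E i j (E j i v) = (of_nat (Suc p) * (of_nat d - of_nat p)) *s v"
proof -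
  have comm2: "E i i (E i j x) = E i j (E i i x) + E i j x" "E i i (E j i x) = E j i (E i i x) - E j i x"
    "E j j (E i j x) = E i j (E j j x) - E i j x" "E j j (E j i x) = E j i (E j j x) + E j i x"
    "E i j (E j i x) = E j i (E i j x) + E i i x - E j j x" for x
    using comm[of i i i j x] comm[of i i j i x] comm[of j j i j x] comm[of j j j i x]
      comm[of i j j i x] assms(1) by simp_all
  interpret sl2_triple "E i j" "E j i" "\<lambda>x. E i i x - E j j x"
    by unfold_locales
      (simp_all add: E_add E_scale comm2(1-4) E_diff vec.scale_right_diff_distrib,
       simp_all add: comm2(5) vec_eq_iff)
  have down_up: "lev l ((E j i ^^ k) ((E i j ^^ k) v))" for k
    using lev_pow[OF lev_pow[OF assms(3), of k i j], of k j i] by (simp add: algebra_simps)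
  have up_down: "lev l ((E i j ^^ k) ((E j i ^^ k) v))" for k
    using lev_pow[OF lev_pow[OF assms(3), of k j i], of k i j] by (simp add: algebra_simps)
  show ?thesis
  proof (rule string[of v "a - b"])
    show "\<exists>\<kappa>. (E j i ^^ k) ((E i j ^^ k) v) = \<kappa> *s v" for k
      using simple_lev[OF assms(2,3) down_up] .
    show "\<exists>\<kappa>. (E i j ^^ k) ((E j i ^^ k) v) = \<kappa> *s v" for k
      using simple_lev[OF assms(2,3) up_down] .
    show "\<exists>n. (E i j ^^ n) v = 0" "\<exists>n. (E j i ^^ n) v = 0"
      using nilpotent assms by metis+
    show "\<exists>n. (E j i ^^ n) ((E i j ^^ k) v) = 0" "\<exists>n. (E i j ^^ n) ((E j i ^^ k) v) = 0" for k
      using nilpotent lev_pow assms by metis+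
  qed (use assms that in \<open>auto simp: vec.scale_left_diff_distrib\<close>)
qed

lemma wv_lev: "wv \<mu> v \<Longrightarrow> lev (lvl \<mu>) v"
  by (simp add: wv_def lev_def lvl_def vec.scale_sum_left)

text \<open>The operators \<open>E k k\<close> preserve the line of \<open>v\<close>, so
  \<open>v\<close> is a simultaneous eigenvector; the root strings make the differences of its
  eigenvalues integral.\<close>

lemma lev_wv:
  assumes "v \<noteq> 0" "lev l v"
  obtains \<mu> where "wv \<mu> v" "lvl \<mu> = l"
proof -
  obtain a where a: "E k k v = a k *s v" for k
    using E_diag_eigen[OF assms] by metis
  have "(\<Sum>k\<in>UNIV. a k) *s v = 0"
    using trace0[of v] by (simp add: a vec.scale_sum_left)
  then have sum: "(\<Sum>k\<in>UNIV. a k) = 0" using assms(1) by simp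
  have int: "a i - a j \<in> \<int>" for i j
  proof (cases "i = j")
    case False
    obtain d p :: nat where "a i - a j = of_nat d - 2 * of_nat p"
      using string_complex[OF False assms a a] by metis
    then show ?thesis by simp
  qed simp
  \<comment> \<open>The eigenvalues sum to zero, so four times each of them is a sum of integral
    differences.\<close>
  have "a i \<in> \<real>" for i
  proof -
    have "(\<Sum>j\<in>UNIV. a i - a j) = 4 * a i"
      using sum by (simp add: sum_subtractf)
    moreover have "(\<Sum>j\<in>UNIV. a i - a j) \<in> \<real>"
      using int by (intro sum_in_Reals) (metis Ints_cases Reals_of_int)
    ultimately have "4 * a i / 4 \<in> \<real>" by (intro Reals_divide) auto
    then show ?thesis by simp
  qed
  then have a_real: "of_real (Re (a i)) = a i" for i by simp
  define \<mu> where "\<mu> = (\<lambda>i. Re (a i))"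
  have wv: "wv \<mu> v" unfolding wv_def \<mu>_def using assms a a_real by simp
  have "of_real (lvl \<mu>) *s v = of_real l *s v"
    using wv_lev[OF wv] assms(2) unfolding lev_def by metis
  then have "complex_of_real (lvl \<mu>) = of_real l" using assms(1) vec.scale_cancel_right by blast
  then have "lvl \<mu> = l" by (simp only: of_real_eq_iff)
  with wv that show ?thesis by blast
qed

lemma wts_sum: "\<mu> \<in> wts \<Longrightarrow> (\<Sum>k\<in>UNIV. \<mu> k) = 0"
proof -
  assume "\<mu> \<in> wts"
  then obtain v where v: "wv \<mu> v" by (auto simp: wts_def)
  then have "of_real (\<Sum>k\<in>UNIV. \<mu> k) *s v = 0"
    using trace0[of v] by (simp add: wv_def vec.scale_sum_left)
  then show ?thesis using v by (simp add: wv_def del: of_real_sum)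
qed

lemma wv_unique:
  assumes "wv \<mu> v" "wv \<nu> v"
  shows "\<mu> = \<nu>"
proof
  fix k
  have "complex_of_real (\<mu> k) *s v = of_real (\<nu> k) *s v" using assms by (simp add: wv_def)
  then show "\<mu> k = \<nu> k" using assms by (simp add: wv_def)
qed

lemma wv_line:
  assumes "wv \<mu> v" "wv \<nu> w" "lvl \<mu> = lvl \<nu>"
  obtains c where "w = c *s v" "c \<noteq> 0" "\<mu> = \<nu>"
proof -
  obtain c where c: "w = c *s v"
    using simple_lev[of v "lvl \<mu>" w] wv_lev assms by (metis wv_def)
  then have "c \<noteq> 0" using assms by (auto simp: wv_def)
  then have "wv \<mu> w" using assms(1) c by (simp add: wv_def E_scale mult.commute)
  then show ?thesis using that c \<open>c \<noteq> 0\<close> wv_unique assms(2) by blast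
qed

lemma lvl_inj: "\<mu> \<in> wts \<Longrightarrow> \<nu> \<in> wts \<Longrightarrow> lvl \<mu> = lvl \<nu> \<Longrightarrow> \<mu> = \<nu>"
  unfolding wts_def using wv_line by blast

lemma lvl_range: "\<mu> \<in> wts \<Longrightarrow> \<exists>k\<le>N. lvl \<mu> = real N / 2 - real k"
  unfolding wts_def using wv_lev level_range unfolding lev_def wv_def by blast

lemma lvl_ex: "k \<le> N \<Longrightarrow> \<exists>\<mu>\<in>wts. lvl \<mu> = real N / 2 - real k"
  using level_ex[of k] lev_wv unfolding lev_def[symmetric] wts_def by (metis mem_Collect_eq)

lemma wv_E:
  assumes "wv \<mu> v" "E i j v \<noteq> 0" "i \<noteq> j"
  shows "wv (sh i j \<mu>) (E i j v)"
proof -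
  have "E k k (E i j v) = of_real (sh i j \<mu> k) *s E i j v" for k
  proof -
    have "E i j (E k k v) = of_real (\<mu> k) *s E i j v" using assms(1) by (simp add: wv_def E_scale)
    then show ?thesis
      using comm[of k k i j v] assms(3) by (auto simp: sh_def vec_eq_iff algebra_simps)
  qed
  then show ?thesis using assms by (simp add: wv_def)
qed

lemma wv_pow:
  assumes "wv \<mu> v" "i \<noteq> j"
  shows "(E i j ^^ n) v \<noteq> 0 \<Longrightarrow> wv (\<mu>(i := \<mu> i + real n, j := \<mu> j - real n)) ((E i j ^^ n) v)"
proof (induction n)
  case (Suc n)
  have nz: "(E i j ^^ n) v \<noteq> 0" using Suc.prems by (auto simp: E_zero)
  have "sh i j (\<mu>(i := \<mu> i + real n, j := \<mu> j - real n)) =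
    \<mu>(i := \<mu> i + real (Suc n), j := \<mu> j - real (Suc n))"
    using assms(2) by (auto simp: sh_def)
  moreover have "wv (sh i j (\<mu>(i := \<mu> i + real n, j := \<mu> j - real n))) ((E i j ^^ Suc n) v)"
    using wv_E[OF Suc.IH[OF nz] _ assms(2)] Suc.prems by (metis funpow.simps(2) comp_apply)
  ultimately show ?case by (simp only:)
qed (use assms in simp)

lemma string_wv:
  assumes "wv \<mu> v" "i \<noteq> j"
  obtains d p :: nat where "p \<le> d" "\<mu> i - \<mu> j = real d - 2 * real p"
    "\<And>k. k \<le> p \<Longrightarrow> (E i j ^^ k) v \<noteq> 0" "(E i j ^^ Suc p) v = 0"
    "\<And>k. k \<le> d - p \<Longrightarrow> (E j i ^^ k) v \<noteq> 0"
    "E i j (E j i v) = (of_nat (Suc p) * (of_nat d - of_nat p)) *s v"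
proof -
  have v: "v \<noteq> 0" "E i i v = of_real (\<mu> i) *s v" "E j j v = of_real (\<mu> j) *s v"
    using assms by (auto simp: wv_def)
  obtain d p :: nat where *: "p \<le> d" "of_real (\<mu> i) - of_real (\<mu> j) = (of_nat d - 2 * of_nat p :: complex)"
    "\<And>k. k \<le> p \<Longrightarrow> (E i j ^^ k) v \<noteq> 0" "(E i j ^^ Suc p) v = 0"
    "\<And>k. k \<le> d - p \<Longrightarrow> (E j i ^^ k) v \<noteq> 0"
    "E i j (E j i v) = (of_nat (Suc p) * (of_nat d - of_nat p)) *s v"
    using string_complex[OF assms(2) v(1) wv_lev[OF assms(1)] v(2,3)] by metis
  have "complex_of_real (\<mu> i - \<mu> j) = of_real (real d - 2 * real p)" using *(2) by simp
  then have "\<mu> i - \<mu> j = real d - 2 * real p" by (simp only: of_real_eq_iff)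
  with * that show ?thesis by blast
qed

text \<open>A vector \<open>p\<close> steps below the top of a string of length \<open>d\<close> has
  its mirror image \<bar>d - 2p\<bar> steps away, and every place of the string is occupied.\<close>

lemma wts_reflect:
  assumes "\<mu> \<in> wts"
  shows "\<mu> \<circ> Transposition.transpose i j \<in> wts"
proof (cases "i = j")
  case False
  obtain v where v: "wv \<mu> v" using assms by (auto simp: wts_def)
  obtain d p :: nat where dp: "p \<le> d" "\<mu> i - \<mu> j = real d - 2 * real p"
    "\<And>k. k \<le> p \<Longrightarrow> (E i j ^^ k) v \<noteq> 0" "\<And>k. k \<le> d - p \<Longrightarrow> (E j i ^^ k) v \<noteq> 0"
    using string_wv[OF v False] by metis
  show ?thesis
  proof (cases "2 * p \<le> d")
    case True
    then have "(E j i ^^ (d - 2 * p)) v \<noteq> 0" using dp by simp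
    then have "wv (\<mu>(j := \<mu> j + real (d - 2 * p), i := \<mu> i - real (d - 2 * p))) ((E j i ^^ (d - 2 * p)) v)"
      using wv_pow[OF v, of i j] wv_pow[OF v, of j i] False by blast
    moreover have "\<mu>(j := \<mu> j + real (d - 2 * p), i := \<mu> i - real (d - 2 * p)) =
        \<mu> \<circ> Transposition.transpose i j"
      using dp True False by (auto simp: Transposition.transpose_def fun_eq_iff)
    ultimately show ?thesis by (auto simp: wts_def)
  next
    case F: False
    then have "(E i j ^^ (2 * p - d)) v \<noteq> 0" using dp by simp
    then have "wv (\<mu>(i := \<mu> i + real (2 * p - d), j := \<mu> j - real (2 * p - d))) ((E i j ^^ (2 * p - d)) v)"
      using wv_pow[OF v, of i j] wv_pow[OF v, of j i] False by blast
    moreover have "\<mu>(i := \<mu> i + real (2 * p - d), j := \<mu> j - real (2 * p - d)) =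
        \<mu> \<circ> Transposition.transpose i j"
      using dp F False by (auto simp: Transposition.transpose_def fun_eq_iff)
    ultimately show ?thesis by (auto simp: wts_def)
  qed
qed (use assms in simp)

lemma wts_permute:
  assumes "bij p" "\<mu> \<in> wts"
  shows "\<mu> \<circ> p \<in> wts"
proof -
  have "p permutes UNIV" using assms(1) by (simp add: permutes_def bij_iff)
  then have "\<forall>\<mu>\<in>wts. \<mu> \<circ> p \<in> wts"
    using finite[of UNIV]
  proof (induction rule: permutes_induct)
    case (swap a b p)
    show ?case
    proof
      fix \<mu> assume "\<mu> \<in> wts"
      then have "\<mu> \<circ> Transposition.transpose a b \<in> wts" by (rule wts_reflect)
      then show "\<mu> \<circ> (Transposition.transpose a b \<circ> p) \<in> wts"
        using swap by (metis o_assoc)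
    qed
  qed simp
  then show ?thesis using assms by blast
qed

text \<open>A positive label puts the vector in the upper half of its string, so there is room for a
  step down.\<close>

lemma wts_saturated:
  assumes "\<mu> \<in> wts" "\<mu> i - \<mu> j \<ge> 1"
  shows "sh j i \<mu> \<in> wts"
proof -
  have "i \<noteq> j" using assms(2) by auto
  obtain v where v: "wv \<mu> v" using assms by (auto simp: wts_def)
  obtain d p :: nat where dp: "p \<le> d" "\<mu> i - \<mu> j = real d - 2 * real p"
    "\<And>k. k \<le> d - p \<Longrightarrow> (E j i ^^ k) v \<noteq> 0"
    using string_wv[OF v \<open>i \<noteq> j\<close>] by metis
  have "1 \<le> d - p" using assms(2) dp(1,2) by linarith
  then have "E j i v \<noteq> 0" using dp(3)[of 1] by simp
  then show ?thesis using wv_E[OF v] \<open>i \<noteq> j\<close> by (auto simp: wts_def)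
qed

text \<open>If \<open>E i j v\<close> were zero, \<open>v\<close> would be the top of its string
  with label \<open>d\<close>. A vector \<open>w\<close> of the neighbouring weight has label d + 2,
  so it is not at the bottom: \<open>E j i w\<close> is a nonzero multiple of \<open>v\<close> that
  \<open>E i j\<close> does not kill.\<close>

lemma wv_adjacent:
  assumes v: "wv \<mu> v" and "i \<noteq> j" and "sh i j \<mu> \<in> wts"
  shows "E i j v \<noteq> 0"
proof
  assume zero: "E i j v = 0"
  obtain d p :: nat where dp: "p \<le> d" "\<mu> i - \<mu> j = real d - 2 * real p"
    "\<And>k. k \<le> p \<Longrightarrow> (E i j ^^ k) v \<noteq> 0"
    using string_wv[OF v \<open>i \<noteq> j\<close>] by metis
  have "p = 0" using dp(3)[of 1] zero by (cases p) auto
  obtain w where w: "wv (sh i j \<mu>) w" using assms by (auto simp: wts_def)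
  obtain d' p' :: nat where dp': "p' \<le> d'" "sh i j \<mu> i - sh i j \<mu> j = real d' - 2 * real p'"
    "E i j (E j i w) = (of_nat (Suc p') * (of_nat d' - of_nat p')) *s w"
    using string_wv[OF w \<open>i \<noteq> j\<close>] by metis
  have "sh i j \<mu> i - sh i j \<mu> j = real d + 2"
    using dp(2) \<open>p = 0\<close> \<open>i \<noteq> j\<close> by (simp add: sh_def)
  then have "p' < d'" using dp'(1,2) by linarith
  then have "of_nat (Suc p') * (of_nat d' - of_nat p') \<noteq> (0 :: complex)"
    by (simp del: of_nat_Suc)
  then have nz: "E i j (E j i w) \<noteq> 0" using dp'(3) w by (simp add: wv_def del: of_nat_Suc)
  then have "E j i w \<noteq> 0" using E_zero by auto
  then have "wv (sh j i (sh i j \<mu>)) (E j i w)" using wv_E[OF w] \<open>i \<noteq> j\<close> by simp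
  moreover have "sh j i (sh i j \<mu>) = \<mu>" using \<open>i \<noteq> j\<close> by (auto simp: sh_def)
  ultimately obtain c where "E j i w = c *s v" using wv_line v by metis
  then show False using nz zero by (simp add: E_scale)
qed

text \<open>Invariance of \<open>B\<close> under the diagonal operators allows a nonzero pairing
  between opposite weights only, so nondegeneracy produces the opposite weight.\<close>

lemma wv_opposite:
  assumes "wv \<mu> v"
  obtains w where "wv (\<lambda>k. - \<mu> k) w"
proof -
  obtain y where "B v y \<noteq> 0" using B_nondeg assms by (auto simp: wv_def)
  then obtain w l where w: "lev l w" "B v w \<noteq> 0"
    using ex_eigenvector[of "B v"] B_add_right B_scale_right by (metis mult_zero_right)
  then have "w \<noteq> 0" using B_zero_right by auto
  then obtain \<nu> where \<nu>: "wv \<nu> w" using lev_wv w by metis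
  have "\<nu> k = - \<mu> k" for k
  proof -
    have "of_real (\<mu> k) * B v w = - (of_real (\<nu> k) * B v w)"
      using B_inv[of k k v w] assms \<nu> by (simp add: wv_def B_scale B_scale_right)
    then have "of_real (\<mu> k + \<nu> k) * B v w = 0" by (simp add: algebra_simps)
    then have "\<mu> k + \<nu> k = 0" using w(2) by (simp only: mult_eq_0_iff of_real_eq_0_iff) simp
    then show ?thesis by simp
  qed
  then have "\<nu> = (\<lambda>k. - \<mu> k)" by auto
  with \<nu> that show ?thesis by simp
qed

lemma wts_neg: "\<mu> \<in> wts \<Longrightarrow> (\<lambda>k. - \<mu> k) \<in> wts"
  unfolding wts_def using wv_opposite by blast

lemma B_opposite:
  assumes v: "wv \<mu> v" and w: "wv (\<lambda>k. - \<mu> k) w"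
  shows "B v w \<noteq> 0"
proof
  assume zero: "B v w = 0"
  obtain y where "B v y \<noteq> 0" using B_nondeg v by (auto simp: wv_def)
  then obtain x l where x: "lev l x" "B v x \<noteq> 0"
    using ex_eigenvector[of "B v"] B_add_right B_scale_right by (metis mult_zero_right)
  then have "x \<noteq> 0" using B_zero_right by auto
  then obtain \<nu> where \<nu>: "wv \<nu> x" using lev_wv x by metis
  have "\<nu> k = - \<mu> k" for k
  proof -
    have "of_real (\<mu> k) * B v x = - (of_real (\<nu> k) * B v x)"
      using B_inv[of k k v x] v \<nu> by (simp add: wv_def B_scale B_scale_right)
    then have "of_real (\<mu> k + \<nu> k) * B v x = 0" by (simp add: algebra_simps)
    then have "\<mu> k + \<nu> k = 0" using x(2) by (simp only: mult_eq_0_iff of_real_eq_0_iff) simp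
    then show ?thesis by simp
  qed
  then have "\<nu> = (\<lambda>k. - \<mu> k)" by auto
  then obtain c where "x = c *s w" using wv_line[OF w] \<nu> by metis
  then show False using x(2) zero by (simp add: B_scale_right)
qed

end

section \<open>Highest weights compatible with multiplicity one and the skew form\<close>

definition wt4 :: "real \<Rightarrow> real \<Rightarrow> real \<Rightarrow> real \<Rightarrow> 4 \<Rightarrow> real" where
  "wt4 a b c d = (\<lambda>i. if i = 1 then a else if i = 2 then b else if i = 3 then c else d)"

lemma wt4_simps: "wt4 a b c d 1 = a" "wt4 a b c d 2 = b" "wt4 a b c d 3 = c" "wt4 a b c d 4 = d"
  by (simp_all add: wt4_def)

lemma fun4_eq: "\<mu> = \<nu> \<longleftrightarrow> \<mu> 1 = \<nu> 1 \<and> \<mu> 2 = \<nu> 2 \<and> \<mu> 3 = \<nu> 3 \<and> \<mu> 4 = \<nu> (4 :: 4)"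
  by (simp add: fun_eq_iff forall_4)

text \<open>The weight of the \<open>k\<close>-th coordinate vector of \<open>\<complex>^4\<close>.
  Only \<open>fundamental 1\<close> is a fundamental weight, namely \<omega>_1; the negative of
  \<open>fundamental 4\<close> is \<omega>_3.\<close>

definition fundamental :: "4 \<Rightarrow> 4 \<Rightarrow> real" where
  "fundamental k = (\<lambda>i. (if i = k then 1 else 0) - 1 / 4)"

context principal_module
begin

text \<open>
  A highest weight vector for \<open>sl\<^sub>3\<close> with two nonzero labels has a weight space of dimension two
  below it: \<open>E j i (E k j v)\<close> and \<open>E k j (E j i v)\<close> are independent.
\<close>

lemma highest_weight_sl3:
  assumes v: "wv \<mu> v" and d: "i \<noteq> j" "j \<noteq> k" "i \<noteq> k" and hw: "E i j v = 0" "E j k v = 0"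
  shows "\<not> (\<mu> i > \<mu> j \<and> \<mu> j > \<mu> k)"
proof
  assume pos: "\<mu> i > \<mu> j \<and> \<mu> j > \<mu> k"
  define a where "a = complex_of_real (\<mu> i - \<mu> j)"
  define b where "b = complex_of_real (\<mu> j - \<mu> k)"
  have diag: "E l l v = of_real (\<mu> l) *s v" for l using v by (simp add: wv_def)
  define x where "x = E j i v"
  define y where "y = E k j v"
  have ijx: "E i j x = a *s v" and jky: "E j k y = b *s v"
    using comm[of i j j i v] comm[of j k k j v] d hw
    by (simp_all add: x_def y_def a_def b_def diag E_zero vec.scale_left_diff_distrib)
  have jkx: "E j k x = 0" and ijy: "E i j y = 0"
    using comm[of j k j i v] comm[of i j k j v] d hw by (simp_all add: x_def y_def E_zero)
  have nz: "a \<noteq> 0" "b \<noteq> 0" "v \<noteq> 0" using pos v by (auto simp: a_def b_def wv_def)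
  have "x \<noteq> 0" "y \<noteq> 0" using ijx jky nz E_zero by force+
  have wx: "wv (sh j i \<mu>) x" and wy: "wv (sh k j \<mu>) y"
    using wv_E[OF v] \<open>x \<noteq> 0\<close> \<open>y \<noteq> 0\<close> d by (auto simp: x_def y_def)
  have dx: "E j j x = of_real (\<mu> j + 1) *s x" "E k k x = of_real (\<mu> k) *s x"
    and dy: "E i i y = of_real (\<mu> i) *s y" "E j j y = of_real (\<mu> j - 1) *s y"
    using wx wy d by (auto simp: wv_def sh_def)
  have ijp: "E i j (E j i y) = (a + 1) *s y" and jkq: "E j k (E k j x) = (b + 1) *s x"
    using comm[of i j j i y] comm[of j k k j x] d
    by (simp_all add: ijy jkx E_zero dx dy a_def b_def vec_eq_iff algebra_simps)
  have ijq: "E i j (E k j x) = a *s y" and jkp: "E j k (E j i y) = b *s x"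
    using comm[of i j k j x] comm[of j k j i y] d
    by (simp_all add: ijx jky E_scale flip: x_def y_def)
  have "a + 1 \<noteq> 0"
  proof -
    have "a + 1 = of_real (\<mu> i - \<mu> j + 1)" by (simp add: a_def)
    then show ?thesis using pos by (simp only: of_real_eq_0_iff) simp
  qed
  then have pnz: "E j i y \<noteq> 0"
    using ijp \<open>y \<noteq> 0\<close> by (metis E_zero vec.scale_eq_0_iff)
  have lp: "lev (lvl \<mu> + (t k - t j) + (t j - t i)) (E j i y)"
    unfolding y_def by (intro lev_E wv_lev v)
  have lq: "lev (lvl \<mu> + (t j - t i) + (t k - t j)) (E k j x)"
    unfolding x_def by (intro lev_E wv_lev v)
  have "lvl \<mu> + (t j - t i) + (t k - t j) = lvl \<mu> + (t k - t j) + (t j - t i)" by simp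
  \<comment> \<open>Both vectors have the same level. Applying \<open>E i j\<close> and
    \<open>E j k\<close> to their proportionality gives a = c (a + 1) and b + 1 = c b, hence a b =
    (a + 1)(b + 1), which is impossible for positive labels.\<close>
  then obtain c where c: "E k j x = c *s E j i y"
    using simple_lev[OF pnz lp] lq by metis
  have "a *s y = (c * (a + 1)) *s y" using ijq c ijp by (metis E_scale vec.scale_scale)
  then have eq1: "a = c * (a + 1)" using \<open>y \<noteq> 0\<close> vec.scale_cancel_right by blast
  have "(b + 1) *s x = (c * b) *s x" using jkq c jkp by (metis E_scale vec.scale_scale)
  then have eq2: "b + 1 = c * b" using \<open>x \<noteq> 0\<close> vec.scale_cancel_right by blast
  have "a * b = (a + 1) * (b + 1)" using eq1 eq2 by (metis mult.assoc mult.commute)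
  then have "a + b + 1 = 0" by (simp add: algebra_simps)
  then have "complex_of_real (\<mu> i - \<mu> k + 1) = 0" by (simp add: a_def b_def algebra_simps)
  then show False using pos by (simp only: of_real_eq_0_iff) simp
qed

text \<open>Weyl reflections give all strings through zero in an sl_3 the same half length P, so
  every \<open>E a b (E b a v)\<close> is K v with K = P (P + 1). The form then determines the
  product of root operators around a triangle, whence \<open>E b c (E a b v)\<close> is -1/2 times
  \<open>E a c v\<close>. Applying this twice yields a negative string scalar.\<close>

lemma no_zero_weight: "\<not> wv (\<lambda>_. 0) v"
proof
  assume v: "wv (\<lambda>_. 0) v"
  have diag: "E l l v = 0" for l using v by (simp add: wv_def)
  have vnz: "v \<noteq> 0" using v by (simp add: wv_def)
  have lv: "lev 0 v" using wv_lev[OF v] by (simp add: lvl_def)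
  \<comment> \<open>The weight zero is the midpoint of its strings, so d = 2p and the scalar (p +
    1)(d - p) becomes p (p + 1).\<close>
  have "\<exists>p. (\<forall>k\<le>p. (E a b ^^ k) v \<noteq> 0) \<and> (E a b ^^ Suc p) v = 0 \<and>
      E a b (E b a v) = of_nat (p * Suc p) *s v" if ab: "a \<noteq> b" for a b
  proof -
    obtain d p :: nat where dp: "(0::real) = real d - 2 * real p"
      "\<And>k. k \<le> p \<Longrightarrow> (E a b ^^ k) v \<noteq> 0" "(E a b ^^ Suc p) v = 0"
      "E a b (E b a v) = (of_nat (Suc p) * (of_nat d - of_nat p)) *s v"
      using string_wv[OF v ab] by (metis diff_self)
    have "d = 2 * p" using dp(1) by linarith
    then have "of_nat (Suc p) * (of_nat d - of_nat p) = (of_nat (p * Suc p) :: complex)"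
      by (simp add: algebra_simps)
    with dp show ?thesis by metis
  qed
  then obtain pp where pp: "\<And>a b k. a \<noteq> b \<Longrightarrow> k \<le> pp a b \<Longrightarrow> (E a b ^^ k) v \<noteq> 0"
    "\<And>a b. a \<noteq> b \<Longrightarrow> (E a b ^^ Suc (pp a b)) v = 0"
    "\<And>a b. a \<noteq> b \<Longrightarrow> E a b (E b a v) = of_nat (pp a b * Suc (pp a b)) *s v"
    by metis
  define rt where "rt = (\<lambda>a b (k::nat). (\<lambda>_::4. 0::real)(a := real k, b := - real k))"
  \<comment> \<open>Saturation fills in the smaller multiples of the root, and
    \<open>wv_adjacent\<close> carries the string of \<open>v\<close> through all of them. So the
    string length is visible from the set of weights alone.\<close>
  have le_pp: "k \<le> pp a b" if "a \<noteq> b" "rt a b k \<in> wts" for a b k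
  proof (rule ccontr)
    assume "\<not> k \<le> pp a b"
    then have k: "Suc (pp a b) \<le> k" by simp
    have all: "rt a b j \<in> wts" if "j \<le> k" for j
      using that
    proof (induction rule: inc_induct)
      case (step n)
      have "rt a b (Suc n) a - rt a b (Suc n) b \<ge> 1" using \<open>a \<noteq> b\<close> by (simp add: rt_def)
      from wts_saturated[OF step.IH this] have "sh b a (rt a b (Suc n)) \<in> wts" .
      moreover have "sh b a (rt a b (Suc n)) = rt a b n"
        using \<open>a \<noteq> b\<close> by (auto simp: rt_def sh_def)
      ultimately show ?case by simp
    qed (use \<open>rt a b k \<in> wts\<close> in simp)
    have "(E a b ^^ j) v \<noteq> 0" if "j \<le> k" for j
      using that
    proof (induction j)
      case (Suc j)
      have eq: "(\<lambda>_. 0)(a := 0 + real j, b := 0 - real j) = rt a b j"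
        by (simp add: rt_def)
      have "wv (rt a b j) ((E a b ^^ j) v)"
        using wv_pow[OF v \<open>a \<noteq> b\<close>, of j] Suc.IH Suc.prems Suc_leD unfolding eq by blast
      moreover have "sh a b (rt a b j) = rt a b (Suc j)"
        using \<open>a \<noteq> b\<close> by (auto simp: rt_def sh_def)
      ultimately show ?case using wv_adjacent[of "rt a b j" "(E a b ^^ j) v" a b] all Suc \<open>a \<noteq> b\<close> by simp
    qed (use vnz in simp)
    then show False using pp(2)[OF \<open>a \<noteq> b\<close>] k by blast
  qed
  have rt_wts: "rt a b (pp a b) \<in> wts" if "a \<noteq> b" for a b
  proof -
    have eq: "(\<lambda>_. 0)(a := 0 + real (pp a b), b := 0 - real (pp a b)) = rt a b (pp a b)"
      by (simp add: rt_def)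
    have "wv (rt a b (pp a b)) ((E a b ^^ pp a b) v)"
      using wv_pow[OF v that, of "pp a b"] pp(1)[OF that order_refl] unfolding eq by blast
    then show ?thesis by (auto simp: wts_def)
  qed
  \<comment> \<open>A transposition that fixes one index permutes the multiples of roots that are
    weights. Together with the version for the other index this compares all roots of the
    sl_3.\<close>
  have pp_right: "pp a b \<le> pp a c" if "a \<noteq> b" "a \<noteq> c" for a b c
  proof -
    have "rt a b (pp a b) \<circ> Transposition.transpose b c = rt a c (pp a b)"
      using that by (auto simp: rt_def Transposition.transpose_def fun_eq_iff)
    then show ?thesis using le_pp[OF that(2)] wts_reflect[OF rt_wts[OF that(1)], of b c] by simp
  qed
  have pp_left: "pp a b \<le> pp c b" if "a \<noteq> b" "c \<noteq> b" for a b c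
  proof -
    have "rt a b (pp a b) \<circ> Transposition.transpose a c = rt c b (pp a b)"
      using that by (auto simp: rt_def Transposition.transpose_def fun_eq_iff)
    then show ?thesis using le_pp[OF that(2)] wts_reflect[OF rt_wts[OF that(1)], of a c] by simp
  qed
  obtain i j where ij: "E i j v \<noteq> 0" using no_invariants vnz by blast
  then have "i \<noteq> j" using diag by auto
  have "\<exists>k::4. k \<noteq> i \<and> k \<noteq> j"
    using exhaust_4[of i] exhaust_4[of j] by (elim disjE) (auto intro: exI[of _ 1] exI[of _ 2] exI[of _ 3])
  then obtain k where k: "k \<noteq> i" "k \<noteq> j" by blast
  define P where "P = pp i j"
  have "P \<noteq> 0" using pp(2)[OF \<open>i \<noteq> j\<close>] ij by (cases "pp i j") (auto simp: P_def)
  define S where "S = {i, j, k}"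
  have ppP: "pp a b = P" if "a \<in> S" "b \<in> S" "a \<noteq> b" for a b
  proof -
    have R: "pp x y = pp x z" if "x \<noteq> y" "x \<noteq> z" for x y z
      using pp_right that by (simp add: le_antisym)
    have L: "pp x y = pp z y" if "x \<noteq> y" "z \<noteq> y" for x y z
      using pp_left that by (simp add: le_antisym)
    have "pp i k = P" using R[of i j k] k \<open>i \<noteq> j\<close> by (auto simp: P_def)
    moreover have "pp k j = P" using L[of i j k] k \<open>i \<noteq> j\<close> by (auto simp: P_def)
    moreover have "pp k i = pp k j" using R[of k i j] k by auto
    moreover have "pp j k = pp i k" using L[of j k i] k \<open>i \<noteq> j\<close> by auto
    moreover have "pp j i = pp j k" using R[of j i k] k \<open>i \<noteq> j\<close> by auto
    ultimately show ?thesis using that by (auto simp: S_def P_def)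
  qed
  define K where "K = (of_nat (P * Suc P) :: complex)"
  have "K \<noteq> 0" using \<open>P \<noteq> 0\<close> by (simp add: K_def del: mult_Suc_right of_nat_mult of_nat_Suc)
  have KK: "E a b (E b a v) = K *s v" if "a \<in> S" "b \<in> S" "a \<noteq> b" for a b
    using pp(3)[OF that(3)] ppP[OF that] by (simp add: K_def)
  have nz: "E a b v \<noteq> 0" if "a \<in> S" "b \<in> S" "a \<noteq> b" for a b
    using pp(1)[OF that(3), of 1] ppP[OF that] \<open>P \<noteq> 0\<close> by simp
  have half: "E b c (E a b v) = (- 1 / 2) *s E a c v"
    if S: "a \<in> S" "b \<in> S" "c \<in> S" and d: "a \<noteq> b" "b \<noteq> c" "a \<noteq> c" for a b c
  proof -
    \<comment> \<open>Moving \<open>E c a\<close> past the other two operators creates the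
      corrections -K v and K v, which cancel.\<close>
    have cyc: "E c a (E a b (E b c v)) = E a b (E b c (E c a v))"
      if S: "a \<in> S" "b \<in> S" "c \<in> S" and d: "a \<noteq> b" "b \<noteq> c" "a \<noteq> c" for a b c
    proof -
      have "E c a (E b c v) = E b c (E c a v) - E b a v"
        using comm[of c a b c v] d by simp
      moreover have "E c a (E a b (E b c v)) = E a b (E c a (E b c v)) + E c b (E b c v)"
        using comm[of c a a b "E b c v"] d by simp
      ultimately show ?thesis using KK[of a b] KK[of c b] S d by (simp add: E_diff)
    qed
    have "lev (0 + (t b - t c) + (t a - t b) + (t c - t a)) (E c a (E a b (E b c v)))"
      by (intro lev_E lv)
    then obtain A where A: "E c a (E a b (E b c v)) = A *s v"
      using simple_lev[OF vnz lv] by auto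
    have A': "E b c (E c a (E a b v)) = A *s v"
      using cyc[of a b c] cyc[of b c a] S d A by auto
    have rev: "E b c (E a b (E c a v)) = (A - K) *s v"
    proof -
      have "E a b (E c a v) = E c a (E a b v) - E c b v"
        using comm[of a b c a v] d by auto
      then show ?thesis using A' KK[of b c] S d by (simp add: E_diff vec.scale_left_diff_distrib)
    qed
    \<comment> \<open>Moving three operators across the form reverses the word with sign -1. The
      word is A and its reversal A - K on \<open>v\<close>, and \<open>B v v\<close> is nonzero
      because the weight zero is its own opposite; so 2A = K.\<close>
    have "B (E c a (E a b (E b c v))) v = - B v (E b c (E a b (E c a v)))"
      by (simp add: B_inv)
    then have "A * B v v = - ((A - K) * B v v)"
      by (simp only: A rev B_scale B_scale_right)
    moreover have "B v v \<noteq> 0" using B_opposite[OF v] v by simp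
    ultimately have AK: "2 * A = K" by algebra
    have "lev (0 + (t a - t b) + (t b - t c)) (E b c (E a b v))" by (intro lev_E lv)
    moreover have "lev (0 + (t a - t c)) (E a c v)" by (intro lev_E lv)
    ultimately obtain \<sigma> where \<sigma>: "E b c (E a b v) = \<sigma> *s E a c v"
      using simple_lev[OF nz[of a c]] S d by (metis add.commute diff_add_cancel add_diff_eq group_cancel.add1)
    have "E c a (E b c (E a b v)) = E b c (E c a (E a b v)) - E b a (E a b v)"
      using comm[of c a b c "E a b v"] d by simp
    then have "(\<sigma> * K) *s v = (A - K) *s v"
      using \<sigma> KK[of c a] KK[of b a] A' S d by (simp add: E_scale vec.scale_left_diff_distrib)
    then have "\<sigma> * K = A - K" using vnz vec.scale_cancel_right by blast
    then have "(2 * \<sigma> + 1) * K = 0" using AK by algebra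
    then have "2 * \<sigma> + 1 = 0" using \<open>K \<noteq> 0\<close> by simp
    then have "2 * \<sigma> = - 1" by algebra
    moreover have "\<sigma> = (2 * \<sigma>) / 2" by simp
    ultimately have "\<sigma> = - 1 / 2" by (simp only:)
    with \<sigma> show ?thesis by simp
  qed
  have S3: "i \<in> S" "j \<in> S" "k \<in> S" by (auto simp: S_def)
  define u where "u = E i j v"
  have u: "wv (sh i j (\<lambda>_. 0)) u" unfolding u_def using wv_E[OF v ij \<open>i \<noteq> j\<close>] .
  \<comment> \<open>Two uses of \<open>half\<close> give the factor 1/4. Interchanging the operators
    subtracts 1 and leaves -3/4, while a string scalar (p + 1)(d - p) is never negative.\<close>
  have jk: "E k j (E j k u) = (1 / 4) *s u"
    using half[of i j k] half[of i k j] S3 \<open>i \<noteq> j\<close> k by (auto simp: u_def E_scale E_neg)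
  have "E k k u = 0" "E j j u = - u" using u k \<open>i \<noteq> j\<close> by (auto simp: wv_def sh_def)
  then have "E k j (E j k u) = E j k (E k j u) + u"
    using comm[of k j j k u] k by simp
  then have "E j k (E k j u) = (1 / 4) *s u - 1 *s u" using jk by simp
  also have "\<dots> = (1 / 4 - 1) *s u" by (simp only: vec.scale_left_diff_distrib)
  finally have ev: "E j k (E k j u) = (- 3 / 4) *s u" by simp
  have "j \<noteq> k" using k by simp
  obtain d p :: nat where dp: "sh i j (\<lambda>_. 0) j - sh i j (\<lambda>_. 0) k = real d - 2 * real p" "p \<le> d"
    "E j k (E k j u) = (of_nat (Suc p) * (of_nat d - of_nat p)) *s u"
    using string_wv[OF u \<open>j \<noteq> k\<close>] by metis
  have "(of_nat (Suc p) * (of_nat d - of_nat p)) *s u = (- 3 / 4) *s u" using dp(3) ev by simp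
  then have "of_nat (Suc p) * (of_nat d - of_nat p) = (- 3 / 4 :: complex)"
    using u vec.scale_cancel_right unfolding wv_def by blast
  then have "complex_of_real (real (Suc p) * (real d - real p)) = of_real (- 3 / 4)" by simp
  then have "real (Suc p) * (real d - real p) = - 3 / 4" by (simp only: of_real_eq_iff)
  moreover have "real (Suc p) * (real d - real p) \<ge> 0" using dp(2) by simp
  ultimately show False by simp
qed

lemma zero_not_wts: "(\<lambda>_. 0) \<notin> wts"
  using no_zero_weight by (auto simp: wts_def)

text \<open>For even \<open>N\<close> the level 0 occurs. Its weight and the opposite weight share
  this level, so they coincide and the weight is zero.\<close>

lemma odd_N: "odd N"
proof
  assume "even N"
  then obtain k where k: "N = 2 * k" by blast
  then obtain \<mu> where \<mu>: "\<mu> \<in> wts" "lvl \<mu> = 0" using lvl_ex[of k] by auto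
  have "lvl (\<lambda>k. - \<mu> k) = 0" using \<mu> by (simp add: lvl_def sum_negf)
  then have "\<mu> = (\<lambda>k. - \<mu> k)" using lvl_inj \<mu> wts_neg by simp
  then have "\<mu> k = 0" for k by (metis neg_equal_zero)
  then have "\<mu> = (\<lambda>_. 0)" by auto
  with \<mu> zero_not_wts show False by simp
qed

text \<open>
  The module \<open>\<Lambda>\<^sup>2 \<complex>\<^sup>4\<close> is orthogonal, whereas the form is skew.
\<close>

lemma wedge_not_wts: "wt4 (1/2) (1/2) (- 1/2) (- 1/2) \<notin> wts"
proof
  define g where "g = wt4 (1/2) (1/2) (- 1/2) (- 1/2)"
  assume "wt4 (1/2) (1/2) (- 1/2) (- 1/2) \<in> wts"
  then have gw: "g \<in> wts" by (simp add: g_def)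
  then obtain v where v: "wv g v" by (auto simp: wts_def)
  have "wt4 (1/2) (- 1/2) (1/2) (- 1/2) = g \<circ> Transposition.transpose 2 3"
    "wt4 (- 1/2) (1/2) (1/2) (- 1/2) = g \<circ> Transposition.transpose 1 3"
    "wt4 (- 1/2) (1/2) (- 1/2) (1/2) = g \<circ> Transposition.transpose 1 4"
    by (simp_all add: fun4_eq g_def wt4_simps Transposition.transpose_def)
  then have w: "wt4 (1/2) (- 1/2) (1/2) (- 1/2) \<in> wts" "wt4 (- 1/2) (1/2) (1/2) (- 1/2) \<in> wts"
    "wt4 (- 1/2) (1/2) (- 1/2) (1/2) \<in> wts"
    using wts_reflect[OF gw] by simp_all
  have s: "sh 3 2 g = wt4 (1/2) (- 1/2) (1/2) (- 1/2)"
    "sh 2 1 (wt4 (1/2) (- 1/2) (1/2) (- 1/2)) = wt4 (- 1/2) (1/2) (1/2) (- 1/2)"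
    "sh 4 3 (wt4 (- 1/2) (1/2) (1/2) (- 1/2)) = wt4 (- 1/2) (1/2) (- 1/2) (1/2)"
    "sh 3 2 (wt4 (- 1/2) (1/2) (- 1/2) (1/2)) = (\<lambda>k. - g k)"
    by (simp_all add: fun4_eq g_def wt4_simps sh_def)
  have d: "(3::4) \<noteq> 2" "(2::4) \<noteq> 1" "(4::4) \<noteq> 3" by simp_all
  have step: "wv (sh i j \<mu>) (E i j x)" if "wv \<mu> x" "i \<noteq> j" "sh i j \<mu> \<in> wts" for i j \<mu> x
    using wv_E[OF that(1) wv_adjacent[OF that] that(2)] .
  have v1: "wv (wt4 (1/2) (- 1/2) (1/2) (- 1/2)) (E 3 2 v)"
    using step[OF v d(1)] s w by metis
  have v2: "wv (wt4 (- 1/2) (1/2) (1/2) (- 1/2)) (E 2 1 (E 3 2 v))"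
    using step[OF v1 d(2)] s w by metis
  have v3: "wv (wt4 (- 1/2) (1/2) (- 1/2) (1/2)) (E 4 3 (E 2 1 (E 3 2 v)))"
    using step[OF v2 d(3)] s w by metis
  have v4: "wv (\<lambda>k. - g k) (E 3 2 (E 4 3 (E 2 1 (E 3 2 v))))"
    using step[OF v3 d(1)] s wts_neg[OF gw] by metis
  let ?w = "E 3 2 (E 4 3 (E 2 1 (E 3 2 v)))"
  \<comment> \<open>The vector \<open>?w\<close> is reached by a path of lowering operators from the
    highest to the lowest weight. Moving the four operators across costs no sign, and the reversed
    word is the same because the middle two commute. Hence the pairing is symmetric, which
    contradicts skewness.\<close>
  have "B v ?w = B (E 3 2 (E 2 1 (E 4 3 (E 3 2 v)))) v"
    by (simp add: B_inv)
  also have "E 2 1 (E 4 3 (E 3 2 v)) = E 4 3 (E 2 1 (E 3 2 v))"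
    using comm[of 2 1 4 3 "E 3 2 v"] by simp
  also have "B ?w v = - B v ?w" using B_sym[of ?w v] sign[OF odd_N] by simp
  finally have "B v ?w = 0" by simp
  then show False using B_opposite[OF v v4] by simp
qed

text \<open>These are the multiples b \<omega>_2. Lowering by the roots of (1,3) and (2,4) replaces
  b by b - 2, and saturation keeps the result a weight; the descent ends at zero or at the weight of
  the exterior square.\<close>

lemma square_not_wts: "wt4 (real b / 2) (real b / 2) (- real b / 2) (- real b / 2) \<notin> wts"
proof (induction b rule: less_induct)
  case (less b)
  consider "b = 0" | "b = 1" | "b \<ge> 2" by linarith
  then show ?case
  proof cases
    case 1
    have "wt4 (real b / 2) (real b / 2) (- real b / 2) (- real b / 2) = (\<lambda>_. 0)"
      by (simp add: fun4_eq wt4_simps 1)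
    then show ?thesis using zero_not_wts by simp
  next
    case 2
    then show ?thesis using wedge_not_wts by simp
  next
    case 3
    show ?thesis
    proof
      let ?r = "real b / 2"
      assume "wt4 (real b / 2) (real b / 2) (- real b / 2) (- real b / 2) \<in> wts"
      moreover have "sh 3 1 (wt4 ?r ?r (- ?r) (- ?r)) = wt4 (?r - 1) ?r (1 - ?r) (- ?r)"
        by (simp add: fun4_eq wt4_simps sh_def)
      ultimately have "wt4 (?r - 1) ?r (1 - ?r) (- ?r) \<in> wts"
        using wts_saturated[of "wt4 ?r ?r (- ?r) (- ?r)" 1 3] 3 by (simp add: wt4_simps)
      moreover have "sh 4 2 (wt4 (?r - 1) ?r (1 - ?r) (- ?r)) = wt4 (?r - 1) (?r - 1) (1 - ?r) (1 - ?r)"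
        by (simp add: fun4_eq wt4_simps sh_def)
      ultimately have "wt4 (?r - 1) (?r - 1) (1 - ?r) (1 - ?r) \<in> wts"
        using wts_saturated[of "wt4 (?r - 1) ?r (1 - ?r) (- ?r)" 2 4] 3 by (simp add: wt4_simps)
      moreover have "wt4 (?r - 1) (?r - 1) (1 - ?r) (1 - ?r) =
          wt4 (real (b - 2) / 2) (real (b - 2) / 2) (- real (b - 2) / 2) (- real (b - 2) / 2)"
        using 3 by (simp add: fun4_eq wt4_simps field_simps)
      ultimately show False using less[of "b - 2"] 3 by simp
    qed
  qed
qed

lemma killed_label:
  assumes "wv \<mu> v" "i \<noteq> j" "E i j v = 0"
  shows "\<exists>d::nat. \<mu> i - \<mu> j = real d"
proof -
  obtain d p :: nat where dp: "\<mu> i - \<mu> j = real d - 2 * real p"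
    "\<And>k. k \<le> p \<Longrightarrow> (E i j ^^ k) v \<noteq> 0"
    using string_wv[OF assms(1,2)] by metis
  have "p = 0" using dp(2)[of 1] assms(3) by (cases p) auto
  then show ?thesis using dp(1) by auto
qed

text \<open>The composite root operators \<open>E 1 3\<close> and \<open>E 2 4\<close> also kill the
  vector, so \<open>highest_weight_sl3\<close> applies to the triples (1,2,4) and (1,3,4) as well.
  These prevent the two outer labels from being nonzero together; \<open>square_not_wts\<close>
  removes the multiples of \<omega>_2.\<close>

lemma highest_weight_cases [consumes 4, case_names first last]:
  assumes \<mu>: "\<mu> \<in> wts" and hw: "sh 1 2 \<mu> \<notin> wts" "sh 2 3 \<mu> \<notin> wts" "sh 3 4 \<mu> \<notin> wts"
  obtains a :: nat where "a \<ge> 1" "\<mu> = (\<lambda>i. real a * fundamental 1 i)"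
    | a :: nat where "a \<ge> 1" "\<mu> = (\<lambda>i. - (real a * fundamental 4 i))"
proof -
  obtain v where v: "wv \<mu> v" using \<mu> by (auto simp: wts_def)
  have zero: "E i j v = 0" if "i \<noteq> j" "sh i j \<mu> \<notin> wts" for i j
    using wv_E[OF v _ that(1)] that(2) by (auto simp: wts_def)
  have e: "E 1 2 v = 0" "E 2 3 v = 0" "E 3 4 v = 0" using zero hw by simp_all
  have e13: "E 1 3 v = 0" using comm[of 1 2 2 3 v] by (simp add: e E_zero)
  have e24: "E 2 4 v = 0" using comm[of 2 3 3 4 v] by (simp add: e E_zero)
  obtain d1 d2 d3 :: nat where d: "\<mu> 1 - \<mu> 2 = real d1" "\<mu> 2 - \<mu> 3 = real d2" "\<mu> 3 - \<mu> 4 = real d3"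
    using killed_label[OF v _ e(1)] killed_label[OF v _ e(2)] killed_label[OF v _ e(3)] by auto
  have "d1 = 0 \<or> d2 = 0" using highest_weight_sl3[OF v, of 1 2 3] e d by auto
  moreover have "d2 = 0 \<or> d3 = 0" using highest_weight_sl3[OF v, of 2 3 4] e d by auto
  moreover have "d1 = 0 \<or> d2 + d3 = 0" using highest_weight_sl3[OF v, of 1 2 4] e e24 d by auto
  moreover have "d1 + d2 = 0 \<or> d3 = 0" using highest_weight_sl3[OF v, of 1 3 4] e e13 d by auto
  ultimately consider "d1 \<ge> 1" "d2 = 0" "d3 = 0" | "d1 = 0" "d2 = 0" "d3 \<ge> 1" | "d1 = 0" "d3 = 0"
    by linarith
  then show ?thesis
  proof cases
    case 1
    then have "\<mu> = (\<lambda>i. real d1 * fundamental 1 i)"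
      using d wts_sum[OF \<mu>] by (simp add: fun4_eq fundamental_def sum_4 field_simps)
    with that 1 show ?thesis by blast
  next
    case 2
    then have "\<mu> = (\<lambda>i. - (real d3 * fundamental 4 i))"
      using d wts_sum[OF \<mu>] by (simp add: fun4_eq fundamental_def sum_4 field_simps)
    with that 2 show ?thesis by blast
  next
    case 3
    then have "\<mu> = wt4 (real d2 / 2) (real d2 / 2) (- real d2 / 2) (- real d2 / 2)"
      using d wts_sum[OF \<mu>] by (simp add: fun4_eq wt4_simps sum_4 field_simps)
    with \<mu> square_not_wts show ?thesis by simp
  qed
qed

end

section \<open>Level arithmetic from the top weight downwards\<close>

definition short_wts :: "(4 \<Rightarrow> real) set" where
  "short_wts = range fundamental \<union> range (\<lambda>k i. - fundamental k i)"

lemma ex_bij_three: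
  fixes a b c a' b' c' :: 'a
  assumes "a \<noteq> b" "b \<noteq> c" "a \<noteq> c" "a' \<noteq> b'" "b' \<noteq> c'" "a' \<noteq> c'"
  shows "\<exists>p. bij p \<and> p a = a' \<and> p b = b' \<and> p c = c'"
proof -
  define p1 where "p1 = Transposition.transpose a a'"
  define p2 where "p2 = Transposition.transpose (p1 b) b' \<circ> p1"
  define p3 where "p3 = Transposition.transpose (p2 c) c' \<circ> p2"
  have "bij p1" by (simp add: p1_def)
  then have bij: "bij p2" by (simp add: p2_def bij_comp)
  have "p1 a = a'" "p1 b \<noteq> a'"
    using assms by (auto simp: p1_def Transposition.transpose_def)
  then have b2: "p2 a = a'" "p2 b = b'"
    using assms by (auto simp: p2_def Transposition.transpose_def)
  have "p2 c \<noteq> a'" "p2 c \<noteq> b'" using bij b2 assms by (metis bij_pointE)+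
  then have "p3 a = a'" "p3 b = b'" "p3 c = c'"
    using b2 assms by (auto simp: p3_def Transposition.transpose_def)
  moreover have "bij p3" using bij by (simp add: p3_def bij_comp)
  ultimately show ?thesis by blast
qed

lemma ex_bij_two:
  fixes a b a' b' :: 4
  assumes "a \<noteq> b" "a' \<noteq> b'"
  shows "\<exists>p. bij p \<and> p a = a' \<and> p b = b'"
proof -
  have third: "\<exists>k. k \<noteq> i \<and> k \<noteq> j" for i j :: 4
    using exhaust_4[of i] exhaust_4[of j] by (elim disjE) (auto intro: exI[of _ 1] exI[of _ 2] exI[of _ 3])
  obtain c c' where "c \<noteq> a" "c \<noteq> b" "c' \<noteq> a'" "c' \<noteq> b'"
    using third[of a b] third[of a' b'] by blast
  then show ?thesis using ex_bij_three[of a b c a' b' c'] assms by auto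
qed

context principal_module
begin

lemma t_less: "t 2 < t 1" "t 3 < t 2" "t 4 < t 3"
  using t_mono t_neq[of 1 2] t_neq[of 2 3] t_neq[of 3 4] by (auto simp: less_le)

lemma t_sum4: "t 1 + t 2 + t 3 + t 4 = 0"
  using t_sum by (simp add: sum_4)

lemma t_gap:
  assumes "t j < t i"
  obtains n :: nat where "n \<ge> 1" "t i - t j = real n"
proof -
  obtain z :: int where z: "t i - t j = of_int z" using t_diff_int[of i j] by (auto elim: Ints_cases)
  then have "z > 0" using assms by linarith
  with z that[of "nat z"] show ?thesis by simp
qed

lemma sh_sh: "i \<noteq> j \<Longrightarrow> sh j i (sh i j \<mu>) = \<mu>"
  by (auto simp: sh_def)

lemma lvl_sh: "lvl (sh i j \<mu>) = lvl \<mu> + (t i - t j)" if "i \<noteq> j"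
proof -
  have "sh i j \<mu> k = \<mu> k + (if k = i then 1 else 0) - (if k = j then 1 else 0)" for k
    using that by (simp add: sh_def)
  then have sh: "sh i j \<mu> = (\<lambda>k. \<mu> k + (if k = i then 1 else 0) - (if k = j then 1 else 0))" by blast
  have "lvl (sh i j \<mu>) = (\<Sum>k\<in>UNIV. t k * \<mu> k + (if k = i then t k else 0) - (if k = j then t k else 0))"
    unfolding lvl_def sh by (intro sum.cong) (auto simp: algebra_simps)
  then show ?thesis by (simp add: sum.distrib sum_subtractf lvl_def)
qed

lemma lvl_fundamental: "lvl (\<lambda>i. c * fundamental k i) = c * t k"
proof -
  have "lvl (\<lambda>i. c * fundamental k i) = c * (\<Sum>i\<in>UNIV. (if i = k then t i else 0) - t i / 4)"
    unfolding lvl_def sum_distrib_left by (intro sum.cong) (auto simp: fundamental_def algebra_simps)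
  also have "\<dots> = c * t k"
    using t_sum by (simp add: sum_subtractf sum_divide_distrib[symmetric])
  finally show ?thesis .
qed

lemma lvl_fundamental': "lvl (fundamental k) = t k" "lvl (\<lambda>i. - fundamental k i) = - t k"
  using lvl_fundamental[of 1 k] lvl_fundamental[of "- 1" k] by simp_all

lemma lvl_le: "\<mu> \<in> wts \<Longrightarrow> lvl \<mu> \<le> real N / 2"
  using lvl_range by fastforce

lemma fundamental_wts:
  assumes "(\<lambda>i. c * fundamental k i) \<in> wts"
  shows "(\<lambda>i. c * fundamental k' i) \<in> wts" "(\<lambda>i. - (c * fundamental k' i)) \<in> wts"
proof -
  have "(\<lambda>i. c * fundamental k i) \<circ> Transposition.transpose k k' = (\<lambda>i. c * fundamental k' i)"
    by (auto simp: fun_eq_iff fundamental_def Transposition.transpose_def)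
  with wts_reflect[OF assms, of k k'] show 1: "(\<lambda>i. c * fundamental k' i) \<in> wts" by simp
  show "(\<lambda>i. - (c * fundamental k' i)) \<in> wts" using wts_neg[OF 1] .
qed

lemma wts_finite: "finite wts" and wts_card: "N + 1 \<le> card wts"
proof -
  have "wts \<subseteq> lvl -` ((\<lambda>k. real N / 2 - real k) ` {..N}) \<inter> wts" using lvl_range by auto
  moreover have "finite (lvl -` ((\<lambda>k. real N / 2 - real k) ` {..N}) \<inter> wts)"
    using lvl_inj by (intro finite_vimage_IntI) (auto simp: inj_on_def)
  ultimately show fin: "finite wts" by (rule finite_subset)
  have "inj_on (\<lambda>k. real N / 2 - real k) {..N}" by (simp add: inj_on_def)
  then have "card ((\<lambda>k. real N / 2 - real k) ` {..N}) = N + 1" by (simp add: card_image)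
  moreover have "(\<lambda>k. real N / 2 - real k) ` {..N} \<subseteq> lvl ` wts"
  proof
    fix x assume "x \<in> (\<lambda>k. real N / 2 - real k) ` {..N}"
    then obtain k where "k \<le> N" "x = real N / 2 - real k" by auto
    then show "x \<in> lvl ` wts" using lvl_ex[of k] by force
  qed
  ultimately show "N + 1 \<le> card wts"
    using surj_card_le[OF fin] by metis
qed

text \<open>The unknowns are the gaps n1, n2, n3 of \<open>t\<close> and the factor
  \<open>a\<close>. The second level gives a = 1 and n1 = n3 + 2, the third gives n3 = 1, and the
  number of available weights together with the parity of \<open>N\<close> gives n2 = 2.\<close>

lemma top_first:
  assumes a: "a \<ge> 1" and top: "(\<lambda>i. real a * fundamental 1 i) \<in> wts" "real a * t 1 = real N / 2"
  shows "N = 7 \<and> t = wt4 (7/2) (1/2) (- 3/2) (- 5/2) \<and> wts = short_wts"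
proof -
  obtain n1 n2 n3 :: nat where n: "n1 \<ge> 1" "n2 \<ge> 1" "n3 \<ge> 1"
    "t 1 - t 2 = real n1" "t 2 - t 3 = real n2" "t 3 - t 4 = real n3"
    using t_gap[OF t_less(1)] t_gap[OF t_less(2)] t_gap[OF t_less(3)] by metis
  have t: "4 * t 1 = 3 * real n1 + 2 * real n2 + real n3" "4 * t 4 = - (real n1 + 2 * real n2 + 3 * real n3)"
    using n t_sum4 by linarith+
  have t1: "t 1 \<ge> 3 / 2" and t4: "t 4 \<le> - 3 / 2" using t n by linarith+
  have le_top: "lvl \<mu> \<le> real a * t 1" if "\<mu> \<in> wts" for \<mu>
    using lvl_le[OF that] top by simp
  have eq_top: "\<mu> = (\<lambda>i. real a * fundamental 1 i)" if "\<mu> \<in> wts" "lvl \<mu> = real a * t 1" for \<mu>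
    using lvl_inj[OF that(1) top(1)] that lvl_fundamental by simp
  have gap: "lvl \<mu> \<le> real N / 2 - 1" if \<mu>: "\<mu> \<in> wts" "lvl \<mu> < real N / 2" for \<mu>
  proof -
    obtain k where "lvl \<mu> = real N / 2 - real k" using lvl_range \<mu> by blast
    with \<mu> show ?thesis by (cases k) auto
  qed
  have low: "(\<lambda>i. - (real a * fundamental 4 i)) \<in> wts"
    using fundamental_wts(2)[OF top(1)] .
  have lvl_low: "lvl (\<lambda>i. - (real a * fundamental 4 i)) = - (real a * t 4)"
    using lvl_fundamental[of "- real a" 4] by simp
  have ne_low: "(\<lambda>i. - (real a * fundamental 4 i)) \<noteq> (\<lambda>i. real a * fundamental 1 i)"
  proof
    assume "(\<lambda>i. - (real a * fundamental 4 i)) = (\<lambda>i. real a * fundamental 1 i)"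
    then have "- (real a * fundamental 4 2) = real a * fundamental 1 2" by (rule fun_cong)
    then show False using a by (simp add: fundamental_def)
  qed
  \<comment> \<open>The weight a \<omega>_3 differs from a \<omega>_1 and therefore lies strictly
    lower. This makes the first gap larger than the last one, hence at least 2.\<close>
  have "- (real a * t 4) \<noteq> real a * t 1" using eq_top[OF low] ne_low lvl_low by metis
  then have low_less: "- (real a * t 4) < real a * t 1" using le_top[OF low] lvl_low by linarith
  then have "real a * (- t 4) < real a * t 1" by linarith
  then have t14: "- t 4 < t 1" using a mult_less_cancel_left_pos[of "real a" "- t 4" "t 1"] by linarith
  then have n13: "n3 < n1" using t by linarith
  have N3: "3 \<le> N"
  proof -
    have "real a * t 1 \<ge> 1 * (3 / 2)" using a t1 by (intro mult_mono) auto
    then show ?thesis using top by simp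
  qed
  obtain \<mu> where \<mu>: "\<mu> \<in> wts" "lvl \<mu> = real N / 2 - 1" using lvl_ex[of 1] N3 by auto
  \<comment> \<open>As gaps are at least 1, a raised weight could only be the top weight, reached
    across a gap of exactly 1, which excludes the first simple root.\<close>
  have \<mu>_hw: "sh i j \<mu> \<notin> wts" if ij: "(i, j) \<in> {(1, 2), (2, 3), (3, 4)}" for i j
  proof
    assume s: "sh i j \<mu> \<in> wts"
    have ne: "i \<noteq> j" using ij by auto
    have le: "t i - t j \<le> 1" using le_top[OF s] lvl_sh[OF ne] \<mu> top by simp
    have ge: "t i - t j \<ge> 1" using ij n by auto
    have eq: "sh i j \<mu> = (\<lambda>i. real a * fundamental 1 i)"
      using eq_top[OF s] lvl_sh[OF ne] \<mu> top le ge by simp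
    have "i \<noteq> 1" using ij le n n13 by auto
    then have two: "sh i j \<mu> i = sh i j \<mu> j"
      using ij unfolding eq by (auto simp: fundamental_def)
    \<comment> \<open>Coordinates \<open>i\<close> and \<open>j\<close> of the top weight are equal,
      so the mirror image of \<open>\<mu>\<close> lies one step beyond the top.\<close>
    have "\<mu> \<circ> Transposition.transpose i j = sh i j (sh i j \<mu>)"
    proof
      fix k
      have "\<mu> i + 1 = \<mu> j - 1" using two ne by (simp add: sh_def)
      then show "(\<mu> \<circ> Transposition.transpose i j) k = sh i j (sh i j \<mu>) k"
        using ne by (auto simp: sh_def Transposition.transpose_def)
    qed
    then have "sh i j (sh i j \<mu>) \<in> wts" using wts_reflect[OF \<mu>(1), of i j] by simp
    then have "lvl \<mu> + (t i - t j) + (t i - t j) \<le> real N / 2"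
      using le_top lvl_sh[OF ne] top by fastforce
    then show False using \<mu> ge by simp
  qed
  have "a = 1 \<and> t 1 + t 4 = 1 \<and> \<mu> = (\<lambda>i. - fundamental 4 i)"
  proof -
    have hw: "sh 1 2 \<mu> \<notin> wts" "sh 2 3 \<mu> \<notin> wts" "sh 3 4 \<mu> \<notin> wts" using \<mu>_hw by auto
    consider (first) a' :: nat where "a' \<ge> 1" "\<mu> = (\<lambda>i. real a' * fundamental 1 i)"
      | (last) c :: nat where "c \<ge> 1" "\<mu> = (\<lambda>i. - (real c * fundamental 4 i))"
      using highest_weight_cases[OF \<mu>(1) hw] by metis
    then show ?thesis
    proof cases
    case first
    then have "real a' * t 1 = real a * t 1 - 1" using \<mu> lvl_fundamental top first by simp
    then have eq: "(real a - real a') * t 1 = 1" by (simp add: algebra_simps)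
    have "a' < a"
    proof (rule ccontr)
      assume "\<not> a' < a"
      then have "(real a - real a') * t 1 \<le> 0" using t1 by (intro mult_nonpos_nonneg) auto
      with eq show False by simp
    qed
    then have "real a - real a' \<ge> 1" by linarith
    then have "(real a - real a') * t 1 \<ge> 1 * (3 / 2)" using t1 by (intro mult_mono) auto
    with eq show ?thesis by simp
  next
    case last
    then have c: "- (real c * t 4) = real a * t 1 - 1"
      using \<mu> lvl_fundamental[of "- real c" 4] top last by simp
    \<comment> \<open>The weight a \<omega>_3 is below the top, so it is at most at the level of
      \<open>\<mu>\<close> = c \<omega>_3; conversely the orbit of c \<omega>_3 and negation give
      the weight c \<omega>_1, bounded by the top. So c = a.\<close>
    have "- (real a * t 4) \<le> - (real c * t 4)"
      using gap[OF low] lvl_low low_less c top by linarith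
    then have "real a * (- t 4) \<le> real c * (- t 4)" by simp
    then have "a \<le> c" using t4 mult_right_le_imp_le[of "real a" "- t 4" "real c"] by simp
    moreover have "(\<lambda>i. real c * fundamental 1 i) \<in> wts"
      using fundamental_wts(2)[of "- real c" 4 1] \<mu> last by simp
    then have "real c * t 1 \<le> real a * t 1" using le_top lvl_fundamental by fastforce
    then have "c \<le> a" using t1 mult_right_le_imp_le[of "real c" "t 1" "real a"] by simp
    ultimately have "c = a" by simp
    then have "real a * (t 1 + t 4) = 1" using c by (simp add: algebra_simps)
    \<comment> \<open>Doubling turns a (t 1 + t 4) = 1 into a product of natural numbers equal to
      2.\<close>
    moreover have "real n1 - real n3 = 2 * (t 1 + t 4)" using t by argo
    ultimately have "real a * (real n1 - real n3) = 2" by algebra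
    then have "real (a * (n1 - n3)) = real 2" using n13 by (simp add: of_nat_diff)
    then have "a * (n1 - n3) = 2" by (simp only: of_nat_eq_iff)
    then have "a dvd 2" by (metis dvd_triv_left)
    then have "a = 1 \<or> a = 2" using a dvd_imp_le[of a 2] by force
    moreover have "a \<noteq> 2"
    proof
      assume "a = 2"
      then have "sh 2 1 (\<lambda>i. real a * fundamental 1 i) \<in> wts"
        using wts_saturated[OF top(1), of 1 2] by (simp add: fundamental_def)
      moreover have "sh 2 1 (\<lambda>i. real a * fundamental 1 i) = wt4 (1/2) (1/2) (- 1/2) (- 1/2)"
        using \<open>a = 2\<close> by (simp add: fun4_eq sh_def wt4_simps fundamental_def)
      ultimately show False using wedge_not_wts by simp
    qed
    ultimately have "a = 1" by blast
    then show ?thesis using \<open>real a * (t 1 + t 4) = 1\<close> last \<open>c = a\<close> by simp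
  qed
  qed
  then have a1: "a = 1" and t14: "t 1 + t 4 = 1" and \<mu>4: "\<mu> = (\<lambda>i. - fundamental 4 i)" by auto
  have top1: "fundamental 1 \<in> wts" and N: "t 1 = real N / 2" using top a1 by simp_all
  have eps: "fundamental k \<in> wts" "(\<lambda>i. - fundamental k i) \<in> wts" for k
    using fundamental_wts[of 1 1 k] top1 by simp_all
  have n1: "n1 = n3 + 2" using t14 t by linarith
  obtain \<nu> where \<nu>: "\<nu> \<in> wts" "lvl \<nu> = real N / 2 - 2" using lvl_ex[of 2] N3 by auto
  \<comment> \<open>Otherwise the weight two levels below the top is again highest. Its level t 1 -
    2 equals - t 4 - 1, which is too low for any positive multiple of \<omega>_1 or
    \<omega>_3.\<close>
  have n3: "n3 = 1"
  proof (rule ccontr)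
    assume n3: "n3 \<noteq> 1"
    have \<nu>_hw: "sh i j \<nu> \<notin> wts" if ij: "(i, j) \<in> {(1, 2), (2, 3), (3, 4)}" for i j
    proof
      assume s: "sh i j \<nu> \<in> wts"
      have ne: "i \<noteq> j" using ij by auto
      have le: "t i - t j \<le> 2" using lvl_le[OF s] lvl_sh[OF ne] \<nu> by simp
      have "i \<noteq> 1" using ij le n n1 by auto
      then have ij': "(i, j) = (2, 3) \<or> (i, j) = (3, 4)" using ij by auto
      then have "t i - t j = 1 \<or> t i - t j = 2" using le n
      proof (elim disjE)
        assume "(i, j) = (2, 3)"
        then show ?thesis using le n by (cases "n2 = 1") (auto simp: linorder_not_le)
      next
        assume "(i, j) = (3, 4)"
        then show ?thesis using le n by (cases "n3 = 1") (auto simp: linorder_not_le)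
      qed
      then show False
      proof
        assume one: "t i - t j = 1"
        then have i2: "i = 2" "j = 3" using ij' n n3 by auto
        \<comment> \<open>Raising by the middle root would lead to \<omega>_3, whose coordinates 2
          and 3 agree. The mirror image of \<open>\<nu>\<close> then sits at the top level without
          being the top weight.\<close>
        have "sh i j \<nu> = \<mu>"
          using lvl_inj[OF s \<mu>(1)] lvl_sh[OF ne] \<nu> \<mu> one by simp
        then have "\<nu> = sh 3 2 \<mu>" using i2 sh_sh[OF ne, of \<nu>] by simp
        then have "\<nu> \<circ> Transposition.transpose 2 3 = sh 2 3 \<mu>"
          by (simp add: fun4_eq sh_def \<mu>4 fundamental_def Transposition.transpose_def)
        then have s': "sh 2 3 \<mu> \<in> wts" using wts_reflect[OF \<nu>(1)] by metis
        have "lvl (sh 2 3 \<mu>) = real a * t 1" using lvl_sh[of 2 3 \<mu>] one i2 \<mu> N a1 by simp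
        then have "sh 2 3 \<mu> = fundamental 1" using eq_top[OF s'] a1 by simp
        then have "sh 2 3 \<mu> 3 = fundamental 1 3" by simp
        then show False by (simp add: sh_def \<mu>4 fundamental_def)
      next
        assume two: "t i - t j = 2"
        have eq: "sh i j \<nu> = fundamental 1"
          using eq_top[OF s] lvl_sh[OF ne] \<nu> two N a1 by simp
        then have "\<nu> = sh j i (fundamental 1)" using sh_sh[OF ne, of \<nu>] by simp
        then have "\<nu> \<circ> Transposition.transpose i j = sh i j (fundamental 1)"
          using ij' by (auto simp: fun4_eq sh_def fundamental_def Transposition.transpose_def)
        then have "sh i j (fundamental 1) \<in> wts" using wts_reflect[OF \<nu>(1)] by metis
        then show False using lvl_le lvl_sh[OF ne] two N lvl_fundamental' by fastforce
      qed
    qed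
    have hw: "sh 1 2 \<nu> \<notin> wts" "sh 2 3 \<nu> \<notin> wts" "sh 3 4 \<nu> \<notin> wts" using \<nu>_hw by auto
    consider (first) a' :: nat where "a' \<ge> 1" "\<nu> = (\<lambda>i. real a' * fundamental 1 i)"
      | (last) c :: nat where "c \<ge> 1" "\<nu> = (\<lambda>i. - (real c * fundamental 4 i))"
      using highest_weight_cases[OF \<nu>(1) hw] by metis
    then show False
    proof cases
      case first
      have "real a' * t 1 = lvl \<nu>" unfolding first(2) lvl_fundamental ..
      then have "real a' * t 1 = t 1 - 2" using \<nu>(2) N by linarith
      moreover have "real a' * t 1 \<ge> 1 * t 1" using first t1 by (intro mult_right_mono) auto
      ultimately show ?thesis by simp
    next
      case last
      have "real c * (- t 4) = lvl \<nu>" using lvl_fundamental[of "- real c" 4] last(2) by simp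
      then have "real c * (- t 4) = t 1 - 2" using \<nu>(2) N by linarith
      moreover have "real c * (- t 4) \<ge> 1 * (- t 4)" using last t4 by (intro mult_right_mono) auto
      ultimately show ?thesis using t14 by simp
    qed
  qed
  have n13: "n1 = 3" using n1 n3 by simp
  have t34: "t 3 + t 4 < 0" using t n n13 n3 by linarith
  have short: "short_wts \<subseteq> wts" using eps by (auto simp: short_wts_def)
  \<comment> \<open>The side conditions exclude just those root steps that lead from a short weight
    to a short weight. In each remaining case a permutation moves the weight to a representative
    whose level exceeds t 1; the third case needs t 3 + t 4 < 0.\<close>
  have long: "\<mu> \<notin> wts"
    if \<mu>: "\<mu> = sh b c \<nu>" and bc: "b \<noteq> c"
      and \<nu>: "(\<exists>a. \<nu> = fundamental a \<and> a \<noteq> c) \<or> (\<exists>a. \<nu> = (\<lambda>i. - fundamental a i) \<and> a \<noteq> b)" for \<mu> \<nu> b c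
  proof
    assume w: "\<mu> \<in> wts"
    have perm: "lvl (\<mu> \<circ> p) \<le> t 1" if "bij p" for p
      using lvl_le[OF wts_permute[OF that w]] N by simp
    consider a where "\<nu> = fundamental a" "a \<noteq> c" "a \<noteq> b" | "\<nu> = fundamental b"
      | a where "\<nu> = (\<lambda>i. - fundamental a i)" "a \<noteq> c" "a \<noteq> b" | "\<nu> = (\<lambda>i. - fundamental c i)"
      using \<nu> by blast
    then show False
    proof cases
      case (1 a)
      obtain p :: "4 \<Rightarrow> 4" where p: "bij p" "p 1 = a" "p 2 = b" "p 4 = c"
        using ex_bij_three[of "1::4" 2 4 a b c] 1 bc by auto
      then have "p 3 \<noteq> a" "p 3 \<noteq> b" "p 3 \<noteq> c" unfolding p(2-)[symmetric] by (simp_all add: inj_eq[OF bij_is_inj[OF p(1)]])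
      then have "\<mu> \<circ> p = sh 2 4 (fundamental 1)"
        unfolding \<mu> 1(1) fun4_eq using p 1(2,3) bc by (auto simp: sh_def fundamental_def)
      then show False using perm[OF p(1)] lvl_sh[of 2 4 "fundamental 1"] lvl_fundamental' t_less by simp
    next
      case 2
      obtain p :: "4 \<Rightarrow> 4" where p: "bij p" "p 1 = b" "p 4 = c"
        using ex_bij_two[of "1::4" 4 b c] bc by auto
      then have "p 3 \<noteq> b" "p 3 \<noteq> c" "p 2 \<noteq> b" "p 2 \<noteq> c" unfolding p(2-)[symmetric] by (simp_all add: inj_eq[OF bij_is_inj[OF p(1)]])
      then have "\<mu> \<circ> p = sh 1 4 (fundamental 1)"
        unfolding \<mu> 2 fun4_eq using p bc by (auto simp: sh_def fundamental_def)
      then show False using perm[OF p(1)] lvl_sh[of 1 4 "fundamental 1"] lvl_fundamental' t_less by simp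
    next
      case (3 a)
      obtain p :: "4 \<Rightarrow> 4" where p: "bij p" "p 3 = a" "p 1 = b" "p 4 = c"
        using ex_bij_three[of "3::4" 1 4 a b c] 3 bc by auto
      then have "p 2 \<noteq> a" "p 2 \<noteq> b" "p 2 \<noteq> c" unfolding p(2-)[symmetric] by (simp_all add: inj_eq[OF bij_is_inj[OF p(1)]])
      then have "\<mu> \<circ> p = sh 1 4 (\<lambda>i. - fundamental 3 i)"
        unfolding \<mu> 3(1) fun4_eq using p 3(2,3) bc by (auto simp: sh_def fundamental_def)
      then show False using perm[OF p(1)] lvl_sh[of 1 4 "\<lambda>i. - fundamental 3 i"] lvl_fundamental' t34 by simp
    next
      case 4
      obtain p :: "4 \<Rightarrow> 4" where p: "bij p" "p 1 = b" "p 4 = c"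
        using ex_bij_two[of "1::4" 4 b c] bc by auto
      then have "p 3 \<noteq> b" "p 3 \<noteq> c" "p 2 \<noteq> b" "p 2 \<noteq> c" unfolding p(2-)[symmetric] by (simp_all add: inj_eq[OF bij_is_inj[OF p(1)]])
      then have "\<mu> \<circ> p = sh 1 4 (\<lambda>i. - fundamental 4 i)"
        unfolding \<mu> 4 fun4_eq using p bc by (auto simp: sh_def fundamental_def)
      then show False using perm[OF p(1)] lvl_sh[of 1 4 "\<lambda>i. - fundamental 4 i"] lvl_fundamental' t4 by simp
    qed
  qed
  \<comment> \<open>Take a weight of maximal level outside \<open>short_wts\<close>. A simple root
    would raise it into \<open>short_wts\<close>, which \<open>long\<close> forbids, so it is a
    highest weight. It is then a multiple of \<omega>_1 or \<omega>_3 with factor at least 2, and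
    that is too high.\<close>
  have wts_short: "wts = short_wts"
  proof (rule ccontr)
    assume "wts \<noteq> short_wts"
    then have ne: "wts - short_wts \<noteq> {}" using short by blast
    have fin: "finite (lvl ` (wts - short_wts))" using wts_finite by simp
    then have "Max (lvl ` (wts - short_wts)) \<in> lvl ` (wts - short_wts)" using ne by (intro Max_in) auto
    then obtain \<mu> where \<mu>: "\<mu> \<in> wts" "\<mu> \<notin> short_wts"
      and Max: "lvl \<mu> = Max (lvl ` (wts - short_wts))" by auto
    have max: "lvl \<nu> \<le> lvl \<mu>" if "\<nu> \<in> wts - short_wts" for \<nu>
      unfolding Max using fin that by (intro Max_ge) auto
    have "sh i j \<mu> \<notin> wts" if ij: "(i, j) \<in> {(1, 2), (2, 3), (3, 4)}" for i j
    proof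
      assume s: "sh i j \<mu> \<in> wts"
      have ne: "i \<noteq> j" using ij by auto
      have "t j < t i" using ij t_less by auto
      then have "sh i j \<mu> \<in> short_wts" using max[of "sh i j \<mu>"] s lvl_sh[OF ne, of \<mu>] by auto
      moreover have \<mu>_eq: "\<mu> = sh j i (sh i j \<mu>)" using sh_sh[OF ne] by simp
      moreover have "sh j i (fundamental i) = fundamental j"
        and "sh j i (\<lambda>k. - fundamental j k) = (\<lambda>k. - fundamental i k)"
        using ne by (auto simp: sh_def fundamental_def fun_eq_iff)
      moreover have "fundamental j \<in> short_wts" "(\<lambda>k. - fundamental i k) \<in> short_wts"
        by (auto simp: short_wts_def)
      moreover have "(\<exists>a. sh i j \<mu> = fundamental a \<and> a \<noteq> i) \<or>
          (\<exists>a. sh i j \<mu> = (\<lambda>i. - fundamental a i) \<and> a \<noteq> j) \<Longrightarrow> False"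
        using long[OF \<mu>_eq ne[symmetric]] \<mu>(1) by blast
      ultimately show False
        using \<mu>(2) unfolding short_wts_def by force
    qed
    then have hw: "sh 1 2 \<mu> \<notin> wts" "sh 2 3 \<mu> \<notin> wts" "sh 3 4 \<mu> \<notin> wts" by auto
    consider (first) a' :: nat where "a' \<ge> 1" "\<mu> = (\<lambda>i. real a' * fundamental 1 i)"
      | (last) c :: nat where "c \<ge> 1" "\<mu> = (\<lambda>i. - (real c * fundamental 4 i))"
      using highest_weight_cases[OF \<mu>(1) hw] by metis
    then show False
    proof cases
      case first
      have "a' \<noteq> 1" using first \<mu>(2) by (auto simp: short_wts_def)
      then have "real a' * t 1 \<ge> 2 * t 1" using first t1 by (intro mult_right_mono) auto
      moreover have "real a' * t 1 = lvl \<mu>" unfolding first(2) lvl_fundamental ..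
      then have "real a' * t 1 \<le> t 1" using lvl_le[OF \<mu>(1)] N by linarith
      ultimately show ?thesis using t1 by simp
    next
      case last
      have "c \<noteq> 1" using last \<mu>(2) by (auto simp: short_wts_def)
      then have "real c * (- t 4) \<ge> 2 * (- t 4)" using last t4 by (intro mult_right_mono) auto
      moreover have "real c * (- t 4) = lvl \<mu>" using lvl_fundamental[of "- real c" 4] last(2) by simp
      then have "real c * (- t 4) \<le> t 1" using lvl_le[OF \<mu>(1)] N by linarith
      ultimately show ?thesis using t14 t n n13 n3 by linarith
    qed
  qed
  \<comment> \<open>There are N + 1 levels and at most eight weights, and N = 2 t 1 = 5 + n2. So n2
    is 1 or 2, and oddness of \<open>N\<close> selects 2.\<close>
  have "card short_wts \<le> 4 + 4"
    unfolding short_wts_def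
    by (rule order_trans[OF card_Un_le]) (intro add_mono order_trans[OF card_image_le]; simp)
  then have "N \<le> 7" using wts_card wts_short by simp
  moreover have N5: "N = 5 + n2" using t N n13 n3 by linarith
  ultimately have "n2 = 1 \<or> n2 = 2" using n by linarith
  then have "n2 = 2" using odd_N N5 by auto
  then have "t = wt4 (7/2) (1/2) (- 3/2) (- 5/2)"
    using n t n13 n3 by (simp add: fun4_eq wt4_simps)
  then show ?thesis using N5 \<open>n2 = 2\<close> wts_short by simp
qed

end

section \<open>The diagram automorphism and the classification\<close>

definition rev4 :: "4 \<Rightarrow> 4" where
  "rev4 i = (if i = 1 then 4 else if i = 2 then 3 else if i = 3 then 2 else 1)"

lemma rev4_simps [simp]: "rev4 1 = 4" "rev4 2 = 3" "rev4 3 = 2" "rev4 4 = 1"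
  by (simp_all add: rev4_def)

lemma rev4_rev4 [simp]: "rev4 (rev4 i) = i"
  using exhaust_4[of i] by auto

lemma rev4_eq_iff [simp]: "rev4 i = rev4 j \<longleftrightarrow> i = j"
  by (metis rev4_rev4)

lemma bij_rev4: "bij rev4"
  by (rule o_bij[of rev4]) (simp_all add: fun_eq_iff)

lemma sum_rev4: "(\<Sum>k\<in>UNIV. g (rev4 k)) = (\<Sum>k\<in>UNIV. g k)"
  using sum.reindex_bij_betw[OF bij_rev4, of g] .

lemma fundamental_rev4: "fundamental k (rev4 i) = fundamental (rev4 k) i"
  unfolding fundamental_def by (metis rev4_rev4)

context principal_module
begin

text \<open>The module is twisted by the automorphism that sends a matrix to minus its transpose
  along the antidiagonal. It reverses and negates \<open>t\<close>, which keeps it decreasing, and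
  it exchanges \<omega>_1 and \<omega>_3. The grading operator itself does not change, so all
  assumptions on its eigenspaces carry over.\<close>

lemma dual: "principal_module (\<lambda>i j x. - E (rev4 j) (rev4 i) x) (\<lambda>i. - t (rev4 i)) B s N"
proof -
  have grade: "(\<Sum>k\<in>UNIV. complex_of_real (- t (rev4 k)) *s - E (rev4 k) (rev4 k) x) =
      (\<Sum>k\<in>UNIV. complex_of_real (t k) *s E k k x)" for x
    using sum_rev4[of "\<lambda>k. complex_of_real (t k) *s E k k x"] by simp
  show ?thesis
  proof (unfold_locales, unfold grade)
    show "x \<in> vec.span {v. \<exists>l. (\<Sum>k\<in>UNIV. complex_of_real (t k) *s E k k v) = complex_of_real l *s v}" for x
      by (rule spanning)
    show "x \<noteq> 0 \<Longrightarrow> \<exists>y. B x y \<noteq> 0" for x by (rule B_nondeg)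
    show "\<exists>x. - E (rev4 j) (rev4 i) x \<noteq> 0" if "i \<noteq> j" for i j
      using nontrivial[of "rev4 j" "rev4 i"] that by auto
    show "x = 0" if "\<And>i j. - E (rev4 j) (rev4 i) x = 0" for x
    proof (rule no_invariants)
      show "E i j x = 0" for i j using that[of "rev4 i" "rev4 j"] by simp
    qed
    show "(\<Sum>k\<in>UNIV. - E (rev4 k) (rev4 k) x) = 0" for x
      using trace0[of x] sum_rev4[of "\<lambda>k. E k k x"] by (simp add: sum_negf)
    show "(\<Sum>k\<in>UNIV. - t (rev4 k)) = 0"
      using t_sum sum_rev4[of t] by (simp add: sum_negf)
    show "- E (rev4 j) (rev4 i) (- E (rev4 q) (rev4 p) x) =
        - E (rev4 q) (rev4 p) (- E (rev4 j) (rev4 i) x) +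
        (if j = p then - E (rev4 q) (rev4 i) x else 0) - (if q = i then - E (rev4 j) (rev4 p) x else 0)"
      for i j p q x
      using comm[of "rev4 j" "rev4 i" "rev4 q" "rev4 p" x] by (auto simp: E_neg)
    show "B (- E (rev4 j) (rev4 i) x) y = - B x (- E (rev4 j) (rev4 i) y)" for i j x y
      using B_inv[of "rev4 j" "rev4 i" x y] B_scale[of "- 1" "E (rev4 j) (rev4 i) x" y]
        B_scale_right[of x "- 1" "E (rev4 j) (rev4 i) y"] by simp
    show "B x y = s * B y x" for x y by (rule B_sym)
    show "\<exists>c. y = c *s x" if "x \<noteq> 0"
      "(\<Sum>k\<in>UNIV. complex_of_real (t k) *s E k k x) = complex_of_real l *s x"
      "(\<Sum>k\<in>UNIV. complex_of_real (t k) *s E k k y) = complex_of_real l *s y" for x y l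
      using simple[OF that] .
    show "\<exists>k\<le>N. l = real N / 2 - real k" if "x \<noteq> 0"
      "(\<Sum>k\<in>UNIV. complex_of_real (t k) *s E k k x) = complex_of_real l *s x" for x l
      using level_range[OF that] .
    show "\<exists>x. x \<noteq> 0 \<and> (\<Sum>k\<in>UNIV. complex_of_real (t k) *s E k k x) =
        complex_of_real (real N / 2 - real n) *s x" if "n \<le> N" for n
      using level_ex[OF that] .
    show "odd N \<Longrightarrow> s = - 1" by (rule sign)
  qed (simp_all add: E_add E_scale B_add B_scale t_mono)
qed

theorem classification:
  "wts = short_wts \<and> (t = wt4 (7/2) (1/2) (- 3/2) (- 5/2) \<or> t = wt4 (5/2) (3/2) (- 1/2) (- 7/2))"
proof -
  obtain \<mu> where \<mu>: "\<mu> \<in> wts" "lvl \<mu> = real N / 2" using lvl_ex[of 0] by auto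
  have hw: "sh i j \<mu> \<notin> wts" if ij: "t j < t i" for i j
  proof
    assume "sh i j \<mu> \<in> wts"
    moreover have "i \<noteq> j" using ij by auto
    ultimately show False using lvl_le[of "sh i j \<mu>"] lvl_sh[of i j \<mu>] \<mu>(2) ij by simp
  qed
  consider (first) a :: nat where "a \<ge> 1" "\<mu> = (\<lambda>i. real a * fundamental 1 i)"
    | (last) a :: nat where "a \<ge> 1" "\<mu> = (\<lambda>i. - (real a * fundamental 4 i))"
    using highest_weight_cases[OF \<mu>(1) hw[OF t_less(1)] hw[OF t_less(2)] hw[OF t_less(3)]] by metis
  then show ?thesis
  proof cases
    case first
    have "real a * t 1 = real N / 2" using \<mu>(2) unfolding first(2) lvl_fundamental .
    then show ?thesis using top_first[of a] first \<mu>(1) by blast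
  next
    case last
    interpret d: principal_module "\<lambda>i j x. - E (rev4 j) (rev4 i) x" "\<lambda>i. - t (rev4 i)" B s N
      by (rule dual)
    have wts_iff: "\<nu> \<in> wts \<longleftrightarrow> (\<lambda>i. - \<nu> (rev4 i)) \<in> d.wts" for \<nu>
    proof -
      have "wv \<nu> v \<longleftrightarrow> d.wv (\<lambda>i. - \<nu> (rev4 i)) v" for v
        unfolding wv_def d.wv_def by (simp, metis rev4_rev4)
      then show ?thesis unfolding wts_def d.wts_def mem_Collect_eq by blast
    qed
    have "(\<lambda>i. real a * fundamental 1 i) \<in> d.wts"
      using \<mu>(1) unfolding wts_iff last(2) by (simp add: fundamental_rev4)
    moreover have "real a * - t (rev4 1) = real N / 2"
      using \<mu>(2) lvl_fundamental[of "- real a" 4] last(2) by simp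
    ultimately have *: "(\<lambda>i. - t (rev4 i)) = wt4 (7/2) (1/2) (- 3/2) (- 5/2)" "d.wts = short_wts"
      using d.top_first[of a] last(1) by blast+
    have t: "t = wt4 (5/2) (3/2) (- 1/2) (- 7/2)"
      using *(1) by (auto simp: fun4_eq wt4_simps)
    have "\<nu> \<in> wts \<longleftrightarrow> \<nu> \<in> short_wts" for \<nu>
    proof -
      have A: "(\<lambda>i. - \<nu> (rev4 i)) \<in> short_wts" if "\<nu> \<in> short_wts" for \<nu>
        using that by (auto simp: short_wts_def fundamental_rev4)
      have "(\<lambda>i. - (\<lambda>i. - \<nu> (rev4 i)) (rev4 i)) = \<nu>" by simp
      with A[of \<nu>] A[of "\<lambda>i. - \<nu> (rev4 i)"] show ?thesis unfolding wts_iff *(2) by auto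
    qed
    with t show ?thesis by blast
  qed
qed

section \<open>Bases adapted to the standard module and its dual\<close>

lemma standard_basis:
  assumes "wts = short_wts"
  obtains u where "\<And>k. wv (fundamental k) (u k)"
    "\<And>i j k. E i j (u k) = (if j = k then u i else 0) - (if i = j then (1 / 4) *s u k else 0)"
proof -
  have eps: "fundamental k \<in> wts" for k by (simp add: assms short_wts_def)
  then obtain u1 where u1: "wv (fundamental 1) u1" by (auto simp: wts_def)
  define u where "u = (\<lambda>k. if k = 1 then u1 else E k 1 u1)"
  have u: "wv (fundamental k) (u k)" for k
  proof (cases "k = 1")
    case False
    have "sh k 1 (fundamental 1) = fundamental k"
      using False by (auto simp: sh_def fundamental_def)
    then show ?thesis
      using wv_E[OF u1 wv_adjacent[OF u1 False] False] eps False by (simp add: u_def)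
  qed (simp add: u_def u1)
  have vanish: "E i j (u k) = 0" if "i \<noteq> j" "j \<noteq> k" for i j k
  proof (rule ccontr)
    assume "E i j (u k) \<noteq> 0"
    then have "sh i j (fundamental k) \<in> short_wts"
      using wv_E[OF u _ that(1)] assms by (auto simp: wts_def)
    then obtain l where "sh i j (fundamental k) = fundamental l \<or>
        sh i j (fundamental k) = (\<lambda>i. - fundamental l i)" by (auto simp: short_wts_def)
    then have "sh i j (fundamental k) j = fundamental l j \<or>
        sh i j (fundamental k) j = - fundamental l j" by auto
    then show False using that by (auto simp: sh_def fundamental_def split: if_splits)
  qed
  have move: "E i k (u k) = u i" if "i \<noteq> k" for i k
  proof (cases "k = 1")
    case False
    have "E i k u1 = 0" using vanish[of i k 1] that False by (simp add: u_def)
    then have "E i k (E k 1 u1) = E i 1 u1 - (if 1 = i then E k k u1 else 0)"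
      using comm[of i k k 1 u1] by (simp add: E_zero)
    moreover have "E 1 1 u1 - E k k u1 = u1"
      using u1 False by (simp add: wv_def fundamental_def vec_eq_iff)
    ultimately show ?thesis using False by (auto simp: u_def)
  qed (use that in \<open>simp add: u_def\<close>)
  have "E i j (u k) = (if j = k then u i else 0) - (if i = j then (1 / 4) *s u k else 0)" for i j k
  proof (cases "i = j")
    case True
    then show ?thesis using u[of k] by (simp add: wv_def fundamental_def vec_eq_iff)
  qed (use vanish move in auto)
  with u that show ?thesis by blast
qed

text \<open>\<open>F\<close> is the inverse of the map \<Psi> that sends coordinates to combinations
  of two families of weight vectors. Matrix units separate the coordinates, which gives injectivity;
  the lines through these weight vectors contain all eigenvectors, which gives surjectivity.\<close>

theorem standard_plus_dual:
  assumes "wts = short_wts"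
  obtains F :: "complex^'v \<Rightarrow> (complex^4) \<times> (complex^4)" where "bij F"
    "\<And>x y. F (x + y) = F x + F y" "\<And>c x. F (c *s x) = (c *s fst (F x), c *s snd (F x))"
    "\<And>i j x. fst (F (E i j x)) = (\<chi> k. (if k = i then fst (F x) $ j else 0) -
        (if i = j then fst (F x) $ k / 4 else 0))"
    "\<And>i j x. snd (F (E i j x)) = (\<chi> k. (if i = j then snd (F x) $ k / 4 else 0) -
        (if k = j then snd (F x) $ i else 0))"
proof -
  obtain u where u: "\<And>k. wv (fundamental k) (u k)"
    "\<And>i j k. E i j (u k) = (if j = k then u i else 0) - (if i = j then (1 / 4) *s u k else 0)"
    using standard_basis[OF assms] by metis
  interpret d: principal_module "\<lambda>i j x. - E (rev4 j) (rev4 i) x" "\<lambda>i. - t (rev4 i)" B s N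
    by (rule dual)
  have "d.wts = short_wts" using d.classification by blast
  then obtain u' where u': "\<And>k. d.wv (fundamental k) (u' k)"
    "\<And>i j k. - E (rev4 j) (rev4 i) (u' k) = (if j = k then u' i else 0) - (if i = j then (1 / 4) *s u' k else 0)"
    using d.standard_basis by metis
  \<comment> \<open>A standard basis of the twisted module consists of dual weight vectors of the
    original one; reversing the index gives \<open>w k\<close> the weight opposite to
    \<open>fundamental k\<close>.\<close>
  define w where "w = (\<lambda>k. u' (rev4 k))"
  have w_E: "E i j (w k) = (if i = j then (1 / 4) *s w k else 0) - (if i = k then w j else 0)" for i j k
  proof -
    have "- E i j (w k) = (if rev4 i = rev4 k then u' (rev4 j) else 0) -
        (if rev4 j = rev4 i then (1 / 4) *s u' (rev4 k) else 0)"
      using u'(2)[of "rev4 i" "rev4 j" "rev4 k"] by (simp add: w_def)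
    then have "E i j (w k) = - ((if rev4 i = rev4 k then u' (rev4 j) else 0) -
        (if rev4 j = rev4 i then (1 / 4) *s u' (rev4 k) else 0))" by (metis minus_minus)
    then show ?thesis by (auto simp: w_def)
  qed
  have w: "wv (\<lambda>i. - fundamental k i) (w k)" for k
    using u'(1)[of "rev4 k"] w_E[of _ _ k]
    by (auto simp: wv_def d.wv_def w_def fundamental_def vec_eq_iff)
  define \<Psi> where "\<Psi> = (\<lambda>p. (\<Sum>k\<in>UNIV. fst p $ k *s u k) + (\<Sum>k\<in>UNIV. snd p $ k *s w k))"
  have \<Psi>_add: "\<Psi> (p + q) = \<Psi> p + \<Psi> q" for p q
    by (simp add: \<Psi>_def vec.scale_left_distrib sum.distrib)
  have \<Psi>_scale: "\<Psi> (c *s y, c *s z) = c *s \<Psi> (y, z)" for c y z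
    by (simp add: \<Psi>_def vec.scale_right_distrib vec.scale_sum_right)
  define act where "act = (\<lambda>i j (p :: (complex^4) \<times> (complex^4)).
    ((\<chi> k. (if k = i then fst p $ j else 0) - (if i = j then fst p $ k / 4 else 0)) :: complex^4,
     (\<chi> k. (if i = j then snd p $ k / 4 else 0) - (if k = j then snd p $ i else 0)) :: complex^4))"
  have \<Psi>_E: "E i j (\<Psi> p) = \<Psi> (act i j p)" for i j p
  proof -
    have "(\<Sum>k\<in>UNIV. fst p $ k *s E i j (u k)) =
        (\<Sum>k\<in>UNIV. (if j = k then fst p $ k *s u i else 0)) -
        (\<Sum>k\<in>UNIV. (if i = j then (fst p $ k / 4) *s u k else 0))"
      unfolding sum_subtractf[symmetric] u(2) by (intro sum.cong) (auto simp: vec.scale_right_diff_distrib)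
    also have "\<dots> = (\<Sum>k\<in>UNIV. (if k = i then fst p $ j *s u k else 0)) -
        (\<Sum>k\<in>UNIV. (if i = j then (fst p $ k / 4) *s u k else 0))" by simp
    also have "\<dots> = (\<Sum>k\<in>UNIV. fst (act i j p) $ k *s u k)"
      unfolding sum_subtractf[symmetric] act_def
      by (intro sum.cong) (auto simp: vec.scale_left_diff_distrib)
    finally have 1: "(\<Sum>k\<in>UNIV. fst p $ k *s E i j (u k)) = (\<Sum>k\<in>UNIV. fst (act i j p) $ k *s u k)" .
    have "(\<Sum>k\<in>UNIV. snd p $ k *s E i j (w k)) =
        (\<Sum>k\<in>UNIV. (if i = j then (snd p $ k / 4) *s w k else 0)) -
        (\<Sum>k\<in>UNIV. (if i = k then snd p $ k *s w j else 0))"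
      unfolding sum_subtractf[symmetric] w_E by (intro sum.cong) (auto simp: vec.scale_right_diff_distrib)
    also have "\<dots> = (\<Sum>k\<in>UNIV. (if i = j then (snd p $ k / 4) *s w k else 0)) -
        (\<Sum>k\<in>UNIV. (if k = j then snd p $ i *s w k else 0))" by simp
    also have "\<dots> = (\<Sum>k\<in>UNIV. snd (act i j p) $ k *s w k)"
      unfolding sum_subtractf[symmetric] act_def
      by (intro sum.cong) (auto simp: vec.scale_left_diff_distrib)
    finally have 2: "(\<Sum>k\<in>UNIV. snd p $ k *s E i j (w k)) = (\<Sum>k\<in>UNIV. snd (act i j p) $ k *s w k)" .
    show ?thesis using 1 2 by (simp add: \<Psi>_def E_add E_sum E_scale)
  qed
  have nz: "u k \<noteq> 0" "w k \<noteq> 0" for k using u(1) w by (auto simp: wv_def)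
  have third: "\<exists>k. k \<noteq> i \<and> k \<noteq> j" for i j :: 4
    using exhaust_4[of i] exhaust_4[of j] by (elim disjE) (auto intro: exI[of _ 1] exI[of _ 2] exI[of _ 3])
  have \<Psi>_0: "\<Psi> 0 = 0" using \<Psi>_add[of 0 0] by simp
  have zero: "p = 0" if p: "\<Psi> p = 0" for p
  proof -
    have *: "fst p $ j *s u i - snd p $ i *s w j = 0" if "i \<noteq> j" for i j
    proof -
      have eq: "fst (act i j p) $ k *s u k = (if k = i then fst p $ j *s u k else 0)"
        "snd (act i j p) $ k *s w k = (if k = j then - (snd p $ i *s w k) else 0)" for k
        using that by (simp_all add: act_def)
      have "E i j (\<Psi> p) = fst p $ j *s u i - snd p $ i *s w j"
        unfolding \<Psi>_E unfolding \<Psi>_def eq by simp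
      then show ?thesis using p by (simp add: E_zero)
    qed
    \<comment> \<open>With a third index \<open>l\<close>, the operator \<open>E l i\<close> kills
      the dual term and \<open>E j l\<close> kills the standard term, so each coefficient is
      isolated.\<close>
    have "fst p $ j = 0 \<and> snd p $ i = 0" if ij: "i \<noteq> j" for i j
    proof -
      obtain l where l: "l \<noteq> i" "l \<noteq> j" using third by blast
      have "E l i (fst p $ j *s u i - snd p $ i *s w j) = fst p $ j *s u l"
        using l ij by (simp add: E_diff E_scale u(2) w_E)
      moreover have "E j l (fst p $ j *s u i - snd p $ i *s w j) = snd p $ i *s w l"
        using l ij by (simp add: E_diff E_scale u(2) w_E)
      ultimately show ?thesis using *[OF ij] nz by (simp add: E_zero)
    qed
    then have "fst p $ i = 0" "snd p $ i = 0" for i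
      using third[of i i] by metis+
    then show ?thesis by (simp add: prod_eq_iff vec_eq_iff)
  qed
  have inj: "inj \<Psi>"
  proof (rule injI)
    fix p q assume pq: "\<Psi> p = \<Psi> q"
    have "\<Psi> (p - q) + \<Psi> q = \<Psi> p" using \<Psi>_add[of "p - q" q] by simp
    then have "\<Psi> (p - q) = 0" using pq by simp
    then have "p - q = 0" by (rule zero)
    then show "p = q" by simp
  qed
  have single: "u k = \<Psi> (axis k 1, 0)" "w k = \<Psi> (0, axis k 1)" for k
    by (simp_all add: \<Psi>_def axis_def if_distrib[of "\<lambda>c. c *s _"] cong: if_cong)
  have surj: "x \<in> range \<Psi>" for x
    using spanning[of x]
  proof (induction rule: vec.span_induct_alt)
    case base
    then show ?case using \<Psi>_0 by (metis rangeI)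
  next
    case (step c v y)
    obtain q where q: "y = \<Psi> q" using step by auto
    obtain l where l: "lev l v" using step by (auto simp: lev_def)
    have "v \<in> range \<Psi>"
    proof (cases "v = 0")
      case True
      then show ?thesis using \<Psi>_0 by (metis rangeI)
    next
      case False
      obtain \<mu> where \<mu>: "wv \<mu> v" using lev_wv[OF False l] .
      then have "\<mu> \<in> short_wts" using assms by (auto simp: wts_def)
      then obtain k where "\<mu> = fundamental k \<or> \<mu> = (\<lambda>i. - fundamental k i)"
        by (auto simp: short_wts_def)
      then obtain b p where "v = b *s \<Psi> p"
        using wv_line[OF u(1) \<mu>] wv_line[OF w \<mu>] single by metis
      then have "v = \<Psi> (b *s fst p, b *s snd p)" using \<Psi>_scale by simp
      then show ?thesis by blast
    qed
    then obtain p where "v = \<Psi> p" by auto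
    then have "c *s v + y = \<Psi> ((c *s fst p, c *s snd p) + q)" using \<Psi>_scale \<Psi>_add q by simp
    then show ?case by blast
  qed
  have bij: "bij \<Psi>" using inj surj by (auto simp: bij_def)
  define F where "F = inv \<Psi>"
  have \<Psi>F: "\<Psi> (F x) = x" and F\<Psi>: "F (\<Psi> p) = p" for x p
    using bij by (simp_all add: F_def bij_is_surj surj_f_inv_f bij_is_inj)
  show ?thesis
  proof (rule that)
    show "bij F" using bij by (simp add: F_def bij_imp_bij_inv)
    show "F (x + y) = F x + F y" for x y by (metis \<Psi>F F\<Psi> \<Psi>_add)
    show "F (c *s x) = (c *s fst (F x), c *s snd (F x))" for c x
      by (metis \<Psi>F F\<Psi> \<Psi>_scale prod.collapse)
    have "F (E i j x) = act i j (F x)" for i j x by (metis \<Psi>F F\<Psi> \<Psi>_E)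
    then show "fst (F (E i j x)) = (\<chi> k. (if k = i then fst (F x) $ j else 0) -
        (if i = j then fst (F x) $ k / 4 else 0))"
      "snd (F (E i j x)) = (\<chi> k. (if i = j then snd (F x) $ k / 4 else 0) -
        (if k = j then snd (F x) $ i else 0))" for i j x
      by (simp_all add: act_def)
  qed
qed

end

section \<open>Polynomial calculus on matrix groups\<close>

lemma cscale_mult_left: "cscale c A ** B = cscale c (A ** B)"
  and cscale_mult_right: "A ** cscale c B = cscale c (A ** B)"
  for A :: "complex^'n^'m" and B :: "complex^'k^'n"
  by (simp_all add: cscale_def matrix_matrix_mult_def vec_eq_iff sum_distrib_left mult_ac)

lemma cscale_vector: "cscale c A *v x = c *s (A *v x)"
  for A :: "complex^'n^'m"
  by (simp add: cscale_def matrix_vector_mult_def vec_eq_iff sum_distrib_left mult_ac)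

lemma matrix_inv_left: "invertible A \<Longrightarrow> matrix_inv A ** A = mat 1"
  and matrix_inv_right: "invertible A \<Longrightarrow> A ** matrix_inv A = mat 1"
  for A :: "complex^'n^'n"
  unfolding invertible_def matrix_inv_def
  by (drule someI_ex, simp)+

lemma matrix_diff_mult: "(A - B) ** C = A ** C - B ** C" and matrix_mult_diff: "C ** (A - B) = C ** A - C ** B"
  for A B C :: "complex^'n^'n"
  by (simp_all add: matrix_matrix_mult_def vec_eq_iff algebra_simps sum_subtractf)

lemma matrix_add_mult: "(A + B) ** C = A ** C + B ** C"
  for A B :: "complex^'n^'m" and C :: "complex^'k^'n"
  by (simp add: matrix_matrix_mult_def vec_eq_iff algebra_simps sum.distrib)

lemma polyfun_mono: "polyfun K f \<Longrightarrow> polyfun UNIV f"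
  by (induction rule: polyfun.induct) (auto intro: polyfun.intros)

text \<open>The derivative \<open>dir_deriv\<close> at an arbitrary base point, as needed for vector
  fields on the matrix space.\<close>

definition pd :: "(complex^'n^'n \<Rightarrow> complex) \<Rightarrow> complex^'n^'n \<Rightarrow> complex^'n^'n \<Rightarrow> complex" where
  "pd f A X = deriv (\<lambda>z. f (A + cscale z X)) 0"

lemma dir_deriv_pd: "dir_deriv f X = pd f (mat 1) X"
  by (simp add: dir_deriv_def pd_def)

lemma pd_DERIV:
  "polyfun UNIV f \<Longrightarrow> ((\<lambda>z. f (A + cscale z X)) has_field_derivative pd f A X) (at 0)"
  unfolding pd_def using polyfun_differentiable field_differentiable_derivI by blast

lemma pd_const: "pd (\<lambda>_. c) A X = 0"
  by (simp add: pd_def)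

lemma pd_add:
  assumes "polyfun UNIV f" "polyfun UNIV g"
  shows "pd (\<lambda>A. f A + g A) A X = pd f A X + pd g A X"
  using DERIV_imp_deriv[OF DERIV_add[OF pd_DERIV[OF assms(1)] pd_DERIV[OF assms(2)]], of A X A X]
  by (simp add: pd_def)

lemma pd_diff:
  assumes "polyfun UNIV f" "polyfun UNIV g"
  shows "pd (\<lambda>A. f A - g A) A X = pd f A X - pd g A X"
  using DERIV_imp_deriv[OF DERIV_diff[OF pd_DERIV[OF assms(1)] pd_DERIV[OF assms(2)]], of A X A X]
  by (simp add: pd_def)

lemma pd_mult:
  assumes "polyfun UNIV f" "polyfun UNIV g"
  shows "pd (\<lambda>A. f A * g A) A X = pd f A X * g A + f A * pd g A X"
  using DERIV_imp_deriv[OF DERIV_mult[OF pd_DERIV[OF assms(1)] pd_DERIV[OF assms(2)]], of A X A X]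
  by (simp add: pd_def mult.commute)

lemma pd_cmult: "polyfun UNIV f \<Longrightarrow> pd (\<lambda>A. c * f A) A X = c * pd f A X"
  and pd_multc: "polyfun UNIV f \<Longrightarrow> pd (\<lambda>A. f A * c) A X = pd f A X * c"
  using pd_mult[of "\<lambda>_. c" f A X] pd_mult[of f "\<lambda>_. c" A X] polyfun.const[of c UNIV]
  by (simp_all add: pd_const)

lemma pd_sum:
  assumes "finite I" "\<And>i. i \<in> I \<Longrightarrow> polyfun UNIV (f i)"
  shows "pd (\<lambda>A. \<Sum>i\<in>I. f i A) A X = (\<Sum>i\<in>I. pd (f i) A X)"
  using assms by (induction I rule: finite_induct) (simp_all add: pd_const pd_add polyfun_sum)

lemma pd_linear_entry: "pd (\<lambda>A. (A ** Y) $ i $ j) A X = (X ** Y) $ i $ j"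
proof -
  have "(\<lambda>z. ((A + cscale z X) ** Y) $ i $ j) = (\<lambda>z. (A ** Y) $ i $ j + z * (X ** Y) $ i $ j)"
    unfolding matrix_add_mult cscale_mult_left by (simp add: cscale_def)
  moreover have "((\<lambda>z. (A ** Y) $ i $ j + z * (X ** Y) $ i $ j) has_field_derivative (X ** Y) $ i $ j) (at 0)"
    by (auto intro!: derivative_eq_intros)
  ultimately show ?thesis unfolding pd_def by (simp add: DERIV_imp_deriv)
qed

lemma pd_entry: "pd (\<lambda>A. A $ i $ j) A X = X $ i $ j"
  using pd_linear_entry[of "mat 1" i j A X] by simp

lemma polyfun_entries: "polyfun UNIV (\<lambda>A. (C ** A ** D) $ i $ j)"
  unfolding matrix_matrix_mult_def
  by (simp, intro polyfun_sum polyfun.mult polyfun.const polyfun.entry) auto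

lemma polyfun_comp_mult:
  "polyfun UNIV f \<Longrightarrow> polyfun UNIV (\<lambda>A. f (C ** A ** D))"
proof (induction rule: polyfun.induct)
  case (entry i j)
  show ?case by (rule polyfun_entries)
qed (auto intro: polyfun.intros)

lemma pd_vec_add: "polyfun UNIV f \<Longrightarrow> pd f A (X + Y) = pd f A X + pd f A Y"
  by (induction rule: polyfun.induct)
    (simp_all add: pd_const pd_entry pd_add pd_mult algebra_simps)

lemma pd_vec_scale: "polyfun UNIV f \<Longrightarrow> pd f A (cscale c X) = c * pd f A X"
proof (induction rule: polyfun.induct)
  case (entry i j)
  show ?case by (simp add: pd_entry cscale_def)
qed (simp_all add: pd_const pd_add pd_mult algebra_simps)

lemma pd_comp_mult: "pd (\<lambda>A. f (C ** A ** D)) A X = pd f (C ** A ** D) (C ** X ** D)"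
proof -
  have "C ** (A + cscale z X) ** D = C ** A ** D + cscale z (C ** X ** D)" for z
    by (simp add: matrix_add_ldistrib matrix_add_mult cscale_mult_left cscale_mult_right)
  then show ?thesis by (simp add: pd_def)
qed

text \<open>The derivation of the left invariant vector field given by \<open>X\<close>.\<close>

definition lder :: "complex^'n^'n \<Rightarrow> (complex^'n^'n \<Rightarrow> complex) \<Rightarrow> complex^'n^'n \<Rightarrow> complex" where
  "lder X f = (\<lambda>A. pd f A (A ** X))"

lemma lder_one: "lder X f (mat 1) = dir_deriv f X"
  by (simp add: lder_def dir_deriv_pd)

lemma lder_rules:
  "lder X (\<lambda>_. c) = (\<lambda>_. 0)"
  "lder X (\<lambda>A. (A ** Y) $ i $ j) = (\<lambda>A. (A ** X ** Y) $ i $ j)"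
  "polyfun UNIV f \<Longrightarrow> polyfun UNIV g \<Longrightarrow> lder X (\<lambda>A. f A + g A) = (\<lambda>A. lder X f A + lder X g A)"
  "polyfun UNIV f \<Longrightarrow> polyfun UNIV g \<Longrightarrow>
     lder X (\<lambda>A. f A * g A) = (\<lambda>A. lder X f A * g A + f A * lder X g A)"
  by (simp_all add: lder_def pd_const pd_linear_entry pd_add pd_mult)

lemma lder_entry: "lder X (\<lambda>A. A $ i $ j) = (\<lambda>A. (A ** X) $ i $ j)"
  by (simp add: lder_def pd_entry)

lemma polyfun_lder: "polyfun UNIV f \<Longrightarrow> polyfun UNIV (lder X f)"
proof (induction rule: polyfun.induct)
  case (entry i j)
  show ?case using polyfun_entries[of "mat 1" X i j] by (simp add: lder_entry)
qed (auto simp: lder_rules intro: polyfun.intros)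

text \<open>In the commutator of two derivations the mixed terms of the product rule cancel, so the
  identity only has to be checked on matrix entries.\<close>

lemma lder_bracket:
  "polyfun UNIV f \<Longrightarrow> lder X (lder Y f) A - lder Y (lder X f) A = lder (bracket X Y) f A"
proof (induction rule: polyfun.induct)
  case (entry i j)
  show ?case
    by (simp add: lder_entry lder_rules bracket_def matrix_mult_diff matrix_mul_assoc)
next
  case (add f g)
  have "lder X (lder Y (\<lambda>A. f A + g A)) A = lder X (lder Y f) A + lder X (lder Y g) A" for X Y
    by (simp only: lder_rules(3) add.hyps polyfun_lder)
  moreover have "lder (bracket X Y) (\<lambda>A. f A + g A) A = lder (bracket X Y) f A + lder (bracket X Y) g A"
    by (simp only: lder_rules(3) add.hyps)
  ultimately show ?case unfolding add.IH[symmetric] by simp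
next
  case (mult f g)
  have "lder X (lder Y (\<lambda>A. f A * g A)) A =
      lder X (lder Y f) A * g A + lder Y f A * lder X g A +
      (lder X f A * lder Y g A + f A * lder X (lder Y g) A)" for X Y
    by (simp only: lder_rules(3,4) mult.hyps polyfun_lder polyfun.mult)
  moreover have "lder (bracket X Y) (\<lambda>A. f A * g A) A =
      lder (bracket X Y) f A * g A + f A * lder (bracket X Y) g A"
    by (simp only: lder_rules(4) mult.hyps)
  ultimately show ?case unfolding mult.IH[symmetric] by (simp add: algebra_simps)
qed (simp add: lder_rules(1))

lemma dir_deriv_bracket:
  "polyfun UNIV f \<Longrightarrow>
    dir_deriv f (bracket X Y) = dir_deriv (lder Y f) X - dir_deriv (lder X f) Y"
  using lder_bracket[of f X Y "mat 1"] by (simp add: lder_one)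

text \<open>Left translation by \<open>g\<close> maps the group to itself, so the translated
  polynomial vanishes on it too. The factor \<open>mat 1\<close> on the right only brings the
  argument into the two-sided form of \<open>polyfun_comp_mult\<close>.\<close>

lemma lder_vanishing:
  assumes G: "matrix_group G" and f: "polyfun UNIV f" "\<forall>g\<in>G. f g = 0"
    and X: "X \<in> lie_algebra G" and g: "g \<in> G"
  shows "lder X f g = 0"
proof -
  have "polyfun UNIV (\<lambda>h. f (g ** h ** mat 1))" by (rule polyfun_comp_mult[OF f(1)])
  moreover have "\<forall>h\<in>G. f (g ** h ** mat 1) = 0"
    using G f(2) g unfolding matrix_group_def by simp
  ultimately have "dir_deriv (\<lambda>h. f (g ** h ** mat 1)) X = 0"
    using X unfolding lie_algebra_def by blast
  then show ?thesis unfolding dir_deriv_pd pd_comp_mult by (simp add: lder_def)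
qed

lemma lie_algebra_subspace: "cmat.subspace (lie_algebra G)"
proof (rule cmat.subspaceI)
  show "0 \<in> lie_algebra G"
  proof -
    have "dir_deriv f 0 = 0" if "polyfun UNIV f" for f :: "complex^'n^'n \<Rightarrow> complex"
      using pd_vec_add[OF that, of "mat 1" 0 0] by (simp add: dir_deriv_pd)
    then show ?thesis unfolding lie_algebra_def by blast
  qed
qed (simp_all add: lie_algebra_def dir_deriv_pd pd_vec_add pd_vec_scale)

lemma lie_algebra_bracket:
  assumes G: "matrix_group G" and X: "X \<in> lie_algebra G" and Y: "Y \<in> lie_algebra G"
  shows "bracket X Y \<in> lie_algebra G"
proof -
  have "dir_deriv f (bracket X Y) = 0" if f: "polyfun UNIV f" "\<forall>g\<in>G. f g = 0" for f
  proof -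
    have "dir_deriv (lder Z f) W = 0" if "Z \<in> lie_algebra G" "W \<in> lie_algebra G" for Z W
      using that polyfun_lder[OF f(1)] lder_vanishing[OF G f that(1)]
      unfolding lie_algebra_def by blast
    then show ?thesis using dir_deriv_bracket[OF f(1)] X Y by simp
  qed
  then show ?thesis by (simp add: lie_algebra_def)
qed

lemma lie_algebra_conjugate:
  assumes G: "matrix_group G" and s: "s \<in> G" and X: "X \<in> lie_algebra G"
  shows "matrix_inv s ** X ** s \<in> lie_algebra G"
proof -
  have inv: "matrix_inv s \<in> G" "matrix_inv s ** s = mat 1"
    using G s by (auto simp: matrix_group_def matrix_inv_left)
  have "dir_deriv f (matrix_inv s ** X ** s) = 0" if f: "polyfun UNIV f" "\<forall>g\<in>G. f g = 0" for f
  proof -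
    have "\<forall>h\<in>G. f (matrix_inv s ** h ** s) = 0"
      using f(2) G inv(1) s unfolding matrix_group_def by blast
    then have "dir_deriv (\<lambda>h. f (matrix_inv s ** h ** s)) X = 0"
      using X polyfun_comp_mult[OF f(1)] unfolding lie_algebra_def by blast
    then show ?thesis unfolding dir_deriv_pd pd_comp_mult by (simp add: inv)
  qed
  then show ?thesis by (simp add: lie_algebra_def)
qed

text \<open>By multiplicativity the determinant is an eigenfunction of every left invariant field.
  Two such derivatives therefore commute on it, so its derivative at the identity kills
  brackets.\<close>

lemma lder_det: "lder X det = (\<lambda>g. dir_deriv det X * det g)"
  for X :: "complex^'n^'n"
proof
  fix g :: "complex^'n^'n"
  have "lder X det g = pd (\<lambda>h. det (g ** h ** mat 1)) (mat 1) X"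
    unfolding pd_comp_mult by (simp add: lder_def)
  also have "\<dots> = pd (\<lambda>h. det g * det h) (mat 1) X" by (simp add: det_mul)
  finally show "lder X det g = dir_deriv det X * det g"
    by (simp add: pd_cmult polyfun_det dir_deriv_pd)
qed

lemma dir_deriv_det_bracket: "dir_deriv det (bracket X Y) = 0"
  unfolding dir_deriv_bracket[OF polyfun_det] lder_det
  by (simp add: dir_deriv_pd pd_cmult polyfun_det)

lemma dir_deriv_det_power: "dir_deriv (\<lambda>g. det g ^ k) X = of_nat k * dir_deriv det X"
proof (induction k)
  case (Suc k)
  then show ?case
    by (simp add: dir_deriv_pd pd_mult polyfun_det polyfun_power algebra_simps)
qed (simp add: dir_deriv_pd pd_const)

section \<open>Complex conjugation\<close>

definition cnj_mat :: "complex^'n^'m \<Rightarrow> complex^'n^'m" where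
  "cnj_mat A = (\<chi> i j. cnj (A $ i $ j))"

lemma cnj_mat_vec: "cnj_vec (A *v x) = cnj_mat A *v cnj_vec x"
  by (simp add: cnj_mat_def cnj_vec_def matrix_vector_mult_def vec_eq_iff)

lemma cnj_mat_cnj_mat [simp]: "cnj_mat (cnj_mat A) = A"
  by (simp add: cnj_mat_def vec_eq_iff)

lemma cnj_mat_one [simp]: "cnj_mat (mat 1) = mat 1"
  by (simp add: cnj_mat_def mat_def vec_eq_iff)

lemma det_cnj_mat: "det (cnj_mat A) = cnj (det A)"
  by (simp add: cnj_mat_def det_def)

lemma invertible_cnj_mat: "invertible (cnj_mat A) \<longleftrightarrow> invertible A"
  for A :: "complex^'n^'n"
  by (simp add: invertible_det_nz det_cnj_mat)

lemma cnj_of_rat: "cnj (of_rat q) = of_rat q"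
  by (cases q) (simp add: of_rat_rat)

lemma polyfun_rat_cnj: "polyfun \<rat> f \<Longrightarrow> f (cnj_mat A) = cnj (f A)"
proof (induction rule: polyfun.induct)
  case (const c)
  then obtain q where "c = of_rat q" by (auto elim: Rats_cases)
  then show ?case by (simp add: cnj_of_rat)
qed (simp_all add: cnj_mat_def)

text \<open>Conjugating argument and value together conjugates the coefficients. The result is again
  a complex polynomial and can be tested against tangent vectors, which conjugation alone would not
  allow.\<close>

lemma polyfun_cnj: "polyfun UNIV f \<Longrightarrow> polyfun UNIV (\<lambda>A. cnj (f (cnj_mat A)))"
  by (induction rule: polyfun.induct) (auto simp: cnj_mat_def intro: polyfun.intros)

lemma pd_cnj:
  assumes "polyfun UNIV f"
  shows "pd (\<lambda>A. cnj (f (cnj_mat A))) A X = cnj (pd f (cnj_mat A) (cnj_mat X))"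
  using assms
proof (induction rule: polyfun.induct)
  case (entry i j)
  then show ?case by (simp add: cnj_mat_def pd_entry)
qed (simp_all add: pd_const pd_add pd_mult polyfun_cnj)

lemma dir_deriv_cnj:
  assumes "polyfun UNIV f" "\<And>A. f (cnj_mat A) = cnj (f A)"
  shows "dir_deriv f (cnj_mat X) = cnj (dir_deriv f X)"
  using pd_cnj[OF assms(1), of "mat 1" "X"] by (simp add: assms(2) dir_deriv_pd)

lemma algebraic_group_rat_cnj:
  assumes "algebraic_group \<rat> G" "g \<in> G"
  shows "cnj_mat g \<in> G"
  using assms unfolding algebraic_group_def by (auto simp: invertible_cnj_mat polyfun_rat_cnj)

lemma lie_algebra_cnj:
  assumes "\<And>g. g \<in> G \<Longrightarrow> cnj_mat g \<in> G" "X \<in> lie_algebra G"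
  shows "cnj_mat X \<in> lie_algebra G"
proof -
  have "dir_deriv f (cnj_mat X) = 0" if f: "polyfun UNIV f" "\<forall>g\<in>G. f g = 0" for f
  proof -
    have "dir_deriv (\<lambda>A. cnj (f (cnj_mat A))) X = 0"
      using assms f polyfun_cnj[OF f(1)] unfolding lie_algebra_def by auto
    then show ?thesis unfolding dir_deriv_pd pd_cnj[OF f(1)] by simp
  qed
  then show ?thesis by (simp add: lie_algebra_def)
qed

section \<open>The differential of a rational representation\<close>

lemma polyfun_rat_sum:
  "finite I \<Longrightarrow> (\<And>i. i \<in> I \<Longrightarrow> polyfun \<rat> (f i)) \<Longrightarrow> polyfun \<rat> (\<lambda>A. \<Sum>i\<in>I. f i A)"
  by (induction I rule: finite_induct) (auto intro: polyfun.intros)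

lemma polyfun_rat_prod:
  "finite I \<Longrightarrow> (\<And>i. i \<in> I \<Longrightarrow> polyfun \<rat> (f i)) \<Longrightarrow> polyfun \<rat> (\<lambda>A. \<Prod>i\<in>I. f i A)"
  by (induction I rule: finite_induct) (auto intro: polyfun.intros)

lemma polyfun_rat_det: "polyfun \<rat> det"
  unfolding det_def [abs_def]
  by (intro polyfun_rat_sum polyfun.mult polyfun.const polyfun_rat_prod polyfun.entry) auto

lemma polyfun_rat_power: "polyfun \<rat> f \<Longrightarrow> polyfun \<rat> (\<lambda>A. f A ^ k)"
  by (induction k) (auto intro: polyfun.intros)

text \<open>
  On the group, \<open>P\<close> is the representation \<open>\<pi>\<close> multiplied by the \<open>N\<close>-th power of the determinant.
  It is again a representation, and its entries are polynomials.
\<close>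

locale rational_rep =
  fixes G :: "(complex^'n^'n) set" and \<pi> :: "complex^'n^'n \<Rightarrow> complex^'v^'v"
    and P :: "'v \<Rightarrow> 'v \<Rightarrow> complex^'n^'n \<Rightarrow> complex" and N :: nat
  assumes group: "matrix_group G"
    and polyfun_P_rat: "polyfun \<rat> (P i j)"
    and \<pi>_P: "g \<in> G \<Longrightarrow> \<pi> g $ i $ j = P i j g / det g ^ N"
    and \<pi>_mult: "g \<in> G \<Longrightarrow> h \<in> G \<Longrightarrow> \<pi> (g ** h) = \<pi> g ** \<pi> h"
    and \<pi>_invertible: "g \<in> G \<Longrightarrow> invertible (\<pi> g)"
    and G_cnj: "g \<in> G \<Longrightarrow> cnj_mat g \<in> G"
begin

definition dP :: "complex^'n^'n \<Rightarrow> complex^'v^'v" where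
  "dP X = (\<chi> i j. dir_deriv (P i j) X)"

lemma polyfun_P: "polyfun UNIV (P i j)"
  using polyfun_mono polyfun_P_rat by blast

lemma one: "mat 1 \<in> G" and G_mult: "g \<in> G \<Longrightarrow> h \<in> G \<Longrightarrow> g ** h \<in> G"
  and G_inv: "g \<in> G \<Longrightarrow> matrix_inv g \<in> G" and G_invertible: "g \<in> G \<Longrightarrow> invertible g"
  and G_det: "g \<in> G \<Longrightarrow> det g \<noteq> 0"
  using group by (auto simp: matrix_group_def invertible_det_nz)

lemma P_\<pi>: "g \<in> G \<Longrightarrow> P i j g = det g ^ N * \<pi> g $ i $ j"
  by (simp add: \<pi>_P G_det)

lemma \<pi>_one: "\<pi> (mat 1) = mat 1"
proof -
  have "\<pi> (mat 1) ** \<pi> (mat 1) = \<pi> (mat 1)" using \<pi>_mult[OF one one] by simp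
  then show ?thesis
    using matrix_inv_left[OF \<pi>_invertible[OF one]]
    by (metis matrix_mul_assoc matrix_mul_lid)
qed

lemma P_one: "P i j (mat 1) = (if i = j then 1 else 0)"
  using P_\<pi>[OF one, of i j] unfolding \<pi>_one by simp (simp add: mat_def)

lemma P_mult: "g \<in> G \<Longrightarrow> h \<in> G \<Longrightarrow> P i j (g ** h) = (\<Sum>k\<in>UNIV. P i k g * P k j h)"
  by (simp add: P_\<pi> G_mult \<pi>_mult det_mul power_mult_distrib)
    (simp add: matrix_matrix_mult_def sum_distrib_left mult_ac)

lemma polyfun_mult_sum: "polyfun UNIV (\<lambda>h. \<Sum>k\<in>UNIV. c k * P k j h)"
  by (rule polyfun_sum) (auto intro!: polyfun.mult polyfun.const polyfun_P)

lemma polyfun_sum_mult: "polyfun UNIV (\<lambda>h. \<Sum>k\<in>UNIV. P i k h * c k)"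
  by (rule polyfun_sum) (auto intro!: polyfun.mult polyfun.const polyfun_P)

text \<open>This is P(g h) = P(g) P(h) differentiated in \<open>h\<close> at the identity. The
  equation holds on the group only, so the difference of both sides is used as a polynomial
  vanishing there.\<close>

lemma lder_P:
  assumes X: "X \<in> lie_algebra G" and g: "g \<in> G"
  shows "lder X (P i j) g = (\<Sum>k\<in>UNIV. P i k g * dP X $ k $ j)"
proof -
  define f where "f = (\<lambda>h. P i j (g ** h ** mat 1) - (\<Sum>k\<in>UNIV. P i k g * P k j h))"
  have poly: "polyfun UNIV (\<lambda>h. P i j (g ** h ** mat 1))"
    "polyfun UNIV (\<lambda>h. \<Sum>k\<in>UNIV. P i k g * P k j h)"
    by (rule polyfun_comp_mult[OF polyfun_P]) (rule polyfun_mult_sum)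
  have "\<forall>h\<in>G. f h = 0" using P_mult[OF g] by (simp add: f_def)
  moreover have "polyfun UNIV f" unfolding f_def by (intro polyfun_diff poly)
  ultimately have "dir_deriv f X = 0" using X unfolding lie_algebra_def by blast
  moreover have "dir_deriv f X = lder X (P i j) g - (\<Sum>k\<in>UNIV. P i k g * dP X $ k $ j)"
    unfolding f_def dir_deriv_pd pd_diff[OF poly] pd_comp_mult
    by (simp add: pd_sum pd_cmult polyfun_P polyfun.mult polyfun.const lder_def dP_def dir_deriv_pd)
  ultimately show ?thesis by simp
qed

text \<open>A second differentiation, now in \<open>g\<close>. The inner direction ends up on the
  right, as the order in \<open>dir_deriv_bracket\<close> requires.\<close>

lemma lder_lder_P:
  assumes X: "X \<in> lie_algebra G" and Y: "Y \<in> lie_algebra G"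
  shows "dir_deriv (lder X (P i j)) Y = (dP Y ** dP X) $ i $ j"
proof -
  define f where "f = (\<lambda>g. lder X (P i j) g - (\<Sum>k\<in>UNIV. P i k g * dP X $ k $ j))"
  have poly: "polyfun UNIV (lder X (P i j))" "polyfun UNIV (\<lambda>g. \<Sum>k\<in>UNIV. P i k g * dP X $ k $ j)"
    by (rule polyfun_lder[OF polyfun_P]) (rule polyfun_sum_mult)
  have "\<forall>g\<in>G. f g = 0" using lder_P[OF X] by (simp add: f_def)
  moreover have "polyfun UNIV f" unfolding f_def by (intro polyfun_diff poly)
  ultimately have "dir_deriv f Y = 0" using Y unfolding lie_algebra_def by blast
  moreover have "dir_deriv f Y = dir_deriv (lder X (P i j)) Y - (\<Sum>k\<in>UNIV. dP Y $ i $ k * dP X $ k $ j)"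
    unfolding f_def dir_deriv_pd pd_diff[OF poly]
    by (simp add: pd_sum pd_multc polyfun_P polyfun.mult polyfun.const dP_def dir_deriv_pd)
  ultimately show ?thesis by (simp add: matrix_matrix_mult_def)
qed

lemma dP_bracket:
  assumes "X \<in> lie_algebra G" "Y \<in> lie_algebra G"
  shows "dP (bracket X Y) = bracket (dP X) (dP Y)"
proof -
  have "dP (bracket X Y) $ i $ j = bracket (dP X) (dP Y) $ i $ j" for i j
    using lder_lder_P[OF assms, of i j] lder_lder_P[OF assms(2,1), of i j]
    by (simp add: dP_def dir_deriv_bracket[OF polyfun_P]) (simp add: bracket_def dP_def)
  then show ?thesis by (simp add: vec_eq_iff)
qed

text \<open>The quotient rule for P / det^N at the identity, where numerator and denominator are
  both trivial.\<close>

definition d\<pi> :: "complex^'n^'n \<Rightarrow> complex^'v^'v" where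
  "d\<pi> X = dP X - cscale (of_nat N * dir_deriv det X) (mat 1)"

lemma d\<pi>_entry: "d\<pi> X $ i $ j = dP X $ i $ j - (if i = j then of_nat N * dir_deriv det X else 0)"
  by (simp add: d\<pi>_def cscale_def mat_def)

lemma differential_eq_d\<pi>:
  assumes X: "X \<in> lie_algebra G"
  shows "differential G \<pi> X = d\<pi> X"
proof -
  define F where "F = (\<lambda>g. (\<chi> i j. P i j g / det g ^ N) :: complex^'v^'v)"
  have reg: "gl_regular UNIV F"
    unfolding gl_regular_def F_def
  proof (intro allI)
    fix i j
    show "\<exists>p k. polyfun UNIV p \<and> (\<forall>g. invertible g \<longrightarrow>
        ((\<chi> i j. P i j g / det g ^ N) :: complex^'v^'v) $ i $ j = p g / det g ^ k)"
      by (intro exI[of _ "P i j"] exI[of _ N]) (simp add: polyfun_P)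
  qed
  have F: "\<forall>g\<in>G. F g = \<pi> g" by (simp add: F_def vec_eq_iff \<pi>_P)
  have "dir_deriv (\<lambda>g. F g $ i $ j) X = d\<pi> X $ i $ j" for i j
  proof -
    have D: "((\<lambda>z. det (mat 1 + cscale z X) ^ N) has_field_derivative of_nat N * dir_deriv det X) (at 0)"
      using pd_DERIV[OF polyfun_power[OF polyfun_det, of N], of "mat 1" X]
        dir_deriv_det_power[of N X] by (simp add: dir_deriv_pd)
    have "((\<lambda>z. P i j (mat 1 + cscale z X) / det (mat 1 + cscale z X) ^ N) has_field_derivative
        d\<pi> X $ i $ j) (at 0)"
      using DERIV_divide[OF pd_DERIV[OF polyfun_P, of i j "mat 1" X] D]
      by (auto simp: P_one d\<pi>_entry dP_def dir_deriv_pd)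
    then show ?thesis unfolding dir_deriv_def F_def by (simp add: DERIV_imp_deriv)
  qed
  moreover have "\<forall>g\<in>G. invertible g" using G_invertible by blast
  ultimately show ?thesis
    using differential_eq[OF one X reg F] by (simp add: vec_eq_iff)
qed

lemma d\<pi>_add: "d\<pi> (X + Y) = d\<pi> X + d\<pi> Y"
  by (simp add: vec_eq_iff d\<pi>_entry dP_def dir_deriv_pd pd_vec_add polyfun_P polyfun_det algebra_simps)

lemma d\<pi>_scale: "d\<pi> (cscale c X) = cscale c (d\<pi> X)"
proof -
  have "d\<pi> (cscale c X) $ i $ j = c * d\<pi> X $ i $ j" for i j
    by (simp add: d\<pi>_entry dP_def dir_deriv_pd pd_vec_scale polyfun_P polyfun_det algebra_simps)
  then show ?thesis by (simp add: vec_eq_iff) (simp add: cscale_def)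
qed

lemma d\<pi>_bracket:
  assumes "X \<in> lie_algebra G" "Y \<in> lie_algebra G"
  shows "d\<pi> (bracket X Y) = bracket (d\<pi> X) (d\<pi> Y)"
proof -
  have "d\<pi> (bracket X Y) = bracket (dP X) (dP Y)"
    by (simp add: d\<pi>_def dP_bracket[OF assms] dir_deriv_det_bracket)
  also have "\<dots> = bracket (d\<pi> X) (d\<pi> Y)"
    by (simp add: bracket_def d\<pi>_def matrix_diff_mult matrix_mult_diff cscale_mult_left
        cscale_mult_right algebra_simps)
  finally show ?thesis .
qed

text \<open>Differentiates the image under \<open>P\<close> of h s = s (s^{-1} h s) in
  \<open>h\<close>. The determinant is invariant under conjugation, so the correction terms
  agree.\<close>

lemma d\<pi>_conjugate:
  assumes s: "s \<in> G" and X: "X \<in> lie_algebra G"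
  shows "d\<pi> X ** \<pi> s = \<pi> s ** d\<pi> (matrix_inv s ** X ** s)"
proof -
  define Z where "Z = matrix_inv s ** X ** s"
  have sinv: "s ** matrix_inv s = mat 1" "matrix_inv s ** s = mat 1" "matrix_inv s \<in> G"
    using s G_inv G_invertible matrix_inv_left matrix_inv_right by auto
  have eq: "(\<Sum>k\<in>UNIV. dP X $ i $ k * P k j s) = (\<Sum>k\<in>UNIV. P i k s * dP Z $ k $ j)" for i j
  proof -
    define f where "f = (\<lambda>h. (\<Sum>k\<in>UNIV. P i k h * P k j s) - (\<Sum>k\<in>UNIV. P i k s * P k j (matrix_inv s ** h ** s)))"
    have polyc: "polyfun UNIV (\<lambda>h. P k j (matrix_inv s ** h ** s))" for k
      by (rule polyfun_comp_mult[OF polyfun_P])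
    have poly: "polyfun UNIV (\<lambda>h. \<Sum>k\<in>UNIV. P i k h * P k j s)"
      "polyfun UNIV (\<lambda>h. \<Sum>k\<in>UNIV. P i k s * P k j (matrix_inv s ** h ** s))"
      by (rule polyfun_sum_mult, rule polyfun_sum) (auto intro!: polyfun.mult polyfun.const polyc)
    have "f h = 0" if h: "h \<in> G" for h
    proof -
      have "s ** (matrix_inv s ** h ** s) = h ** s"
        by (simp add: matrix_mul_assoc sinv)
      then show ?thesis
        using P_mult[OF h s, of i j] P_mult[OF s G_mult[OF G_mult[OF sinv(3) h] s], of i j]
        by (simp add: f_def)
    qed
    moreover have "polyfun UNIV f" unfolding f_def by (intro polyfun_diff poly)
    ultimately have "dir_deriv f X = 0" using X unfolding lie_algebra_def by blast
    moreover have "dir_deriv f X = (\<Sum>k\<in>UNIV. dP X $ i $ k * P k j s) - (\<Sum>k\<in>UNIV. P i k s * dP Z $ k $ j)"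
    proof -
      have "pd (\<lambda>h. \<Sum>k\<in>UNIV. P i k h * P k j s) (mat 1) X = (\<Sum>k\<in>UNIV. dP X $ i $ k * P k j s)"
        by (simp add: pd_sum pd_multc polyfun_P polyfun.mult polyfun.const dP_def dir_deriv_pd)
      moreover have "pd (\<lambda>h. P k j (matrix_inv s ** h ** s)) (mat 1) X = dP Z $ k $ j" for k
        unfolding pd_comp_mult by (simp add: sinv Z_def dP_def dir_deriv_pd)
      then have "pd (\<lambda>h. \<Sum>k\<in>UNIV. P i k s * P k j (matrix_inv s ** h ** s)) (mat 1) X =
          (\<Sum>k\<in>UNIV. P i k s * dP Z $ k $ j)"
        by (simp add: pd_sum pd_cmult polyc polyfun.mult polyfun.const)
      ultimately show ?thesis unfolding f_def dir_deriv_pd pd_diff[OF poly] by simp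
    qed
    ultimately show ?thesis by simp
  qed
  have "det s ^ N * (dP X ** \<pi> s) $ i $ j = det s ^ N * (\<pi> s ** dP Z) $ i $ j" for i j
    using eq[of i j] by (simp add: P_\<pi>[OF s] matrix_matrix_mult_def sum_distrib_left mult_ac)
  then have 1: "dP X ** \<pi> s = \<pi> s ** dP Z" using G_det[OF s] by (simp add: vec_eq_iff)
  have "dir_deriv det Z = dir_deriv det X"
  proof -
    have "det (matrix_inv s ** h ** s) = det h" for h
    proof -
      have "det (matrix_inv s) * det s = 1" using sinv(2) det_mul[of "matrix_inv s" s] by simp
      then show ?thesis by (simp add: det_mul mult.commute)
    qed
    then have "pd det (mat 1) X = pd (\<lambda>h. det (matrix_inv s ** h ** s)) (mat 1) X" by simp
    then show ?thesis unfolding pd_comp_mult by (simp add: sinv Z_def dir_deriv_pd)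
  qed
  then show ?thesis
    unfolding Z_def[symmetric] d\<pi>_def
    by (simp add: matrix_diff_mult matrix_mult_diff cscale_mult_left cscale_mult_right 1)
qed

lemma d\<pi>_cnj: "d\<pi> (cnj_mat X) = cnj_mat (d\<pi> X)"
proof -
  have "d\<pi> (cnj_mat X) $ i $ j = cnj (d\<pi> X $ i $ j)" for i j
    using dir_deriv_cnj[OF polyfun_P polyfun_rat_cnj[OF polyfun_P_rat], of i j X]
      dir_deriv_cnj[OF polyfun_det det_cnj_mat, of X]
    by (simp add: d\<pi>_entry dP_def)
  then show ?thesis by (simp add: vec_eq_iff) (simp add: cnj_mat_def)
qed

text \<open>Clearing denominators in both slots turns invariance into the polynomial identity q = r
  on the group, with the factor det^(2N). Its derivative contributes N times the derivative of the
  determinant per slot, exactly what \<open>d\<pi>\<close> subtracts.\<close>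

lemma d\<pi>_form:
  assumes form: "\<And>g u v. g \<in> G \<Longrightarrow> bilinear_form C (\<pi> g *v u) (\<pi> g *v v) = bilinear_form C u v"
    and X: "X \<in> lie_algebra G"
  shows "bilinear_form C (d\<pi> X *v u) v + bilinear_form C u (d\<pi> X *v v) = 0"
proof -
  have bil: "bilinear_form C (a *s x) y = a * bilinear_form C x y" "bilinear_form C x (a *s y) = a * bilinear_form C x y"
    "bilinear_form C (x - z) y = bilinear_form C x y - bilinear_form C z y"
    "bilinear_form C x (y - z) = bilinear_form C x y - bilinear_form C x z" for a x y z
    by (simp_all add: bilinear_form_def sum_distrib_left mult_ac algebra_simps sum_subtractf)
  define Pv where "Pv = (\<lambda>g (u :: complex^'v) i. \<Sum>a\<in>UNIV. P i a g * u $ a)"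
  have polyv: "polyfun UNIV (\<lambda>g. Pv g u i)" for u i
    unfolding Pv_def by (rule polyfun_sum_mult)
  have pdv: "pd (\<lambda>g. Pv g u i) (mat 1) X = (dP X *v u) $ i" for u i
    unfolding Pv_def by (simp add: pd_sum pd_multc polyfun_P polyfun.mult polyfun.const dP_def
        dir_deriv_pd matrix_vector_mult_def)
  have Pv1: "Pv (mat 1) u i = u $ i" for u i
    by (simp add: Pv_def P_one if_distrib[of "\<lambda>c. c * _"] cong: if_cong)
  have PvG: "Pv g u i = det g ^ N * (\<pi> g *v u) $ i" if "g \<in> G" for g u i
    by (simp add: Pv_def P_\<pi>[OF that] matrix_vector_mult_def sum_distrib_left mult_ac)
  define q where "q = (\<lambda>g. \<Sum>i\<in>UNIV. \<Sum>j\<in>UNIV. Pv g u i * C $ i $ j * Pv g v j)"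
  define r where "r = (\<lambda>g::complex^'n^'n. det g ^ (2 * N) * bilinear_form C u v)"
  have qr: "polyfun UNIV q" "polyfun UNIV r"
    unfolding q_def r_def
    by (intro polyfun_sum polyfun.mult polyv) (auto intro!: polyfun.const polyfun.mult polyfun_power polyfun_det)
  have "q g - r g = 0" if g: "g \<in> G" for g
  proof -
    have "q g = bilinear_form C (det g ^ N *s (\<pi> g *v u)) (det g ^ N *s (\<pi> g *v v))"
      by (simp add: q_def PvG[OF g] bilinear_form_def)
    also have "\<dots> = r g" by (simp add: bil form[OF g] r_def power_add mult_2)
    finally show ?thesis by simp
  qed
  moreover have "polyfun UNIV (\<lambda>g. q g - r g)" using qr by (rule polyfun_diff)
  ultimately have "dir_deriv (\<lambda>g. q g - r g) X = 0" using X unfolding lie_algebra_def by blast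
  then have "pd q (mat 1) X = pd r (mat 1) X" unfolding dir_deriv_pd pd_diff[OF qr] by simp
  moreover have "pd q (mat 1) X = bilinear_form C (dP X *v u) v + bilinear_form C u (dP X *v v)"
  proof -
    have p1: "polyfun UNIV (\<lambda>g. Pv g u i * C $ i $ j)" for i j
      by (intro polyfun.mult polyv polyfun.const) auto
    have "pd (\<lambda>g. Pv g u i * C $ i $ j * Pv g v j) (mat 1) X =
        (dP X *v u) $ i * C $ i $ j * v $ j + u $ i * C $ i $ j * (dP X *v v) $ j" for i j
      by (simp add: pd_mult[OF p1 polyv] pd_multc[OF polyv] pdv Pv1)
    then show ?thesis
      unfolding q_def bilinear_form_def sum.distrib[symmetric]
      by (simp add: pd_sum p1 polyv polyfun_sum polyfun.mult)
  qed
  moreover have "pd r (mat 1) X = 2 * (of_nat N * dir_deriv det X) * bilinear_form C u v"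
    using dir_deriv_det_power[of "2 * N" X]
    by (simp add: r_def pd_multc polyfun_power polyfun_det dir_deriv_pd)
  ultimately show ?thesis
    by (simp add: d\<pi>_def matrix_vector_mult_diff_rdistrib cscale_vector bil algebra_simps)
qed

end

section \<open>The Hodge decomposition\<close>

text \<open>On the circle 2 z Re z = z^2 + 1 and 2 z Im z = \<i> - \<i> z^2, so real polynomials
  restrict to Laurent polynomials in \<open>z\<close>; the power of \<open>z\<close> clears the
  denominator.\<close>

lemma real_polynomial_circle:
  fixes p :: "complex \<Rightarrow> real"
  assumes "real_polynomial_function p"
  shows "\<exists>K q. \<forall>z\<in>sphere 0 1. of_real (p z) * z ^ K = poly q z"
  using assms
proof (induction rule: real_polynomial_function.induct)
  case (linear f)
  define a b where "a = complex_of_real (f 1)" and "b = complex_of_real (f \<i>)"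
  define q where "q = smult (1 / 2) [: a + \<i> * b, 0, a - \<i> * b :]"
  have "of_real (f z) * z ^ 1 = poly q z" if "z \<in> sphere 0 1" for z
  proof -
    have "Re z *\<^sub>R 1 + Im z *\<^sub>R \<i> = z" by (simp add: complex_eq_iff)
    then have "f z = f (Re z *\<^sub>R 1 + Im z *\<^sub>R \<i>)" by simp
    also have "\<dots> = Re z * f 1 + Im z * f \<i>"
      using linear by (simp add: bounded_linear.linear linear_add linear_scale)
    finally have f: "of_real (f z) = of_real (Re z) * a + of_real (Im z) * b"
      by (simp add: a_def b_def)
    have zz: "z * cnj z = 1" using that by (simp add: complex_norm_square[symmetric])
    have re: "2 * (of_real (Re z) * z) = z * z + 1" and im: "2 * (of_real (Im z) * z) = \<i> - \<i> * (z * z)"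
      using zz by (simp_all add: complex_eq_iff algebra_simps)
    have "2 * (of_real (f z) * z) = a * (2 * (of_real (Re z) * z)) + b * (2 * (of_real (Im z) * z))"
      unfolding f by (simp only: ring_distribs mult_ac)
    also have "\<dots> = poly [: a + \<i> * b, 0, a - \<i> * b :] z"
      unfolding re im by (simp add: ring_distribs mult_ac)
    also have "\<dots> = 2 * poly q z" unfolding q_def poly_smult by simp
    finally show ?thesis by simp
  qed
  then show ?case by blast
next
  case (const c)
  have "of_real c * z ^ 0 = poly [: of_real c :] z" for z :: complex by simp
  then show ?case by blast
next
  case (add f g)
  then obtain K q L r where *: "\<forall>z\<in>sphere 0 1. of_real (f z) * z ^ K = poly q z"
    "\<forall>z\<in>sphere 0 1. of_real (g z) * z ^ L = poly r z" by blast
  have "of_real (f z + g z) * z ^ (K + L) = poly (q * monom 1 L + r * monom 1 K) z"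
    if "z \<in> sphere 0 1" for z
    using *[THEN bspec, OF that] by (simp add: poly_monom power_add algebra_simps)
  then show ?case by blast
next
  case (mult f g)
  then obtain K q L r where *: "\<forall>z\<in>sphere 0 1. of_real (f z) * z ^ K = poly q z"
    "\<forall>z\<in>sphere 0 1. of_real (g z) * z ^ L = poly r z" by blast
  have "of_real (f z * g z) * z ^ (K + L) = poly (q * r) z"
    if "z \<in> sphere 0 1" for z
    using *[THEN bspec, OF that] by (simp add: power_add algebra_simps)
  then show ?case by blast
qed

lemma infinite_circle: "infinite (sphere 0 1 :: complex set)"
proof
  assume "finite (sphere 0 1 :: complex set)"
  moreover have "connected (sphere 0 1 :: complex set)" by (rule connected_sphere) simp
  ultimately have "sphere 0 1 = ({} :: complex set) \<or> (\<exists>a::complex. sphere 0 1 = {a})"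
    using connected_finite_iff_sing[of "sphere 0 1 :: complex set"] by blast
  moreover have mem: "(1::complex) \<in> sphere 0 1" "(- 1 :: complex) \<in> sphere 0 1" by simp_all
  ultimately obtain a :: complex where a: "sphere 0 1 = {a}" by blast
  have "(1::complex) = - 1" using mem unfolding a singleton_iff by (rule trans[OF _ sym])
  then show False by (simp add: complex_eq_iff)
qed

text \<open>Expand \<psi>(z) as a Laurent polynomial with matrix coefficients \<open>B k\<close>.
  The homomorphism property places the range of each \<open>B k\<close> in one character space, and
  evaluation at 1 writes \<open>v\<close> as the sum of the \<open>B k *v v\<close>.\<close>

lemma circle_decomposition:
  fixes \<psi> :: "complex \<Rightarrow> complex^'v^'v"
  assumes \<psi>: "circle_hom H \<psi>" and one: "\<psi> 1 = mat 1"
  shows "v \<in> vec.span (\<Union>k::int. {x. \<forall>z\<in>sphere 0 1. \<psi> z *v x = z powi k *s x})"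
proof -
  have "\<forall>i j. \<exists>K q. \<forall>z\<in>sphere 0 1. \<psi> z $ i $ j * z ^ K = poly q z"
  proof (intro allI)
    fix i j
    obtain p where p: "real_polynomial_function p" "\<forall>z\<in>sphere 0 1. \<psi> z $ i $ j = of_real (p z)"
      using \<psi> unfolding circle_hom_def by blast
    then show "\<exists>K q. \<forall>z\<in>sphere 0 1. \<psi> z $ i $ j * z ^ K = poly q z"
      using real_polynomial_circle[OF p(1)] by auto
  qed
  then obtain K q where Kq: "\<And>i j z. z \<in> sphere 0 1 \<Longrightarrow> \<psi> z $ i $ j * z ^ K i j = poly (q i j) z"
    by metis
  define M where "M = Max (range (\<lambda>(i, j). K i j))"
  have KM: "K i j \<le> M" for i j unfolding M_def by (rule Max_ge) (auto intro: image_eqI[of _ _ "(i, j)"])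
  define r where "r = (\<lambda>i j. q i j * monom 1 (M - K i j))"
  have r: "\<psi> z $ i $ j * z ^ M = poly (r i j) z" if "z \<in> sphere 0 1" for z i j
  proof -
    have "z ^ M = z ^ K i j * z ^ (M - K i j)" using KM[of i j] by (simp flip: power_add)
    then show ?thesis using Kq[OF that, of i j] by (simp add: r_def poly_monom flip: mult.assoc)
  qed
  define B where "B = (\<lambda>k. (\<chi> i j. coeff (r i j) k) :: complex^'v^'v)"
  \<comment> \<open>For fixed \<open>u\<close> the two expansions of \<psi>(u z) are polynomials in
    \<open>z\<close> that agree on the infinite circle, so their coefficients agree.\<close>
  have B: "\<psi> u ** B k = cscale (u powi (int k - int M)) (B k)" if u: "u \<in> sphere 0 1" for u k
  proof -
    have unz: "u \<noteq> 0" using u by auto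
    have "u ^ M * (\<Sum>l\<in>UNIV. \<psi> u $ i $ l * coeff (r l j) k) = u ^ k * coeff (r i j) k" for i j
    proof -
      define a where "a = smult (u ^ M) (\<Sum>l\<in>UNIV. smult (\<psi> u $ i $ l) (r l j))"
      define b where "b = pcompose (r i j) [:0, u:]"
      have "poly (a - b) z = 0" if z: "z \<in> sphere 0 1" for z
      proof -
        have uz: "u * z \<in> sphere 0 1" using u z by (simp add: norm_mult)
        have "poly a z = u ^ M * (\<Sum>l\<in>UNIV. \<psi> u $ i $ l * (\<psi> z $ l $ j * z ^ M))"
          by (simp add: a_def poly_sum r[OF z])
        also have "\<dots> = (\<psi> u ** \<psi> z) $ i $ j * (u * z) ^ M"
          by (simp add: matrix_matrix_mult_def sum_distrib_left sum_distrib_right power_mult_distrib mult_ac)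
        also have "\<dots> = poly b z"
          using \<psi> u z r[OF uz, of i j] unfolding circle_hom_def b_def
          by (simp add: poly_pcompose mult.commute)
        finally show ?thesis by simp
      qed
      then have "sphere 0 1 \<subseteq> {z. poly (a - b) z = 0}" by blast
      then have "a - b = 0" using infinite_circle poly_roots_finite finite_subset by metis
      then have "coeff a k = coeff b k" by simp
      then show ?thesis by (simp add: a_def b_def coeff_sum coeff_pcompose_linear)
    qed
    then have "(\<Sum>l\<in>UNIV. \<psi> u $ i $ l * coeff (r l j) k) = u powi (int k - int M) * coeff (r i j) k" for i j
      using unz by (simp add: power_int_diff field_simps)
    then show ?thesis by (simp add: B_def vec_eq_iff matrix_matrix_mult_def cscale_def)
  qed
  define D where "D = Max (range (\<lambda>(i, j). degree (r i j)))"
  have deg: "degree (r i j) \<le> D" for i j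
    unfolding D_def by (rule Max_ge) (auto intro: image_eqI[of _ _ "(i, j)"])
  have "v = (\<Sum>k\<le>D. B k *v v)"
  proof -
    have "(mat 1 :: complex^'v^'v) $ i $ j = (\<Sum>k\<le>D. B k $ i $ j)" for i j
    proof -
      have "poly (r i j) 1 = (\<Sum>k\<le>D. coeff (r i j) k)"
        unfolding poly_altdef using deg[of i j] by (auto intro!: sum.mono_neutral_left coeff_eq_0)
      then show ?thesis using r[of 1 i j] one by (simp add: B_def)
    qed
    then have "mat 1 = (\<Sum>k\<le>D. B k)" by (simp add: vec_eq_iff)
    then have "mat 1 *v v = (\<Sum>k\<le>D. B k) *v v" by simp
    also have "\<dots> = (\<Sum>k\<le>D. B k *v v)"
      by (induction D) (simp_all add: matrix_vector_mult_add_rdistrib)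
    finally show ?thesis by simp
  qed
  also have "\<dots> \<in> vec.span (\<Union>k::int. {x. \<forall>z\<in>sphere 0 1. \<psi> z *v x = z powi k *s x})"
  proof (intro vec.span_sum vec.span_base UN_I[of "int _ - int M"] CollectI ballI UNIV_I)
    fix k and z :: complex assume "z \<in> sphere 0 1"
    then show "\<psi> z *v (B k *v v) = z powi (int k - int M) *s (B k *v v)"
      using B[of z k] by (simp add: matrix_vector_mul_assoc cscale_vector)
  qed
  finally show ?thesis .
qed

text \<open>The value at -1 forces every occurring character to have the parity of \<open>w\<close>,
  so its exponent can be written as p - (w - p).\<close>

lemma hodge_decomposition:
  assumes "polarized_hodge_structure Q w \<psi>" "\<psi> 1 = mat 1"
  shows "v \<in> vec.span (\<Union>p. hodge_space \<psi> p (w - p))"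
proof -
  have "{x. \<forall>z\<in>sphere 0 1. \<psi> z *v x = z powi k *s x} \<subseteq> vec.span (\<Union>p. hodge_space \<psi> p (w - p))" for k
  proof
    fix x assume "x \<in> {x. \<forall>z\<in>sphere 0 1. \<psi> z *v x = z powi k *s x}"
    then have x: "\<psi> z *v x = z powi k *s x" if "z \<in> sphere 0 1" for z using that by blast
    show "x \<in> vec.span (\<Union>p. hodge_space \<psi> p (w - p))"
    proof (cases "x = 0")
      case False
      have "\<psi> (- 1) *v x = (- 1) powi w *s x"
        using assms by (simp add: polarized_hodge_structure_def cscale_vector)
      then have "((- 1) powi k :: complex) = (- 1) powi w" using x[of "- 1"] False by simp
      then have "even k \<longleftrightarrow> even w" by (auto simp: power_int_minus_left split: if_splits)
      then have "even (w + k)" by simp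
      then obtain p where p: "w + k = 2 * p" by blast
      then have "p - (w - p) = k" by simp
      then have "x \<in> hodge_space \<psi> p (w - p)" using x by (simp add: hodge_space_def)
      then show ?thesis by (intro vec.span_base) blast
    qed (simp add: vec.span_zero)
  qed
  then have "(\<Union>k::int. {x. \<forall>z\<in>sphere 0 1. \<psi> z *v x = z powi k *s x}) \<subseteq>
      vec.span (\<Union>p. hodge_space \<psi> p (w - p))" by blast
  then have "vec.span (\<Union>k::int. {x. \<forall>z\<in>sphere 0 1. \<psi> z *v x = z powi k *s x}) \<subseteq>
      vec.span (\<Union>p. hodge_space \<psi> p (w - p))" by (rule vec.span_minimal) simp
  moreover have "circle_hom (aut_form Q) \<psi>" using assms by (simp add: polarized_hodge_structure_def)
  ultimately show ?thesis using circle_decomposition assms(2) by blast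
qed

section \<open>From the group to its Lie algebra\<close>

lemma rational_rep_exists:
  assumes G: "algebraic_group \<rat> G" and \<pi>: "algebraic_hom \<rat> G H \<pi>" and H: "\<And>A. A \<in> H \<Longrightarrow> invertible A"
  obtains P N where "rational_rep G \<pi> P N"
proof -
  obtain F where F: "gl_regular \<rat> F" "\<forall>g\<in>G. F g = \<pi> g" using \<pi> unfolding algebraic_hom_def by blast
  obtain p k where p: "\<And>i j. polyfun \<rat> (p i j)"
    "\<And>i j g. invertible g \<Longrightarrow> F g $ i $ j = p i j g / det g ^ k i j"
    using F(1) unfolding gl_regular_def by metis
  have inv: "invertible g" if "g \<in> G" for g
    using G that unfolding algebraic_group_def matrix_group_def by blast
  define N where "N = Max (range (\<lambda>(i, j). k i j))"
  have kN: "k i j \<le> N" for i j unfolding N_def by (rule Max_ge) (auto intro: image_eqI[of _ _ "(i, j)"])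
  define P where "P = (\<lambda>i j g. p i j g * det g ^ (N - k i j))"
  have "rational_rep G \<pi> P N"
  proof
    show "matrix_group G" using G by (simp add: algebraic_group_def)
    show "polyfun \<rat> (P i j)" for i j
      unfolding P_def by (intro polyfun.mult p polyfun_rat_power polyfun_rat_det)
    show "\<pi> g $ i $ j = P i j g / det g ^ N" if "g \<in> G" for g i j
    proof -
      have "det g ^ N = det g ^ k i j * det g ^ (N - k i j)" using kN[of i j] by (simp flip: power_add)
      moreover have "det g \<noteq> 0" using inv[OF that] by (simp add: invertible_det_nz)
      moreover have "\<pi> g $ i $ j = p i j g / det g ^ k i j" using p(2) inv F(2) that by metis
      ultimately show ?thesis by (simp add: P_def)
    qed
    show "\<pi> (g ** h) = \<pi> g ** \<pi> h" if "g \<in> G" "h \<in> G" for g h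
      using \<pi> that unfolding algebraic_hom_def by blast
    show "invertible (\<pi> g)" if "g \<in> G" for g
      using \<pi> that H unfolding algebraic_hom_def by blast
    show "cnj_mat g \<in> G" if "g \<in> G" for g using algebraic_group_rat_cnj[OF G that] .
  qed
  with that show ?thesis by blast
qed

lemma matrix_vector_span_eq:
  fixes A B :: "complex^'v^'w"
  assumes "\<And>x. x \<in> vec.span S" "\<And>x. x \<in> S \<Longrightarrow> A *v x = B *v x"
  shows "A = B"
proof -
  have "A *v x = B *v x" for x
    using assms(1)[of x]
  proof (induction rule: vec.span_induct_alt)
    case (step c x y)
    then show ?case using assms(2) by (simp add: matrix_vector_right_distrib vec.scale)
  qed simp
  then show ?thesis by (simp add: matrix_eq)
qed

text \<open>Commuting with \<open>T\<close> is a system of linear equations in the entries, hence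
  inherited by the tangent space.\<close>

lemma commutes_lie_algebra:
  assumes "\<And>s. s \<in> S \<Longrightarrow> s ** T = T ** s" "Y \<in> lie_algebra S"
  shows "bracket T Y = 0"
proof -
  have "(T ** Y) $ i $ j = (Y ** T) $ i $ j" for i j
  proof -
    define f where "f = (\<lambda>A. (T ** A ** mat 1) $ i $ j - (mat 1 ** A ** T) $ i $ j)"
    have poly: "polyfun UNIV (\<lambda>A. (T ** A ** mat 1) $ i $ j)" "polyfun UNIV (\<lambda>A. (mat 1 ** A ** T) $ i $ j)"
      by (rule polyfun_entries)+
    have "polyfun UNIV f" unfolding f_def using poly by (rule polyfun_diff)
    moreover have "\<forall>s\<in>S. f s = 0" using assms(1) by (simp add: f_def)
    ultimately have "dir_deriv f Y = 0" using assms(2) unfolding lie_algebra_def by blast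
    moreover have "pd (\<lambda>A. (T ** A ** mat 1) $ i $ j) (mat 1) Y = (T ** Y) $ i $ j"
      using pd_comp_mult[of "\<lambda>A. A $ i $ j" T "mat 1" "mat 1" Y] by (simp add: pd_entry)
    moreover have "pd (\<lambda>A. (mat 1 ** A ** T) $ i $ j) (mat 1) Y = (Y ** T) $ i $ j"
      using pd_comp_mult[of "\<lambda>A. A $ i $ j" "mat 1" T "mat 1" Y] by (simp add: pd_entry)
    ultimately show ?thesis unfolding f_def dir_deriv_pd pd_diff[OF poly] by simp
  qed
  then show ?thesis by (simp add: bracket_def vec_eq_iff)
qed

context rational_rep
begin

text \<open>The torus is commutative and contains the circle, so it preserves the Hodge spaces, on
  which \<open>T\<close> acts by scalars. Injectivity of the differential turns this into invariance
  of \<open>T\<close> under conjugation by the torus. So \<open>T\<close> centralizes the Cartan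
  subalgebra and belongs to it by self-normalization.\<close>

lemma grading_element_in_cartan:
  assumes inj: "inj_on d\<pi> (lie_algebra G)" and T: "T \<in> lie_algebra G"
    and span: "\<And>v. v \<in> vec.span (\<Union>p. hodge_space (\<pi> \<circ> \<phi>) p (w - p))"
    and eig: "\<And>p v. v \<in> hodge_space (\<pi> \<circ> \<phi>) p (w - p) \<Longrightarrow> d\<pi> T *v v = c p *s v"
    and S: "S \<subseteq> G" "\<And>g h. g \<in> S \<Longrightarrow> h \<in> S \<Longrightarrow> g ** h = h ** g" "\<phi> ` sphere 0 1 \<subseteq> S"
    and cartan: "cartan_subalgebra (lie_algebra G) (lie_algebra S)"
  shows "T \<in> lie_algebra S"
proof -
  have "s ** T = T ** s" if s: "s \<in> S" for s
  proof -
    have sG: "s \<in> G" using s S by blast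
    have "d\<pi> T ** \<pi> s = \<pi> s ** d\<pi> T"
    proof (rule matrix_vector_span_eq[OF span])
      fix x assume "x \<in> (\<Union>p. hodge_space (\<pi> \<circ> \<phi>) p (w - p))"
      then obtain p where x: "x \<in> hodge_space (\<pi> \<circ> \<phi>) p (w - p)" by blast
      have "\<pi> s *v x \<in> hodge_space (\<pi> \<circ> \<phi>) p (w - p)"
        unfolding hodge_space_def
      proof (intro CollectI ballI)
        fix z :: complex assume z: "z \<in> sphere 0 1"
        then have zS: "\<phi> z \<in> S" using S by blast
        have "\<pi> (\<phi> z) ** \<pi> s = \<pi> s ** \<pi> (\<phi> z)"
          using S s zS \<pi>_mult by (metis subsetD)
        then have "\<pi> (\<phi> z) *v (\<pi> s *v x) = \<pi> s *v (\<pi> (\<phi> z) *v x)"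
          by (simp add: matrix_vector_mul_assoc)
        also have "\<pi> (\<phi> z) *v x = z powi (p - (w - p)) *s x"
          using x z by (simp add: hodge_space_def)
        finally show "(\<pi> \<circ> \<phi>) z *v (\<pi> s *v x) = z powi (p - (w - p)) *s (\<pi> s *v x)"
          by (simp add: vec.scale)
      qed
      then show "d\<pi> T ** \<pi> s *v x = \<pi> s ** d\<pi> T *v x"
        using eig[OF x] eig by (simp add: vec.scale flip: matrix_vector_mul_assoc)
    qed
    then have "\<pi> s ** d\<pi> (matrix_inv s ** T ** s) = \<pi> s ** d\<pi> T"
      using d\<pi>_conjugate[OF sG T] by simp
    then have "d\<pi> (matrix_inv s ** T ** s) = d\<pi> T"
      using matrix_inv_left[OF \<pi>_invertible[OF sG]] by (metis matrix_mul_assoc matrix_mul_lid)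
    then have "matrix_inv s ** T ** s = T"
      using inj T lie_algebra_conjugate[OF group sG T] by (meson inj_onD)
    then have "s ** (matrix_inv s ** T ** s) = s ** T" by simp
    then show ?thesis
      using matrix_inv_right[OF G_invertible[OF sG]] by (simp add: matrix_mul_assoc)
  qed
  then have "\<forall>Y\<in>lie_algebra S. bracket T Y \<in> lie_algebra S"
    using commutes_lie_algebra lie_algebra_subspace[of S] cmat.subspace_0 by metis
  then show ?thesis using cartan T unfolding cartan_subalgebra_def by blast
qed

text \<open>The invariants of the Lie algebra are stable under the group by conjugation, and under
  complex conjugation by rationality. They are thus the complexification of a real submodule, which
  is proper because \<open>X\<close> acts nontrivially.\<close>

lemma invariants_trivial:
  assumes irr: "irreducible_real_module G \<pi>" and inj: "inj_on d\<pi> (lie_algebra G)"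
    and X: "X \<in> lie_algebra G" "X \<noteq> 0"
    and v: "\<And>X. X \<in> lie_algebra G \<Longrightarrow> d\<pi> X *v v = 0"
  shows "v = 0"
proof -
  define I where "I = {v. \<forall>X\<in>lie_algebra G. d\<pi> X *v v = 0}"
  define W where "W = {u::real^'v. (\<chi> i. complex_of_real (u $ i)) \<in> I}"
  have I: "x + y \<in> I" "c *s x \<in> I" if "x \<in> I" "y \<in> I" for x y c
    using that by (simp_all add: I_def matrix_vector_right_distrib vec.scale)
  have "0 \<in> I" by (simp add: I_def)
  have subW: "subspace W"
  proof (rule subspaceI)
    have "(\<chi> i. complex_of_real ((0::real^'v) $ i)) = 0" by (simp add: vec_eq_iff)
    then show "0 \<in> W" using \<open>0 \<in> I\<close> by (simp add: W_def)
    have eq: "(\<chi> i. complex_of_real ((x + y) $ i)) = (\<chi> i. complex_of_real (x $ i)) + (\<chi> i. complex_of_real (y $ i))"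
      "(\<chi> i. complex_of_real ((c *\<^sub>R x) $ i)) = of_real c *s (\<chi> i. complex_of_real (x $ i))" for x y :: "real^'v" and c
      by (simp_all add: vec_eq_iff)
    show "x + y \<in> W" if "x \<in> W" "y \<in> W" for x y using that I unfolding W_def mem_Collect_eq eq by blast
    show "c *\<^sub>R x \<in> W" if "x \<in> W" for c x using that I unfolding W_def mem_Collect_eq eq by blast
  qed
  have cnj_I: "cnj_vec x \<in> I" if "x \<in> I" for x
    unfolding I_def
  proof (intro CollectI ballI)
    fix Y assume "Y \<in> lie_algebra G"
    then have "cnj_mat Y \<in> lie_algebra G" using lie_algebra_cnj G_cnj by blast
    then have "d\<pi> (cnj_mat Y) *v x = 0" using that by (simp add: I_def)
    then have "cnj_vec (d\<pi> (cnj_mat Y) *v x) = 0" by (simp add: cnj_vec_def vec_eq_iff)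
    then show "d\<pi> Y *v cnj_vec x = 0" by (simp add: cnj_mat_vec flip: d\<pi>_cnj)
  qed
  have "complexification W = I"
  proof (intro set_eqI iffI)
    fix x assume "x \<in> complexification W"
    then have re_im: "(\<chi> i. complex_of_real (Re (x $ i))) \<in> I" "(\<chi> i. complex_of_real (Im (x $ i))) \<in> I"
      by (simp_all add: complexification_def W_def)
    have "(\<chi> i. complex_of_real (Re (x $ i))) + \<i> *s (\<chi> i. complex_of_real (Im (x $ i))) = x"
      by (simp add: vec_eq_iff complex_eq_iff)
    moreover have "(\<chi> i. complex_of_real (Re (x $ i))) + \<i> *s (\<chi> i. complex_of_real (Im (x $ i))) \<in> I"
      using I re_im by blast
    ultimately show "x \<in> I" by simp
  next
    fix x assume x: "x \<in> I"
    have re: "(\<chi> i. complex_of_real (Re (x $ i))) = (1 / 2) *s (x + cnj_vec x)"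
      and im: "(\<chi> i. complex_of_real (Im (x $ i))) = (1 / (2 * \<i>)) *s (x + (- 1) *s cnj_vec x)"
      by (simp_all add: vec_eq_iff cnj_vec_def complex_eq_iff)
    have "(\<chi> i. complex_of_real (Re (x $ i))) \<in> I" "(\<chi> i. complex_of_real (Im (x $ i))) \<in> I"
      unfolding re im using I x cnj_I[OF x] by blast+
    then show "x \<in> complexification W" by (simp add: complexification_def W_def)
  qed
  moreover have "\<pi> g *v x \<in> I" if g: "g \<in> G" and x: "x \<in> I" for g x
    unfolding I_def
  proof (intro CollectI ballI)
    fix Y assume Y: "Y \<in> lie_algebra G"
    have "d\<pi> Y *v (\<pi> g *v x) = \<pi> g *v (d\<pi> (matrix_inv g ** Y ** g) *v x)"
      using d\<pi>_conjugate[OF g Y] by (simp add: matrix_vector_mul_assoc)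
    also have "\<dots> = 0" using x lie_algebra_conjugate[OF group g Y] by (simp add: I_def)
    finally show "d\<pi> Y *v (\<pi> g *v x) = 0" .
  qed
  ultimately have "W = {0} \<or> W = UNIV"
    using irr subW unfolding irreducible_real_module_def by blast
  moreover have "W \<noteq> UNIV"
  proof
    assume "W = UNIV"
    then have "I = UNIV" using \<open>complexification W = I\<close> by (auto simp: complexification_def)
    then have "d\<pi> X *v x = 0 *v x" for x using X by (auto simp: I_def)
    then have "d\<pi> X = 0" by (simp add: matrix_eq)
    moreover have "d\<pi> 0 = 0" using d\<pi>_add[of 0 0] by simp
    ultimately show False using inj X lie_algebra_subspace cmat.subspace_0 by (metis inj_onD)
  qed
  ultimately have "W = {0}" by blast
  moreover have "v \<in> complexification W" using v \<open>complexification W = I\<close> by (simp add: I_def)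
  ultimately show ?thesis by (simp add: complexification_def vec_eq_iff complex_eq_iff)
qed

end

section \<open>Diagonalizing the Cartan subalgebra\<close>

text \<open>Take a nonzero polynomial p with p(f) b = 0 and split off linear factors; the last
  nonzero vector met on the way is an eigenvector, and it stays in \<open>W\<close>.\<close>

lemma eigenvector_exists:
  fixes f :: "complex^'k \<Rightarrow> complex^'k"
  assumes add: "\<And>x y. f (x + y) = f x + f y" and scale: "\<And>c x. f (c *s x) = c *s f x"
    and W: "\<And>x y. x \<in> W \<Longrightarrow> y \<in> W \<Longrightarrow> x + y \<in> W" "\<And>c x. x \<in> W \<Longrightarrow> c *s x \<in> W"
      "\<And>x. x \<in> W \<Longrightarrow> f x \<in> W"
    and b: "b \<in> W" "b \<noteq> 0"
  obtains w \<nu> where "w \<in> W" "w \<noteq> 0" "f w = \<nu> *s w"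
proof -
  have f0: "f 0 = 0" using scale[of 0 0] by simp
  \<comment> \<open>This is p(f) b, evaluated by the Horner scheme.\<close>
  define act where "act = (\<lambda>p. fold_coeffs (\<lambda>a w. a *s b + f w) p 0)"
  have act_0: "act 0 = 0" by (simp add: act_def)
  have act_pCons: "act (pCons a p) = a *s b + f (act p)" for a p
    by (cases "a = 0 \<and> p = 0") (auto simp: act_def f0)
  have act_add: "act (p + q) = act p + act q" for p q
    by (induction p q rule: poly_induct2) (simp_all add: act_0 act_pCons add vec.scale_left_distrib)
  have act_smult: "act (smult c p) = c *s act p" for c p
    by (induction p) (simp_all add: act_0 act_pCons scale vec.scale_right_distrib)
  have "0 \<in> W" using W(2)[OF b(1), of 0] by simp
  then have act_W: "act p \<in> W" for p
    by (induction p) (simp_all add: act_0 act_pCons W b)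
  have act_monom: "act (monom c i) = c *s (f ^^ i) b" for c i
    by (induction i) (simp_all add: monom_0 monom_Suc act_pCons act_0 f0 scale)
  have act_sum: "act (\<Sum>i\<in>I. p i) = (\<Sum>i\<in>I. act (p i))" for I and p :: "nat \<Rightarrow> complex poly"
    by (induction I rule: infinite_finite_induct) (simp_all add: act_0 act_add)
  have step: "\<exists>w \<nu>. w \<in> W \<and> w \<noteq> 0 \<and> f w = \<nu> *s w" if "p \<noteq> 0" "act p = 0" for p
    using that
  proof (induction "degree p" arbitrary: p rule: less_induct)
    case less
    show ?case
    proof (cases "degree p = 0")
      case True
      then obtain a where "p = [:a:]" by (metis degree_eq_zeroE)
      then show ?thesis using less b by (simp add: act_pCons act_0 f0)
    next
      case False
      then have "\<not> constant (poly p)" by (simp add: constant_degree)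
      then obtain \<nu> where "poly p \<nu> = 0" using fundamental_theorem_of_algebra by blast
      then obtain q where q: "p = [:- \<nu>, 1:] * q" by (metis poly_eq_0_iff_dvd dvdE)
      have "q \<noteq> 0" using q less.prems by auto
      have "p = pCons 0 q + smult (- \<nu>) q" by (simp add: q)
      then have "act p = f (act q) - \<nu> *s act q"
        by (simp only: act_add act_smult act_pCons) simp
      then have fq: "f (act q) = \<nu> *s act q" using less.prems by simp
      show ?thesis
      proof (cases "act q = 0")
        case True
        have "degree q < degree p" unfolding q using \<open>q \<noteq> 0\<close> by (subst degree_mult_eq) auto
        then show ?thesis using less.hyps[of q] \<open>q \<noteq> 0\<close> True by blast
      next
        case nz: False
        then show ?thesis using fq act_W by blast
      qed
    qed
  qed
  define g where "g = (\<lambda>i. (f ^^ i) b)"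
  \<comment> \<open>Among the first n + 1 iterates of \<open>b\<close> either two coincide, which
    gives a difference of monomials, or they form a dependent set.\<close>
  have "\<exists>p. p \<noteq> 0 \<and> act p = 0"
  proof (cases "inj_on g {..CARD('k)}")
    case False
    then obtain i j where ij: "i \<noteq> j" "g i = g j" by (auto simp: inj_on_def)
    have "act (monom 1 i + monom (- 1) j) = 0"
      using ij(2) by (simp add: act_add act_monom g_def)
    moreover have "coeff (monom 1 i + monom (- 1) j :: complex poly) i \<noteq> 0" using ij(1) by simp
    then have "monom 1 i + monom (- 1) j \<noteq> (0 :: complex poly)" by (metis coeff_0)
    ultimately show ?thesis by blast
  next
    case True
    have "vec.dependent (g ` {..CARD('k)})"
    proof (rule ccontr)
      assume "\<not> ?thesis"
      then have "card (g ` {..CARD('k)}) \<le> vec.dim (UNIV :: (complex^'k) set)"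
        by (intro vec.independent_card_le_dim) auto
      also have "\<dots> \<le> CARD('k)" by (rule dim_subset_UNIV_cart_gen)
      finally show False using True by (simp add: card_image)
    qed
    then obtain u where u: "\<exists>v\<in>g ` {..CARD('k)}. u v \<noteq> 0" "(\<Sum>v\<in>g ` {..CARD('k)}. u v *s v) = 0"
      using vec.dependent_finite[of "g ` {..CARD('k)}"] by auto
    define p where "p = (\<Sum>i\<le>CARD('k). monom (u (g i)) i)"
    have "act p = (\<Sum>i\<le>CARD('k). u (g i) *s g i)"
      by (simp add: p_def act_sum act_monom g_def)
    also have "\<dots> = 0" using u(2) by (simp add: sum.reindex[OF True])
    finally have "act p = 0" .
    moreover obtain i where "i \<le> CARD('k)" "u (g i) \<noteq> 0" using u(1) by auto
    then have "coeff p i \<noteq> 0" by (simp add: p_def coeff_sum)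
    then have "p \<noteq> 0" by auto
    ultimately show ?thesis by blast
  qed
  with step that show ?thesis by blast
qed

text \<open>The matrices B with [\<eta>, B] = c B are stable under left multiplication by \<eta>,
  which has an eigenvector C among them: \<eta> C = \<nu> C and C \<eta> = (\<nu> - c) C. A nonzero
  column of C belongs to \<nu>, and C \<noteq> 0 makes \<eta> - (\<nu> - c) singular. Matrices are
  flattened to vectors so that \<open>eigenvector_exists\<close> applies.\<close>

lemma eigenvalue_pair:
  fixes \<eta> B :: "complex^'m^'m"
  assumes B: "B \<noteq> 0" "bracket \<eta> B = cscale c B"
  obtains \<nu> x y where "x \<noteq> 0" "\<eta> *v x = \<nu> *s x" "y \<noteq> 0" "\<eta> *v y = (\<nu> - c) *s y"
proof -
  define M where "M = (\<lambda>z :: complex^('m \<times> 'm). (\<chi> i j. z $ (i, j)) :: complex^'m^'m)"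
  define V where "V = (\<lambda>A :: complex^'m^'m. (\<chi> p. A $ fst p $ snd p) :: complex^('m \<times> 'm))"
  have MV: "M (V A) = A" and VM: "V (M z) = z" for A z
    by (simp_all add: M_def V_def vec_eq_iff)
  have M_add: "M (x + y) = M x + M y" and M_scale: "M (a *s x) = cscale a (M x)"
    and V_add: "V (A + C) = V A + V C" and V_scale: "V (cscale a A) = a *s V A" for x y a A C
    by (simp_all add: M_def V_def vec_eq_iff cscale_def)
  define W where "W = {z. bracket \<eta> (M z) = cscale c (M z)}"
  have br: "bracket \<eta> (A + C) = bracket \<eta> A + bracket \<eta> C" "bracket \<eta> (cscale a A) = cscale a (bracket \<eta> A)"
    "bracket \<eta> (\<eta> ** A) = \<eta> ** bracket \<eta> A" for A C a
    by (simp_all add: bracket_def matrix_add_ldistrib matrix_add_mult cscale_mult_left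
        cscale_mult_right matrix_mult_diff matrix_mul_assoc cmat.scale_right_diff_distrib)
  obtain w \<nu> where w: "w \<in> W" "w \<noteq> 0" "V (\<eta> ** M w) = \<nu> *s w"
  proof (rule eigenvector_exists[of "\<lambda>z. V (\<eta> ** M z)" W "V B"])
    show "V (\<eta> ** M (x + y)) = V (\<eta> ** M x) + V (\<eta> ** M y)" for x y
      by (simp add: M_add V_add matrix_add_ldistrib)
    show "V (\<eta> ** M (a *s x)) = a *s V (\<eta> ** M x)" for a x
      by (simp add: M_scale V_scale cscale_mult_right)
    show "x + y \<in> W" if "x \<in> W" "y \<in> W" for x y
      using that by (simp add: W_def M_add br cmat.scale_right_distrib)
    show "a *s x \<in> W" if "x \<in> W" for a x
      using that by (simp add: W_def M_scale br mult.commute)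
    show "V (\<eta> ** M x) \<in> W" if "x \<in> W" for x
      using that by (simp add: W_def MV br cscale_mult_right)
    show "V B \<in> W" using B by (simp add: W_def MV)
    show "V B \<noteq> 0"
    proof
      assume "V B = 0"
      then have "B = M 0" using MV[of B] by simp
      then show False using B(1) by (simp add: M_def vec_eq_iff)
    qed
  qed
  define C where "C = M w"
  have C0: "C \<noteq> 0"
  proof
    assume "C = 0"
    then have "w = V 0" using VM[of w] by (simp add: C_def)
    then show False using w(2) by (simp add: V_def vec_eq_iff)
  qed
  have left: "\<eta> ** C = cscale \<nu> C"
    using w(3) MV[of "\<eta> ** M w"] by (simp add: C_def M_scale)
  have "C ** \<eta> = \<eta> ** C - cscale c C"
    using w(1) by (simp add: W_def C_def bracket_def algebra_simps)
  then have right: "C ** \<eta> = cscale (\<nu> - c) C"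
    by (simp add: left cmat.scale_left_diff_distrib)
  obtain i j where ij: "C $ i $ j \<noteq> 0" using C0 by (auto simp: vec_eq_iff)
  define x where "x = C *v axis j 1"
  have "x $ i = C $ i $ j"
    by (simp add: x_def matrix_vector_mult_def axis_def if_distrib[of "\<lambda>c. _ * c"] cong: if_cong)
  then have "x \<noteq> 0" using ij by auto
  moreover have "\<eta> *v x = \<nu> *s x"
    by (simp add: x_def matrix_vector_mul_assoc left cscale_vector)
  moreover have "\<exists>y. y \<noteq> 0 \<and> \<eta> *v y = (\<nu> - c) *s y"
  proof (rule ccontr)
    assume none: "\<not> ?thesis"
    define D where "D = \<eta> - cscale (\<nu> - c) (mat 1)"
    have "D *v y = \<eta> *v y - (\<nu> - c) *s y" for y
      by (simp only: D_def matrix_vector_mult_diff_rdistrib cscale_vector matrix_vector_mul_lid)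
    then have "\<forall>y. D *v y = 0 \<longrightarrow> y = 0" using none by auto
    then obtain R where "R ** D = mat 1" using matrix_left_invertible_ker by blast
    then have "D ** R = mat 1" using matrix_left_right_inverse by blast
    moreover have "C ** D = 0"
      by (simp add: D_def matrix_mult_diff cscale_mult_right right)
    moreover have "C = (C ** D) ** R"
      using \<open>D ** R = mat 1\<close> by (simp flip: matrix_mul_assoc)
    ultimately have "C = 0" by (simp add: matrix_matrix_mult_def vec_eq_iff)
    then show False using C0 by simp
  qed
  ultimately show ?thesis using that by blast
qed

lemma eigenvectors_independent:
  fixes \<eta> :: "complex^'m^'m"
  assumes "finite I" "inj_on ev I" "\<And>k. k \<in> I \<Longrightarrow> y k \<noteq> 0 \<and> \<eta> *v y k = ev k *s y k"
    and "(\<Sum>k\<in>I. x k *s y k) = 0" "k \<in> I"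
  shows "x k = 0"
  using assms
proof (induction I arbitrary: x k rule: finite_induct)
  case (insert j I)
  have "\<eta> *v (\<Sum>k\<in>insert j I. x k *s y k) = (\<Sum>k\<in>insert j I. x k *s (ev k *s y k))"
    unfolding vec.linear_sum[OF matrix_vector_mul_linear_gen]
    using insert.prems(2) by (intro sum.cong refl) (metis vec.scale)
  then have "(\<Sum>k\<in>insert j I. (x k * ev k) *s y k) - ev j *s (\<Sum>k\<in>insert j I. x k *s y k) = 0"
    by (simp add: insert.prems(3))
  moreover have "(\<Sum>k\<in>insert j I. (x k * (ev k - ev j)) *s y k) =
      (\<Sum>k\<in>insert j I. (x k * ev k) *s y k) - ev j *s (\<Sum>k\<in>insert j I. x k *s y k)"
    unfolding vec.scale_sum_right sum_subtractf[symmetric]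
    by (intro sum.cong refl) (simp add: vec_eq_iff algebra_simps)
  ultimately have "(\<Sum>k\<in>insert j I. (x k * (ev k - ev j)) *s y k) = 0" by simp
  then have "(\<Sum>k\<in>I. (x k * (ev k - ev j)) *s y k) = 0" using insert.hyps by simp
  moreover have "inj_on ev I" using insert.prems(1) by (simp add: inj_on_insert)
  ultimately have "x k * (ev k - ev j) = 0" if "k \<in> I" for k
    using insert.IH[of "\<lambda>k. x k * (ev k - ev j)" k] insert.prems(2) that by blast
  moreover have "ev k \<noteq> ev j" if "k \<in> I" for k
    using insert.prems(1) insert.hyps(2) that by (metis inj_on_contraD insertCI)
  ultimately have zero: "x k = 0" if "k \<in> I" for k using that by simp
  then have "x j *s y j = 0" using insert.prems(3) insert.hyps by simp
  then have "x j = 0" using insert.prems(2)[of j] by simp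
  with zero insert.prems(4) show ?case by auto
qed simp

text \<open>No signed sum of some of the numbers 100, 10, 1 vanishes. So the three pairs, read as
  edges of a graph on \<open>S\<close>, form a forest, and a forest with three edges has at least
  four vertices.\<close>

lemma four_distinct:
  assumes S: "a \<in> S" "a - 100 \<in> S" "b \<in> S" "b - 10 \<in> S" "c \<in> S" "c - 1 \<in> (S :: complex set)"
  obtains ev :: "4 \<Rightarrow> complex" where "inj ev" "range ev \<subseteq> S"
proof -
  have "\<exists>w x y z. {w, x, y, z} \<subseteq> S \<and> distinct [w, x, y, z]"
  proof (cases "{b, b - 10} \<inter> {a, a - 100} = {}")
    case True
    then have "distinct [a, a - 100, b, b - 10]" by auto
    with S show ?thesis by (intro exI[of _ a] exI[of _ "a - 100"] exI[of _ b] exI[of _ "b - 10"]) auto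
  next
    case False
    then have "b = a \<or> b = a - 100 \<or> b - 10 = a \<or> b - 10 = a - 100" by auto
    then have "\<exists>d'. a + d' \<in> S \<and> d' \<in> {- 10, - 110, 10, - 90}"
    proof (elim disjE)
      assume "b = a"
      then show ?thesis using S by (intro exI[of _ "- 10"]) simp
    next
      assume "b = a - 100"
      then show ?thesis using S by (intro exI[of _ "- 110"]) simp
    next
      assume "b - 10 = a"
      then have "a + 10 = b" by (metis diff_add_cancel)
      then show ?thesis using S by (intro exI[of _ "10"]) simp
    next
      assume "b - 10 = a - 100"
      then have "a + - 90 = b" by (simp add: diff_eq_eq)
      then show ?thesis using S by (intro exI[of _ "- 90"]) (simp only: insert_iff simp_thms)
    qed
    then obtain d' where d': "a + d' \<in> S" "d' \<in> {- 10, - 110, 10, - 90}" by blast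
    define d where "d = a + d'"
    have d: "d \<in> S" using d' by (simp add: d_def)
    have dis: "distinct [a, a - 100, d]"
    proof -
      have "a - 100 = a + - 100" by simp
      then show ?thesis using d'(2) by (auto simp: d_def simp del: add_uminus_conv_diff)
    qed
    have "c \<notin> {a, a - 100, d} \<or> c - 1 \<notin> {a, a - 100, d}"
    proof -
      define w where "w = c - a"
      have c: "c \<in> {a, a - 100, d} \<longleftrightarrow> w \<in> {0, - 100, d'}"
        "c - 1 \<in> {a, a - 100, d} \<longleftrightarrow> w \<in> {1, - 99, d' + 1}"
        by (auto simp: w_def d_def diff_eq_eq eq_diff_eq)
      show ?thesis unfolding c using d'(2) by auto
    qed
    then obtain e where "e \<in> S" "e \<notin> {a, a - 100, d}" using S by blast
    with dis d S show ?thesis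
      by (intro exI[of _ a] exI[of _ "a - 100"] exI[of _ d] exI[of _ e]) auto
  qed
  then obtain w x y z where *: "{w, x, y, z} \<subseteq> S" "distinct [w, x, y, z]" by blast
  define ev where "ev = (\<lambda>k::4. if k = 1 then w else if k = 2 then x else if k = 3 then y else z)"
  have "inj ev" using *(2) by (auto simp: inj_def forall_4 ev_def)
  moreover have "range ev \<subseteq> S" using *(1) by (auto simp: ev_def)
  ultimately show ?thesis using that by blast
qed

section \<open>The order of the four weights along the Dynkin diagram\<close>

lemma complete_four:
  fixes u v :: 4
  assumes "u \<noteq> v"
  shows "\<exists>y z. (\<forall>k. k = u \<or> k = v \<or> k = y \<or> k = z) \<and> distinct [u, v, y, z]"
proof -
  have new: "\<exists>k::4. k \<notin> set ks" if "length ks < 4" for ks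
  proof (rule ccontr)
    assume "\<not> ?thesis"
    then have "card (UNIV :: 4 set) \<le> card (set ks)" by (intro card_mono) auto
    then show False using that card_length[of ks] by simp
  qed
  obtain y where y: "y \<notin> set [u, v]" using new[of "[u, v]"] by auto
  obtain z where z: "z \<notin> set [u, v, y]" using new[of "[u, v, y]"] by auto
  have dist: "distinct [u, v, y, z]" using assms y z by auto
  have "card (set [u, v, y, z]) = card (UNIV :: 4 set)"
    using distinct_card[OF dist] by simp
  then have "set [u, v, y, z] = UNIV" by (intro card_subset_eq) auto
  then have "k \<in> set [u, v, y, z]" for k by blast
  then have "k = u \<or> k = v \<or> k = y \<or> k = z" for k by simp
  with dist show ?thesis by blast
qed

lemma sum_four:
  fixes e :: "4 \<Rightarrow> real"
  assumes "\<And>k. k = u \<or> k = v \<or> k = y \<or> k = z" "distinct [u, v, y, z]"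
  shows "(\<Sum>k\<in>UNIV. e k) = e u + e v + e y + e z"
proof -
  have "UNIV = set [u, v, y, z]" using assms(1) by auto
  then have "(\<Sum>k\<in>UNIV. e k) = sum_list (map e [u, v, y, z])"
    using sum.distinct_set_conv_list[OF assms(2), of e] by (simp only:)
  then show ?thesis by simp
qed

text \<open>Two different edges on four points either share a point, which gives three equal values,
  or are disjoint, which gives two pairs that are opposite because the sum is zero.\<close>

lemma two_equalities:
  fixes e :: "4 \<Rightarrow> real"
  assumes ab: "a \<noteq> b" "e a = e b" and cd: "c \<noteq> d" "e c = e d"
    and ne: "\<not> (c = a \<and> d = b)" "\<not> (c = b \<and> d = a)" and sum: "(\<Sum>k\<in>UNIV. e k) = 0"
  shows "(\<exists>w. \<forall>k. k \<noteq> w \<longrightarrow> e k = - e w / 3) \<or> (\<forall>k. e k = e a \<or> e k = - e a)"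
proof -
  obtain y z where yz': "\<forall>k. k = a \<or> k = b \<or> k = y \<or> k = z" "distinct [a, b, y, z]"
    using complete_four[OF ab(1)] by blast
  note yz = yz'(1)[rule_format] yz'(2)
  have s: "e a + e a + e y + e z = 0" using sum sum_four[OF yz, of e] ab(2) by simp
  have "e y = e a \<or> e z = e a \<or> e y = e z"
  proof -
    define p where "p = e a"
    have "e a = p" "e b = p" using ab(2) by (simp_all add: p_def)
    moreover have "e y = p \<or> e z = p \<or> e y = e z"
      using yz(1)[of c] yz(1)[of d] cd ne calculation by (elim disjE; simp)
    ultimately show ?thesis by simp
  qed
  then show ?thesis
  proof (elim disjE)
    assume y: "e y = e a"
    have "\<forall>k. k \<noteq> z \<longrightarrow> e k = - e z / 3"
    proof (intro allI impI)
      fix k assume "k \<noteq> z"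
      then have "e k = e a" using yz(1)[of k] y ab(2) by (elim disjE; simp)
      then show "e k = - e z / 3" using s y by simp
    qed
    then show ?thesis by blast
  next
    assume z: "e z = e a"
    have "\<forall>k. k \<noteq> y \<longrightarrow> e k = - e y / 3"
    proof (intro allI impI)
      fix k assume "k \<noteq> y"
      then have "e k = e a" using yz(1)[of k] z ab(2) by (elim disjE; simp)
      then show "e k = - e y / 3" using s z by simp
    qed
    then show ?thesis by blast
  next
    assume "e y = e z"
    then have m: "e y = - e a" "e z = - e a" using s by simp_all
    have "e k = e a \<or> e k = - e a" for k using yz(1)[of k] m ab(2) by (elim disjE; simp)
    then show ?thesis by blast
  qed
qed

text \<open>
  The three differences form a tree on the four weights. The coordinates of the weight with index
  \<open>r\<close> force this tree to be a path that starts at \<open>r\<close>.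
\<close>

lemma weight_order:
  fixes e1 e2 e3 :: "4 \<Rightarrow> real"
  assumes E1: "e1 a1 - e1 b1 = 1" "e1 a2 = e1 b2" "e1 a3 = e1 b3" "e1 r = 3 / 4" "(\<Sum>k\<in>UNIV. e1 k) = 0"
    and E2: "e2 a1 = e2 b1" "e2 a2 - e2 b2 = 1" "e2 a3 = e2 b3" "e2 r = 1 / 2" "(\<Sum>k\<in>UNIV. e2 k) = 0"
    and E3: "e3 a1 = e3 b1" "e3 a2 = e3 b2" "e3 a3 - e3 b3 = 1" "e3 r = 1 / 4" "(\<Sum>k\<in>UNIV. e3 k) = 0"
  shows "a1 = r \<and> a2 = b1 \<and> a3 = b2 \<and> distinct [r, b1, b2, b3]"
proof -
  have ne: "a1 \<noteq> b1" "a2 \<noteq> b2" "a3 \<noteq> b3" using E1(1) E2(2) E3(3) by auto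
  have ne23: "\<not> (a3 = a2 \<and> b3 = b2)" "\<not> (a3 = b2 \<and> b3 = a2)" using E2(2,3) by auto
  have ne12: "\<not> (a2 = a1 \<and> b2 = b1)" "\<not> (a2 = b1 \<and> b2 = a1)" using E1(1,2) by auto
  \<comment> \<open>The prescribed values 3/4, 1/2, 1/4 at \<open>r\<close> are those of \<omega>_1
    on T^1, T^2, T^3. Two opposite pairs would give \<open>e1\<close> the values 3/4 and -3/4 only,
    and an exceptional point other than \<open>r\<close> the values 3/4 and -9/4; neither allows a
    difference of 1.\<close>
  have first: "a1 = r \<and> (\<forall>k. k \<noteq> r \<longrightarrow> e1 k = - 1 / 4)"
    using two_equalities[OF ne(2) E1(2) ne(3) E1(3) ne23 E1(5)]
  proof
    assume "\<exists>w. \<forall>k. k \<noteq> w \<longrightarrow> e1 k = - e1 w / 3"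
    then obtain w where w: "\<And>k. k \<noteq> w \<Longrightarrow> e1 k = - e1 w / 3" by blast
    have "r = w"
    proof (rule ccontr)
      assume "r \<noteq> w"
      then have "e1 w = - 9 / 4" using w[of r] E1(4) by simp
      then have "e1 k = - 9 / 4 \<or> e1 k = 3 / 4" for k using w[of k] by (cases "k = w") auto
      from this[of a1] this[of b1] E1(1) show False by auto
    qed
    then have r: "\<forall>k. k \<noteq> r \<longrightarrow> e1 k = - 1 / 4" using w E1(4) by simp
    moreover have "a1 = r"
    proof (rule ccontr)
      assume "a1 \<noteq> r"
      then have "e1 a1 = - 1 / 4" using r by blast
      moreover have "e1 b1 = - 1 / 4 \<or> e1 b1 = 3 / 4" using r E1(4) by (cases "b1 = r") auto
      ultimately show False using E1(1) by auto
    qed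
    ultimately show ?thesis by blast
  next
    assume all: "\<forall>k. e1 k = e1 a2 \<or> e1 k = - e1 a2"
    have val: "e1 a2 = 3 / 4 \<or> e1 a2 = - 3 / 4" using all[rule_format, of r] E1(4) by auto
    have "e1 k = 3 / 4 \<or> e1 k = - 3 / 4" for k using all[rule_format, of k] val by auto
    from this[of a1] this[of b1] E1(1) show ?thesis by auto
  qed
  have last: "\<forall>k. k \<noteq> b3 \<longrightarrow> e3 k = 1 / 4"
    using two_equalities[OF ne(1) E3(1) ne(2) E3(2) ne12 E3(5)]
  proof
    assume "\<exists>w. \<forall>k. k \<noteq> w \<longrightarrow> e3 k = - e3 w / 3"
    then obtain w where w: "\<And>k. k \<noteq> w \<Longrightarrow> e3 k = - e3 w / 3" by blast
    have "r \<noteq> w"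
    proof
      assume "r = w"
      then have "e3 k = 1 / 4 \<or> e3 k = - 1 / 12" for k using w[of k] E3(4) by (cases "k = w") auto
      from this[of a3] this[of b3] E3(3) show False by auto
    qed
    then have "e3 w = - 3 / 4" using w[of r] E3(4) by simp
    then have ew: "e3 k = 1 / 4" if "k \<noteq> w" for k using w[OF that] by simp
    have "b3 = w"
    proof (rule ccontr)
      assume "b3 \<noteq> w"
      then have "e3 b3 = 1 / 4" using ew by blast
      moreover have "e3 a3 = 1 / 4 \<or> e3 a3 = - 3 / 4" using ew \<open>e3 w = - 3 / 4\<close> by (cases "a3 = w") auto
      ultimately show False using E3(3) by auto
    qed
    then show ?thesis using ew by blast
  next
    assume all: "\<forall>k. e3 k = e3 a1 \<or> e3 k = - e3 a1"
    have val: "e3 a1 = 1 / 4 \<or> e3 a1 = - 1 / 4" using all[rule_format, of r] E3(4) by auto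
    have "e3 k = 1 / 4 \<or> e3 k = - 1 / 4" for k using all[rule_format, of k] val by auto
    from this[of a3] this[of b3] E3(3) show ?thesis by auto
  qed
  have e3b: "e3 b3 = - 3 / 4" using last ne(3) E3(3) by auto
  have r3: "r \<noteq> b3" using e3b E3(4) by auto
  have f1: "e1 k = - 1 / 4" if "k \<noteq> r" for k using first that by blast
  have l3: "e3 k = 1 / 4" if "k \<noteq> b3" for k using last that by blast
  have "a2 \<noteq> r" "b2 \<noteq> r"
  proof -
    show "a2 \<noteq> r" using f1[of b2] ne(2) E1(2,4) by (cases "a2 = r") simp_all
    show "b2 \<noteq> r" using f1[of a2] ne(2) E1(2,4) by (cases "b2 = r") simp_all
  qed
  moreover have "a2 \<noteq> b3" "b2 \<noteq> b3"
  proof -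
    show "a2 \<noteq> b3" using l3[of b2] ne(2) E3(2) e3b by (cases "a2 = b3") simp_all
    show "b2 \<noteq> b3" using l3[of a2] ne(2) E3(2) e3b by (cases "b2 = b3") simp_all
  qed
  ultimately have dist: "distinct [r, b3, a2, b2]" using r3 ne(2) by auto
  have all: "k = r \<or> k = b3 \<or> k = a2 \<or> k = b2" for k
  proof -
    obtain y z where yz': "\<forall>k. k = r \<or> k = b3 \<or> k = y \<or> k = z" "distinct [r, b3, y, z]"
      using complete_four[OF r3] by blast
    note yz = yz'(1)[rule_format] yz'(2)
    have "{a2, b2} \<subseteq> {y, z}" using dist yz(1)[of a2] yz(1)[of b2] by auto
    then show ?thesis using yz(1)[of k] dist by auto
  qed
  have "e1 b3 = - 1 / 4" using f1 r3 by simp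
  then have "a3 \<noteq> r" using E1(3,4) by (cases "a3 = r") simp_all
  then have a3: "a3 = a2 \<or> a3 = b2" using all[of a3] ne(3) by blast
  have "b1 \<noteq> b3" using E3(1,4) first e3b by (cases "b1 = b3") simp_all
  then have b1: "b1 = a2 \<or> b1 = b2" using all[of b1] first ne(1) by blast
  have s2: "e2 r + e2 b3 + e2 a2 + e2 b2 = 0" using sum_four[OF all dist, of e2] E2(5) by simp
  have r2: "e2 b1 = 1 / 2" using E2(1,4) first by simp
  \<comment> \<open>The first edge starts at \<open>r\<close> and the third ends at
    \<open>b3\<close>, so only the orientation of the middle edge is open. The wrong one gives
    \<open>e2\<close> the value -5/2 at \<open>b3\<close>, which no possible \<open>a3\<close>
    shares.\<close>
  have "b1 \<noteq> b2"
  proof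
    assume "b1 = b2"
    then have "e2 b2 = 1 / 2" "e2 a2 = 3 / 2" using r2 E2(2) by simp_all
    moreover then have "e2 b3 = - 5 / 2" using s2 E2(4) by simp
    ultimately show False using a3 E2(3) by (elim disjE) simp_all
  qed
  then have b1: "b1 = a2" using b1 by blast
  then have e2: "e2 a2 = 1 / 2" "e2 b2 = - 1 / 2" using r2 E2(2) by simp_all
  then have "e2 b3 = - 1 / 2" using s2 E2(4) by simp
  then have "a3 \<noteq> a2" using e2 E2(3) by (cases "a3 = a2") simp_all
  then have "a3 = b2" using a3 by blast
  then show ?thesis using first dist b1 by auto
qed

text \<open>Here \<open>A\<close> stands for the Cartan subalgebra and \<open>f\<close> for the
  isomorphism with \<open>sl4\<close>. One element with four distinct eigenvalues provides the
  frame, nilpotency makes all of \<open>f\<close> diagonal in it, and the highest weight puts the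
  frame in the order of the simple roots.\<close>

lemma diagonal_frame:
  fixes A :: "(complex^'n^'n) set" and f :: "complex^'n^'n \<Rightarrow> complex^4^4"
    and \<sigma> :: "nat \<Rightarrow> complex^'n^'n \<Rightarrow> complex"
  assumes A: "cmat.subspace A"
    and f: "\<And>H H'. H \<in> A \<Longrightarrow> H' \<in> A \<Longrightarrow> f (H + H') = f H + f H'" "\<And>c H. H \<in> A \<Longrightarrow> f (cscale c H) = cscale c (f H)"
    and tr: "\<And>H. H \<in> A \<Longrightarrow> trace (f H) = 0"
    and \<sigma>: "\<And>i H H'. i \<in> {1..3} \<Longrightarrow> H \<in> A \<Longrightarrow> H' \<in> A \<Longrightarrow> \<sigma> i (H + H') = \<sigma> i H + \<sigma> i H'"
      "\<And>i c H. i \<in> {1..3} \<Longrightarrow> H \<in> A \<Longrightarrow> \<sigma> i (cscale c H) = c * \<sigma> i H"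
    and T: "\<forall>j\<in>{1..3}. T j \<in> A" "\<forall>i\<in>{1..3}. \<forall>j\<in>{1..3}. \<sigma> i (T j) = (if i = j then 1 else 0)"
    and root: "\<And>i. i \<in> {1..3} \<Longrightarrow> X i \<noteq> 0"
      "\<And>i H. i \<in> {1..3} \<Longrightarrow> H \<in> A \<Longrightarrow> bracket (f H) (X i) = cscale (\<sigma> i H) (X i)"
    and hw: "y0 \<noteq> 0" "\<And>H. H \<in> A \<Longrightarrow> f H *v y0 = ((3 * \<sigma> 1 H + 2 * \<sigma> 2 H + \<sigma> 3 H) / 4) *s y0"
    and nil: "\<And>H H'. H \<in> A \<Longrightarrow> H' \<in> A \<Longrightarrow> (bracket (f H) ^^ n) (f H') = 0"
  obtains P R :: "complex^4^4" and \<epsilon> where "P ** R = mat 1" "R ** P = mat 1"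
    "\<And>H. H \<in> A \<Longrightarrow> f H = P ** (\<chi> i j. if i = j then \<epsilon> i H else 0) ** R"
    "\<And>H. H \<in> A \<Longrightarrow> \<sigma> 1 H = \<epsilon> 1 H - \<epsilon> 2 H" "\<And>H. H \<in> A \<Longrightarrow> \<sigma> 2 H = \<epsilon> 2 H - \<epsilon> 3 H"
    "\<And>H. H \<in> A \<Longrightarrow> \<sigma> 3 H = \<epsilon> 3 H - \<epsilon> 4 H" "\<And>H. H \<in> A \<Longrightarrow> (\<Sum>k\<in>UNIV. \<epsilon> k H) = 0"
proof -
  \<comment> \<open>The simple roots take the values 100, 10, 1 on \<open>H0\<close>, and each root
    vector yields two eigenvalues differing by the value of its root, as
    \<open>four_distinct\<close> requires.\<close>
  define H0 where "H0 = cscale 100 (T 1) + cscale 10 (T 2) + T 3"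
  have T': "T 1 \<in> A" "T 2 \<in> A" "T 3 \<in> A" using T(1) by auto
  have cT: "cscale 100 (T 1) \<in> A" "cscale 10 (T 2) \<in> A" "cscale 100 (T 1) + cscale 10 (T 2) \<in> A"
    using T' A by (auto intro: cmat.subspace_scale cmat.subspace_add)
  then have H0: "H0 \<in> A" unfolding H0_def using T' A by (intro cmat.subspace_add)
  have \<sigma>H0: "\<sigma> 1 H0 = 100" "\<sigma> 2 H0 = 10" "\<sigma> 3 H0 = 1"
    unfolding H0_def using T(2) T' cT by (simp_all add: \<sigma>)
  define \<eta> where "\<eta> = f H0"
  define S where "S = {\<nu>. \<exists>x. x \<noteq> 0 \<and> \<eta> *v x = \<nu> *s x}"
  have pair: "\<exists>\<nu>. \<nu> \<in> S \<and> \<nu> - \<sigma> i H0 \<in> S" if i: "i \<in> {1..3}" for i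
  proof -
    have "bracket \<eta> (X i) = cscale (\<sigma> i H0) (X i)" using root(2)[OF i H0] by (simp add: \<eta>_def)
    then obtain \<nu> x y where "x \<noteq> 0" "\<eta> *v x = \<nu> *s x" "y \<noteq> 0" "\<eta> *v y = (\<nu> - \<sigma> i H0) *s y"
      by (rule eigenvalue_pair[OF root(1)[OF i]])
    then have "\<nu> \<in> S \<and> \<nu> - \<sigma> i H0 \<in> S" unfolding S_def by blast
    then show ?thesis by blast
  qed
  obtain a b c where "a \<in> S" "a - 100 \<in> S" "b \<in> S" "b - 10 \<in> S" "c \<in> S" "c - 1 \<in> S"
  proof -
    have i: "1 \<in> {1..3::nat}" "2 \<in> {1..3::nat}" "3 \<in> {1..3::nat}" by simp_all
    obtain a b c where "a \<in> S \<and> a - \<sigma> 1 H0 \<in> S" "b \<in> S \<and> b - \<sigma> 2 H0 \<in> S" "c \<in> S \<and> c - \<sigma> 3 H0 \<in> S"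
      using pair[OF i(1)] pair[OF i(2)] pair[OF i(3)] by blast
    then show thesis unfolding \<sigma>H0 by (intro that[of a b c]) blast+
  qed
  then obtain ev :: "4 \<Rightarrow> complex" where ev: "inj ev" "range ev \<subseteq> S" by (rule four_distinct)
  then have "\<forall>k. \<exists>x. x \<noteq> 0 \<and> \<eta> *v x = ev k *s x" by (auto simp: S_def)
  then obtain y where y: "\<And>k. y k \<noteq> 0 \<and> \<eta> *v y k = ev k *s y k" by metis
  define P where "P = (\<chi> i k. y k $ i)"
  have Pv: "P *v x = (\<Sum>k\<in>UNIV. x $ k *s y k)" for x
    by (simp add: P_def matrix_vector_mult_def vec_eq_iff mult.commute)
  have "x = 0" if x: "P *v x = 0" for x
  proof -
    have "x $ k = 0" for k
      by (rule eigenvectors_independent[OF finite ev(1) y x[unfolded Pv] UNIV_I])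
    then show ?thesis by (simp add: vec_eq_iff)
  qed
  then obtain R where RP: "R ** P = mat 1" using matrix_left_invertible_ker by blast
  then have PR: "P ** R = mat 1" using matrix_left_right_inverse by blast
  have \<eta>P: "R ** \<eta> ** P = (\<chi> i j. if i = j then ev i else 0)"
  proof -
    have "\<eta> ** P = P ** (\<chi> i j. if i = j then ev i else 0)"
    proof -
      have 1: "(\<eta> ** P) $ i $ k = (\<eta> *v y k) $ i" for i k
        by (simp add: P_def matrix_matrix_mult_def matrix_vector_mult_def)
      have 2: "(P ** (\<chi> i j. if i = j then ev i else 0)) $ i $ k = ev k * y k $ i" for i k
        by (simp add: P_def matrix_matrix_mult_def if_distrib[of "\<lambda>c. _ * c"] cong: if_cong)
      have 3: "(\<eta> *v y k) $ i = ev k * y k $ i" for i k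
        using conjunct2[OF y[of k]] by (simp only: vector_smult_component)
      show ?thesis unfolding vec_eq_iff by (intro allI) (simp only: 1 2 3)
    qed
    then have "R ** \<eta> ** P = R ** P ** (\<chi> i j. if i = j then ev i else 0)"
      by (simp only: matrix_mul_assoc[symmetric])
    then show ?thesis by (simp only: RP matrix_mul_lid)
  qed
  define cj where "cj = (\<lambda>M. R ** M ** P)"
  have cj_mult: "cj (M ** M') = cj M ** cj M'" for M M'
  proof -
    have "cj M ** cj M' = R ** M ** (P ** R) ** M' ** P" by (simp add: cj_def matrix_mul_assoc)
    then show ?thesis by (simp add: cj_def PR matrix_mul_assoc)
  qed
  have cj_diff: "cj (M - M') = cj M - cj M'" for M M'
    by (simp add: cj_def matrix_diff_mult matrix_mult_diff)
  have cj_bracket: "cj (bracket M M') = bracket (cj M) (cj M')" for M M'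
    by (simp add: bracket_def cj_diff cj_mult)
  have cj_0: "cj 0 = 0" by (simp add: cj_def)
  have cj_inv: "M = P ** cj M ** R" for M
  proof -
    have "P ** cj M ** R = (P ** R) ** M ** (P ** R)" by (simp only: cj_def matrix_mul_assoc)
    then show ?thesis by (simp add: PR)
  qed
  have diag_bracket: "bracket (\<chi> i j. if i = j then \<mu> i else 0) M $ i $ j = (\<mu> i - \<mu> j) * M $ i $ j"
    for \<mu> :: "4 \<Rightarrow> complex" and M i j
    by (simp add: bracket_def matrix_matrix_mult_def if_distrib[of "\<lambda>c. _ * c"]
        if_distrib[of "\<lambda>c. c * _"] algebra_simps cong: if_cong)
  define \<epsilon> where "\<epsilon> = (\<lambda>k H. cj (f H) $ k $ k)"
  \<comment> \<open>In the eigenbasis, bracketing with \<eta> multiplies the entry (i, j) by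
    \<open>ev i - ev j\<close>. Some power of this operation kills \<open>f H\<close>, so all
    entries off the diagonal vanish.\<close>
  have diag: "cj (f H) = (\<chi> i j. if i = j then \<epsilon> i H else 0)" if H: "H \<in> A" for H
  proof -
    have "cj ((bracket \<eta> ^^ k) (f H)) $ i $ j = (ev i - ev j) ^ k * cj (f H) $ i $ j" for k i j
    proof (induction k)
      case (Suc k)
      have "cj \<eta> = (\<chi> i j. if i = j then ev i else 0)" using \<eta>P by (simp add: cj_def)
      then show ?case using Suc by (simp add: cj_bracket diag_bracket)
    qed simp
    note this[of n] 
    moreover have "(bracket \<eta> ^^ n) (f H) = 0" using nil[OF H0 H] by (simp only: \<eta>_def)
    ultimately have "(ev i - ev j) ^ n * cj (f H) $ i $ j = 0" for i j by (simp add: cj_0)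
    then have "cj (f H) $ i $ j = 0" if "i \<noteq> j" for i j
      using that ev(1) by (auto simp: inj_eq)
    then show ?thesis by (simp add: vec_eq_iff \<epsilon>_def)
  qed
  have \<epsilon>_sum: "(\<Sum>k\<in>UNIV. \<epsilon> k H) = 0" if H: "H \<in> A" for H
  proof -
    have "trace (cj (f H)) = trace (P ** (R ** f H))" 
      unfolding cj_def by (rule trace_mul_sym)
    also have "\<dots> = 0" unfolding matrix_mul_assoc PR matrix_mul_lid by (rule tr[OF H])
    finally show ?thesis by (simp add: trace_def \<epsilon>_def)
  qed
  \<comment> \<open>A nonzero entry of the root vector in the eigenbasis shows which difference of
    diagonal entries the root is.\<close>
  have ex_root: "\<exists>p q. \<forall>H\<in>A. \<sigma> i H = \<epsilon> p H - \<epsilon> q H" if i: "i \<in> {1..3}" for i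
  proof -
    have "cj (X i) \<noteq> 0" 
    proof
      assume "cj (X i) = 0"
      then have "X i = P ** 0 ** R" using cj_inv[of "X i"] by simp
      then show False using root(1)[OF i] by simp
    qed
    then obtain p q where pq: "cj (X i) $ p $ q \<noteq> 0" by (auto simp: vec_eq_iff)
    have "\<sigma> i H = \<epsilon> p H - \<epsilon> q H" if H: "H \<in> A" for H
    proof -
      have "cj (bracket (f H) (X i)) = cscale (\<sigma> i H) (cj (X i))"
        unfolding root(2)[OF i H] by (simp add: cj_def cscale_mult_left cscale_mult_right)
      then have "(\<epsilon> p H - \<epsilon> q H) * cj (X i) $ p $ q = \<sigma> i H * cj (X i) $ p $ q"
        using diag_bracket[of "\<lambda>k. \<epsilon> k H" "cj (X i)" p q] by (auto simp: cj_bracket diag[OF H] cscale_def)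
      then show ?thesis using pq by simp
    qed
    then show ?thesis by blast
  qed
  obtain a1 b1 a2 b2 a3 b3 where ab: "\<And>H. H \<in> A \<Longrightarrow> \<sigma> 1 H = \<epsilon> a1 H - \<epsilon> b1 H"
    "\<And>H. H \<in> A \<Longrightarrow> \<sigma> 2 H = \<epsilon> a2 H - \<epsilon> b2 H" "\<And>H. H \<in> A \<Longrightarrow> \<sigma> 3 H = \<epsilon> a3 H - \<epsilon> b3 H"
  proof -
    have i: "1 \<in> {1..3::nat}" "2 \<in> {1..3::nat}" "3 \<in> {1..3::nat}" by simp_all
    obtain a1 b1 a2 b2 a3 b3 where "\<forall>H\<in>A. \<sigma> 1 H = \<epsilon> a1 H - \<epsilon> b1 H"
      "\<forall>H\<in>A. \<sigma> 2 H = \<epsilon> a2 H - \<epsilon> b2 H" "\<forall>H\<in>A. \<sigma> 3 H = \<epsilon> a3 H - \<epsilon> b3 H"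
      using ex_root[OF i(1)] ex_root[OF i(2)] ex_root[OF i(3)] by blast
    then show thesis by (intro that[of a1 b1 a2 b2 a3 b3]) blast+
  qed
  \<comment> \<open>Any nonzero coordinate of the highest weight vector gives such an index.\<close>
  obtain r where r: "\<And>H. H \<in> A \<Longrightarrow> \<epsilon> r H = (3 * \<sigma> 1 H + 2 * \<sigma> 2 H + \<sigma> 3 H) / 4"
  proof -
    have "P *v (R *v y0) = y0" by (simp add: matrix_vector_mul_assoc PR)
    then have "R *v y0 \<noteq> 0" using hw(1) by auto
    then obtain r where r: "(R *v y0) $ r \<noteq> 0" by (auto simp: vec_eq_iff)
    have "\<epsilon> r H = (3 * \<sigma> 1 H + 2 * \<sigma> 2 H + \<sigma> 3 H) / 4" if H: "H \<in> A" for H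
    proof -
      have "cj (f H) *v (R *v y0) = R *v (f H *v ((P ** R) *v y0))"
        by (simp only: cj_def matrix_vector_mul_assoc matrix_mul_assoc)
      also have "\<dots> = ((3 * \<sigma> 1 H + 2 * \<sigma> 2 H + \<sigma> 3 H) / 4) *s (R *v y0)"
        by (simp only: PR matrix_vector_mul_lid hw(2)[OF H] vec.scale)
      finally have "(cj (f H) *v (R *v y0)) $ r = ((3 * \<sigma> 1 H + 2 * \<sigma> 2 H + \<sigma> 3 H) / 4) * (R *v y0) $ r"
        by simp
      moreover have "(cj (f H) *v z) $ r = \<epsilon> r H * z $ r" for z
        unfolding diag[OF H]
        by (simp add: matrix_vector_mult_def if_distrib[of "\<lambda>c. c * _"] cong: if_cong)
      ultimately show ?thesis using r by simp
    qed
    with that show ?thesis by blast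
  qed
  have order: "a1 = r \<and> a2 = b1 \<and> a3 = b2 \<and> distinct [r, b1, b2, b3]"
  proof (rule weight_order[of "\<lambda>k. Re (\<epsilon> k (T 1))" _ _ _ _ _ _ _ "\<lambda>k. Re (\<epsilon> k (T 2))" "\<lambda>k. Re (\<epsilon> k (T 3))"])
    have \<sigma>T: "\<sigma> 1 (T 1) = 1" "\<sigma> 2 (T 1) = 0" "\<sigma> 3 (T 1) = 0" "\<sigma> 1 (T 2) = 0" "\<sigma> 2 (T 2) = 1" "\<sigma> 3 (T 2) = 0"
      "\<sigma> 1 (T 3) = 0" "\<sigma> 2 (T 3) = 0" "\<sigma> 3 (T 3) = 1"
      using T(2) by auto
    have re: "Re (\<epsilon> p H) - Re (\<epsilon> q H) = Re (\<epsilon> p H - \<epsilon> q H)" for p q H by simp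
    show "Re (\<epsilon> a1 (T 1)) - Re (\<epsilon> b1 (T 1)) = 1" "Re (\<epsilon> a2 (T 2)) - Re (\<epsilon> b2 (T 2)) = 1"
      "Re (\<epsilon> a3 (T 3)) - Re (\<epsilon> b3 (T 3)) = 1"
      unfolding re using ab T' \<sigma>T by (metis one_complex.sel(1))+
    have eq: "Re (\<epsilon> p H) = Re (\<epsilon> q H)" if "\<epsilon> p H - \<epsilon> q H = 0" for p q H using that by simp
    show "Re (\<epsilon> a2 (T 1)) = Re (\<epsilon> b2 (T 1))" "Re (\<epsilon> a3 (T 1)) = Re (\<epsilon> b3 (T 1))"
      "Re (\<epsilon> a1 (T 2)) = Re (\<epsilon> b1 (T 2))" "Re (\<epsilon> a3 (T 2)) = Re (\<epsilon> b3 (T 2))"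
      "Re (\<epsilon> a1 (T 3)) = Re (\<epsilon> b1 (T 3))" "Re (\<epsilon> a2 (T 3)) = Re (\<epsilon> b2 (T 3))"
      using ab T' \<sigma>T by (metis eq)+
    show "Re (\<epsilon> r (T 1)) = 3 / 4" "Re (\<epsilon> r (T 2)) = 1 / 2" "Re (\<epsilon> r (T 3)) = 1 / 4"
      unfolding r[OF T'(1)] r[OF T'(2)] r[OF T'(3)] \<sigma>T by simp_all
    have "(\<Sum>k\<in>UNIV. Re (\<epsilon> k H)) = 0" if "H \<in> A" for H
      using \<epsilon>_sum[OF that] by (metis Re_sum zero_complex.sel(1))
    then show "(\<Sum>k\<in>UNIV. Re (\<epsilon> k (T 1))) = 0" "(\<Sum>k\<in>UNIV. Re (\<epsilon> k (T 2))) = 0"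
      "(\<Sum>k\<in>UNIV. Re (\<epsilon> k (T 3))) = 0" using T' by blast+
  qed
  define p where "p = (\<lambda>k::4. if k = 1 then r else if k = 2 then b1 else if k = 3 then b2 else b3)"
  have "inj p" using order by (auto simp: inj_def forall_4 p_def)
  then have bij: "bij p" by (simp add: bij_def finite_UNIV_inj_surj)
  define P' where "P' = (\<chi> i k. P $ i $ p k)"
  define R' where "R' = (\<chi> k i. R $ p k $ i)"
  have sum_p: "(\<Sum>k\<in>UNIV. g (p k)) = (\<Sum>k\<in>UNIV. g k)" for g :: "4 \<Rightarrow> complex"
    using sum.reindex_bij_betw[OF bij, of g] .
  have P'R': "P' ** R' = mat 1"
  proof -
    have "P' ** R' = P ** R"
      unfolding matrix_matrix_mult_def P'_def R'_def vec_eq_iff vec_lambda_beta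
      by (intro allI sum_p[of "\<lambda>k. P $ _ $ k * R $ k $ _"])
    then show ?thesis by (simp add: PR)
  qed
  then have R'P': "R' ** P' = mat 1" using matrix_left_right_inverse by blast
  show ?thesis
  proof (rule that[OF P'R' R'P', of "\<lambda>k. \<epsilon> (p k)"])
    fix H assume H: "H \<in> A"
    have "(P' ** (\<chi> i j. if i = j then \<epsilon> (p i) H else 0) ** R') $ i $ j = (P ** cj (f H) ** R) $ i $ j" for i j
    proof -
      have D: "(M ** (\<chi> i j. if i = j then \<mu> i else 0) ** M') $ i $ j = (\<Sum>k\<in>UNIV. M $ i $ k * \<mu> k * M' $ k $ j)"
        for M M' :: "complex^4^4" and \<mu>
        by (simp add: matrix_matrix_mult_def if_distrib[of "\<lambda>c. _ * c"] cong: if_cong)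
      show ?thesis
        unfolding diag[OF H] D P'_def R'_def vec_lambda_beta
        by (rule sum_p[of "\<lambda>k. P $ i $ k * \<epsilon> k H * R $ k $ j"])
    qed
    then show "f H = P' ** (\<chi> i j. if i = j then \<epsilon> (p i) H else 0) ** R'"
      unfolding vec_eq_iff cj_inv[of "f H", symmetric] by simp
    show "\<sigma> 1 H = \<epsilon> (p 1) H - \<epsilon> (p 2) H" "\<sigma> 2 H = \<epsilon> (p 2) H - \<epsilon> (p 3) H"
      "\<sigma> 3 H = \<epsilon> (p 3) H - \<epsilon> (p 4) H"
      using ab[OF H] order by (simp_all add: p_def)
    show "(\<Sum>k\<in>UNIV. \<epsilon> (p k) H) = 0" using \<epsilon>_sum[OF H] sum_p[of "\<lambda>k. \<epsilon> k H"] by simp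
  qed
qed

section \<open>Matrix units in the Lie algebra\<close>

text \<open>The matrix unit projected to trace zero. It satisfies the bracket relations of gl_4,
  which is why scalar matrices act by zero in \<open>principal_module\<close>.\<close>

definition munit :: "4 \<Rightarrow> 4 \<Rightarrow> complex^4^4" where
  "munit i j = (\<chi> a b. (if a = i \<and> b = j then 1 else 0) - (if i = j \<and> a = b then 1 / 4 else 0))"

lemma munit_entry:
  "munit i j $ a $ b = (if a = i \<and> b = j then 1 else 0) - (if i = j \<and> a = b then 1 / 4 else 0)"
  by (simp add: munit_def)

lemma munit_mult_left: "(munit i j ** M) $ a $ b = (if a = i then M $ j $ b else 0) - (if i = j then M $ a $ b / 4 else 0)"
proof -
  have "munit i j $ a $ k * M $ k $ b =
      (if k = j then (if a = i then M $ j $ b else 0) else 0) - (if k = a then (if i = j then M $ a $ b / 4 else 0) else 0)" for k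
    by (simp add: munit_entry algebra_simps)
  then show ?thesis by (simp add: matrix_matrix_mult_def sum_subtractf)
qed

lemma munit_bracket:
  "bracket (munit i j) (munit p q) = (if j = p then munit i q else 0) - (if q = i then munit p j else 0)"
proof -
  have "bracket (munit i j) (munit p q) $ a $ b =
      ((if j = p then munit i q else 0) - (if q = i then munit p j else 0)) $ a $ b" for a b
    unfolding bracket_def vector_minus_component munit_mult_left
    by (auto simp: munit_entry)
  then show ?thesis by (simp add: vec_eq_iff)
qed

lemma munit_trace: "trace (munit i j) = 0"
proof -
  have "trace (munit i j) = (\<Sum>k\<in>UNIV. (if k = i then (if i = j then 1 else 0) else 0) - (if i = j then 1 / 4 else 0))"
    unfolding trace_def munit_entry by (intro sum.cong) auto
  then show ?thesis by (simp add: sum_subtractf)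
qed

lemma munit_sum: "(\<Sum>k\<in>UNIV. munit k k) = 0"
proof -
  have "(\<Sum>k\<in>UNIV. munit k k $ a $ b) = 0" for a b
  proof -
    have "(\<Sum>k\<in>UNIV. munit k k $ a $ b) = (\<Sum>k\<in>UNIV. (if k = a then (if a = b then 1 else 0) else 0) - (if a = b then 1 / 4 else 0))"
      unfolding munit_entry by (intro sum.cong) auto
    then show ?thesis by (simp add: sum_subtractf)
  qed
  then show ?thesis by (simp add: vec_eq_iff)
qed

lemma munit_expand:
  assumes "trace M = 0"
  shows "(\<Sum>i\<in>UNIV. \<Sum>j\<in>UNIV. cscale (M $ i $ j) (munit i j)) = M"
proof -
  have "(\<Sum>i\<in>UNIV. \<Sum>j\<in>UNIV. M $ i $ j * munit i j $ a $ b) = M $ a $ b" for a b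
  proof -
    have "(\<Sum>j\<in>UNIV. M $ i $ j * munit i j $ a $ b) =
        (if i = a then M $ a $ b else 0) - (if a = b then M $ i $ i / 4 else 0)" for i
    proof -
      have "M $ i $ j * munit i j $ a $ b = (if j = b then (if i = a then M $ a $ b else 0) else 0) -
          (if j = i then (if a = b then M $ i $ i / 4 else 0) else 0)" for j
        by (simp add: munit_entry)
      then show ?thesis by (simp add: sum_subtractf)
    qed
    then have "(\<Sum>i\<in>UNIV. \<Sum>j\<in>UNIV. M $ i $ j * munit i j $ a $ b) = M $ a $ b - (if a = b then trace M / 4 else 0)"
      by (simp add: sum_subtractf trace_def sum_divide_distrib)
    then show ?thesis using assms by simp
  qed
  then show ?thesis by (simp add: vec_eq_iff cscale_def)
qed

text \<open>The \<open>e i j\<close> are preimages of the conjugated units under the isomorphism,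
  whose injectivity transfers every relation from \<open>sl4\<close>.\<close>

lemma matrix_unit_frame:
  fixes g :: "(complex^'n^'n) set" and P R :: "complex^4^4"
  assumes sub: "cmat.subspace g" and br: "\<And>X Y. X \<in> g \<Longrightarrow> Y \<in> g \<Longrightarrow> bracket X Y \<in> g"
    and iso: "lie_isomorphism g sl4 \<iota>" and PR: "P ** R = mat 1" "R ** P = mat 1"
  obtains e :: "4 \<Rightarrow> 4 \<Rightarrow> complex^'n^'n" where "\<And>i j. e i j \<in> g"
    "\<And>i j p q. bracket (e i j) (e p q) = (if j = p then e i q else 0) - (if q = i then e p j else 0)"
    "(\<Sum>k\<in>UNIV. e k k) = 0" "\<And>i j. i \<noteq> j \<Longrightarrow> e i j \<noteq> 0"
    "\<And>X. X \<in> g \<Longrightarrow> X = (\<Sum>i\<in>UNIV. \<Sum>j\<in>UNIV. cscale ((R ** \<iota> X ** P) $ i $ j) (e i j))"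
proof -
  have bij: "bij_betw \<iota> g sl4" and add: "\<And>X Y. X \<in> g \<Longrightarrow> Y \<in> g \<Longrightarrow> \<iota> (X + Y) = \<iota> X + \<iota> Y"
    and scale: "\<And>c X. X \<in> g \<Longrightarrow> \<iota> (cscale c X) = cscale c (\<iota> X)"
    and bracket: "\<And>X Y. X \<in> g \<Longrightarrow> Y \<in> g \<Longrightarrow> \<iota> (bracket X Y) = bracket (\<iota> X) (\<iota> Y)"
    using iso unfolding lie_isomorphism_def by blast+
  have inj: "X = Y" if "X \<in> g" "Y \<in> g" "\<iota> X = \<iota> Y" for X Y
    using bij that by (meson bij_betw_imp_inj_on inj_onD)
  have sl: "trace (\<iota> X) = 0" if "X \<in> g" for X
    using bij that unfolding sl4_def by (metis (mono_tags) bij_betwE mem_Collect_eq)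
  have zero: "0 \<in> g" using sub by (rule cmat.subspace_0)
  have \<iota>0: "\<iota> 0 = 0" using add[OF zero zero] by simp
  define cj where "cj = (\<lambda>M. P ** M ** R)"
  have cj_add: "cj (M + M') = cj M + cj M'" and cj_scale: "cj (cscale c M) = cscale c (cj M)"
    and cj_diff: "cj (M - M') = cj M - cj M'" and cj_0: "cj 0 = 0" for M M' c
    by (simp_all add: cj_def matrix_add_ldistrib matrix_add_mult cscale_mult_left cscale_mult_right
        matrix_diff_mult matrix_mult_diff)
  have cj_mult: "cj M ** cj M' = cj (M ** M')" for M M'
  proof -
    have "cj M ** cj M' = P ** M ** (R ** P) ** M' ** R" by (simp only: cj_def matrix_mul_assoc)
    then show ?thesis by (simp only: cj_def PR matrix_mul_rid matrix_mul_assoc)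
  qed
  have cj_trace: "trace (cj M) = trace M" for M
  proof -
    have "trace (cj M) = trace (R ** (P ** M))" unfolding cj_def by (rule trace_mul_sym)
    then show ?thesis by (simp only: matrix_mul_assoc PR matrix_mul_lid)
  qed
  have cj_inj: "M = 0" if "cj M = 0" for M
  proof -
    have "M = (R ** P) ** M ** (R ** P)" by (simp add: PR)
    also have "\<dots> = R ** cj M ** P" by (simp only: cj_def matrix_mul_assoc)
    finally show ?thesis using that by simp
  qed
  have "cj (munit i j) \<in> \<iota> ` g" for i j
  proof -
    have "cj (munit i j) \<in> sl4" by (simp add: sl4_def cj_trace munit_trace)
    then show ?thesis using bij by (simp add: bij_betw_def)
  qed
  then have "\<forall>i j. \<exists>X. X \<in> g \<and> \<iota> X = cj (munit i j)" by (metis imageE)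
  then obtain e where e: "\<And>i j. e i j \<in> g" "\<And>i j. \<iota> (e i j) = cj (munit i j)" by metis
  have diff: "X - Y \<in> g" "\<iota> (X - Y) = \<iota> X - \<iota> Y" if "X \<in> g" "Y \<in> g" for X Y
  proof -
    show XY: "X - Y \<in> g" using sub that by (rule cmat.subspace_diff)
    have "\<iota> (X - Y) + \<iota> Y = \<iota> X" using add[OF XY that(2)] by simp
    then show "\<iota> (X - Y) = \<iota> X - \<iota> Y" by (simp add: eq_diff_eq)
  qed
  have sum: "(\<Sum>k\<in>K. f k) \<in> g \<and> \<iota> (\<Sum>k\<in>K. f k) = (\<Sum>k\<in>K. \<iota> (f k))" if "finite K" "\<And>k. f k \<in> g"
    for K :: "4 set" and f
    using that(1)
  proof (induction K rule: finite_induct)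
    case (insert x K)
    then show ?case using add[OF that(2)[of x], of "sum f K"] sub that(2)[of x]
      by (auto intro: cmat.subspace_add)
  qed (simp_all add: zero \<iota>0)
  have cj_sum: "cj (\<Sum>k\<in>K. f k) = (\<Sum>k\<in>K. cj (f k))" for K :: "4 set" and f
    by (induction K rule: infinite_finite_induct) (simp_all add: cj_0 cj_add)
  have ife: "(if b then e i j else 0) \<in> g" "\<iota> (if b then e i j else 0) = cj (if b then munit i j else 0)" for b i j
    using e zero by (simp_all add: \<iota>0 cj_0)
  show ?thesis
  proof (rule that)
    show "e i j \<in> g" for i j by (rule e)
    show "bracket (e i j) (e p q) = (if j = p then e i q else 0) - (if q = i then e p j else 0)" for i j p q
    proof (rule inj)
      show "bracket (e i j) (e p q) \<in> g" using br e by blast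
      show "(if j = p then e i q else 0) - (if q = i then e p j else 0) \<in> g" by (intro diff(1) ife)
      have "\<iota> (bracket (e i j) (e p q)) = cj (bracket (munit i j) (munit p q))"
        unfolding bracket[OF e(1) e(1)] e(2) by (simp only: bracket_def cj_mult cj_diff)
      also have "\<dots> = cj (if j = p then munit i q else 0) - cj (if q = i then munit p j else 0)"
        unfolding munit_bracket by (rule cj_diff)
      also have "\<dots> = \<iota> ((if j = p then e i q else 0) - (if q = i then e p j else 0))"
        unfolding diff(2)[OF ife(1) ife(1)] ife(2) ..
      finally show "\<iota> (bracket (e i j) (e p q)) = \<iota> ((if j = p then e i q else 0) - (if q = i then e p j else 0))" .
    qed
    show "(\<Sum>k\<in>UNIV. e k k) = 0"
    proof (rule inj[OF _ zero])
      have s: "(\<Sum>k\<in>UNIV. e k k) \<in> g \<and> \<iota> (\<Sum>k\<in>UNIV. e k k) = (\<Sum>k\<in>UNIV. \<iota> (e k k))"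
        by (rule sum) (auto intro: e)
      then show "(\<Sum>k\<in>UNIV. e k k) \<in> g" by blast
      show "\<iota> (\<Sum>k\<in>UNIV. e k k) = \<iota> 0"
        using s unfolding e(2) cj_sum[symmetric] munit_sum cj_0 \<iota>0 by blast
    qed
    show "e i j \<noteq> 0" if "i \<noteq> j" for i j
    proof
      assume "e i j = 0"
      then have "cj (munit i j) = 0" using e(2)[of i j] \<iota>0 by simp
      then have "munit i j = 0" by (rule cj_inj)
      then have "munit i j $ i $ j = 0" by simp
      then show False using that by (simp add: munit_entry)
    qed
    show "X = (\<Sum>i\<in>UNIV. \<Sum>j\<in>UNIV. cscale ((R ** \<iota> X ** P) $ i $ j) (e i j))" if X: "X \<in> g" for X
    proof -
      define M where "M = R ** \<iota> X ** P"
      have cjM: "cj M = \<iota> X"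
      proof -
        have "cj M = (P ** R) ** \<iota> X ** (P ** R)" by (simp only: cj_def M_def matrix_mul_assoc)
        then show ?thesis by (simp add: PR)
      qed
      then have trM: "trace M = 0" using cj_trace[of M] sl[OF X] by simp
      have tm: "cscale c (e i j) \<in> g" "\<iota> (cscale c (e i j)) = cj (cscale c (munit i j))" for c i j
        using e sub by (simp_all add: scale cj_scale cmat.subspace_scale)
      have row: "(\<Sum>j\<in>UNIV. cscale (M $ i $ j) (e i j)) \<in> g \<and>
          \<iota> (\<Sum>j\<in>UNIV. cscale (M $ i $ j) (e i j)) = (\<Sum>j\<in>UNIV. \<iota> (cscale (M $ i $ j) (e i j)))" for i
        by (rule sum) (auto intro: tm)
      have all: "(\<Sum>i\<in>UNIV. \<Sum>j\<in>UNIV. cscale (M $ i $ j) (e i j)) \<in> g \<and>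
          \<iota> (\<Sum>i\<in>UNIV. \<Sum>j\<in>UNIV. cscale (M $ i $ j) (e i j)) =
          (\<Sum>i\<in>UNIV. \<iota> (\<Sum>j\<in>UNIV. cscale (M $ i $ j) (e i j)))"
        by (rule sum) (use row in auto)
      have "\<iota> (\<Sum>i\<in>UNIV. \<Sum>j\<in>UNIV. cscale (M $ i $ j) (e i j)) =
          cj (\<Sum>i\<in>UNIV. \<Sum>j\<in>UNIV. cscale (M $ i $ j) (munit i j))"
        unfolding conjunct2[OF all] conjunct2[OF row] tm(2) cj_sum ..
      also have "\<dots> = \<iota> X" by (simp only: munit_expand[OF trM] cjM)
      finally show ?thesis using inj[OF X conjunct1[OF all]] unfolding M_def by simp
    qed
  qed
qed

lemma nilpotent_bracket:
  assumes "lie_nilpotent h"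
  obtains n where "\<And>X Y. X \<in> h \<Longrightarrow> Y \<in> h \<Longrightarrow> (bracket X ^^ n) Y = 0"
proof -
  obtain n where n: "(lie_commutator h ^^ n) h \<subseteq> {0}" using assms unfolding lie_nilpotent_def by blast
  have "(bracket X ^^ k) Y \<in> (lie_commutator h ^^ k) h" if "X \<in> h" "Y \<in> h" for X Y k
  proof (induction k)
    case (Suc k)
    then have "bracket X ((bracket X ^^ k) Y) \<in> lie_commutator h ((lie_commutator h ^^ k) h)"
      unfolding lie_commutator_def using that by (intro cmat.span_base) blast
    then show ?case by simp
  qed (use that in simp)
  with n that show ?thesis by blast
qed

section \<open>One-dimensional eigenspaces and the symmetry of the polarization\<close>

lemma dim_one_line:
  assumes "vec.dim (V :: (complex^'v) set) = 1" "x \<in> V" "x \<noteq> 0" "y \<in> V"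
  shows "\<exists>c. y = c *s x"
proof -
  obtain B where B: "B \<subseteq> V" "V \<subseteq> vec.span B" "card B = vec.dim V" using vec.basis_exists by metis
  then obtain b where "B = {b}" using assms(1) by (metis card_1_singletonE)
  then have "V \<subseteq> range (\<lambda>k. k *s b)" using B by (simp add: vec.span_singleton)
  then obtain a c where "x = a *s b" "y = c *s b" using assms by blast
  then have "y = (c / a) *s x" using assms(3) by auto
  then show ?thesis by blast
qed

lemma dim_one_nonzero:
  assumes "vec.dim (V :: (complex^'v) set) = 1"
  shows "\<exists>x\<in>V. x \<noteq> 0"
proof (rule ccontr)
  assume "\<not> ?thesis"
  then have "V \<subseteq> {0}" by blast
  then have "vec.dim V = 0" by simp
  then show False using assms by simp
qed

lemma dim_span_one: "x \<noteq> 0 \<Longrightarrow> vec.dim (vec.span {x :: complex^'v}) = 1"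
  using vec.dim_eq_card_independent[of "{x}"] by simp

lemma polarization_skew:
  assumes "polarization_form Q w"
  shows "complex_form Q x y = (- 1) powi w * complex_form Q y x"
proof -
  have sym: "Q $ i $ j = (- 1) powi w * Q $ j $ i" for i j
  proof -
    have "bilinear_form Q (axis a 1) (axis b 1) = Q $ a $ b" for a b
    proof -
      have "axis a 1 $ i * Q $ i $ j * axis b 1 $ j = (if j = b then (if i = a then Q $ a $ b else 0) else 0)" for i j
        by (simp add: axis_def)
      then show ?thesis by (simp add: bilinear_form_def)
    qed
    then show ?thesis using assms unfolding polarization_form_def by metis
  qed
  have "complex_form Q x y = (\<Sum>i\<in>UNIV. \<Sum>j\<in>UNIV. x $ i * of_rat (Q $ i $ j) * y $ j)"
    by (simp add: complex_form_def bilinear_form_def map_matrix_def)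
  also have "\<dots> = (\<Sum>j\<in>UNIV. \<Sum>i\<in>UNIV. x $ i * of_rat (Q $ i $ j) * y $ j)" by (rule sum.swap)
  also have "\<dots> = (\<Sum>j\<in>UNIV. \<Sum>i\<in>UNIV. (- 1) powi w * (y $ j * of_rat (Q $ j $ i) * x $ i))"
  proof (intro sum.cong refl)
    fix i j
    have "of_rat (Q $ i $ j) = ((- 1) powi w * of_rat (Q $ j $ i) :: complex)"
      using sym[of i j] by (cases "even w") (auto simp: power_int_minus_left of_rat_minus)
    then show "x $ i * of_rat (Q $ i $ j) * y $ j = (- 1) powi w * (y $ j * of_rat (Q $ j $ i) * x $ i)"
      by (simp add: mult_ac)
  qed
  also have "\<dots> = (- 1) powi w * complex_form Q y x"
    by (simp add: complex_form_def bilinear_form_def map_matrix_def sum_distrib_left)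
  finally show ?thesis .
qed

lemma complex_form_add: "complex_form Q (x + y) z = complex_form Q x z + complex_form Q y z"
  and complex_form_scale: "complex_form Q (c *s x) z = c * complex_form Q x z"
  by (simp_all add: complex_form_def bilinear_form_def algebra_simps sum.distrib sum_distrib_left)

section \<open>Principal Hodge representations of type \<open>A\<^sub>3\<close>\<close>

text \<open>For the converse direction: \<open>a\<close> and \<open>b\<close> list the levels on the
  two summands. They are eight distinct numbers, so each eigenspace is a coordinate line.\<close>

lemma principal_diagonal:
  fixes F :: "complex^'v \<Rightarrow> (complex^4) \<times> (complex^4)"
  assumes bij: "bij F" and add: "\<And>u v. F (u + v) = F u + F v"
    and scale: "\<And>c v. F (c *s v) = (c *s fst (F v), c *s snd (F v))"
    and D: "\<And>v. F (differential G \<pi> T *v v) = ((\<chi> k. of_real (a k) * fst (F v) $ k), (\<chi> k. of_real (b k) * snd (F v) $ k))"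
    and vals: "range a \<union> range b = (\<lambda>k. 7 / 2 - real k) ` {..7}"
    and inj: "inj a" "inj b" "range a \<inter> range b = {}"
  shows "principal G \<pi> T"
proof -
  let ?E = "grading_eigenspace G \<pi> T"
  have F0: "F 0 = 0" using add[of 0 0] by simp
  have F_eq: "F u = F v \<longleftrightarrow> u = v" for u v using bij by (simp add: bij_def inj_eq)
  have mem: "v \<in> ?E l \<longleftrightarrow> (\<forall>k. a k = l \<or> fst (F v) $ k = 0) \<and> (\<forall>k. b k = l \<or> snd (F v) $ k = 0)" for v l
  proof -
    have "v \<in> ?E l \<longleftrightarrow> F (differential G \<pi> T *v v) = F (of_real l *s v)"
      by (simp add: grading_eigenspace_def F_eq)
    also have "\<dots> \<longleftrightarrow> (\<forall>k. of_real (a k) * fst (F v) $ k = of_real l * fst (F v) $ k) \<and>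
        (\<forall>k. of_real (b k) * snd (F v) $ k = of_real l * snd (F v) $ k)"
      unfolding D scale by (simp only: prod.inject vec_eq_iff vec_lambda_beta vector_smult_component)
    also have "\<dots> \<longleftrightarrow> (\<forall>k. a k = l \<or> fst (F v) $ k = 0) \<and> (\<forall>k. b k = l \<or> snd (F v) $ k = 0)"
      unfolding mult_cancel_right of_real_eq_iff by blast
    finally show ?thesis .
  qed
  have zero: "?E l = {0}" if l: "l \<notin> range a \<union> range b" for l
  proof -
    have nl: "a k \<noteq> l" "b k \<noteq> l" for k using l by auto
    have "v = 0" if "v \<in> ?E l" for v
    proof -
      have "fst (F v) = 0" "snd (F v) = 0" using that nl unfolding mem by (simp_all add: vec_eq_iff)
      then have "F v = F 0" by (simp add: F0 prod_eq_iff)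
      then show ?thesis by (simp only: F_eq)
    qed
    moreover have "0 \<in> ?E l" by (simp add: mem F0)
    ultimately show ?thesis by blast
  qed
  have line: "vec.dim (?E l) = 1" if l: "l \<in> range a \<union> range b" for l
  proof -
    obtain p where p: "p \<noteq> 0" "\<And>v. v \<in> ?E l \<longleftrightarrow> (\<exists>c. F v = (c *s fst p, c *s snd p))"
    proof -
      consider k where "a k = l" | k where "b k = l" using l by auto
      then show thesis
      proof cases
        case (1 k)
        have uniq: "a j = l \<longleftrightarrow> j = k" "b j \<noteq> l" for j
          using 1 inj by (auto simp: inj_eq)
        show thesis
        proof (rule that[of "(axis k 1, 0)"])
          show "v \<in> ?E l \<longleftrightarrow> (\<exists>c. F v = (c *s fst (axis k 1, 0), c *s snd (axis k 1, 0)))" for v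
          proof
            assume "v \<in> ?E l"
            then have "F v = ((fst (F v) $ k) *s axis k 1, 0)"
              unfolding mem by (auto simp: uniq prod_eq_iff vec_eq_iff axis_def)
            then show "\<exists>c. F v = (c *s fst (axis k 1, 0), c *s snd (axis k 1, 0))" by auto
          next
            assume "\<exists>c. F v = (c *s fst (axis k 1, 0), c *s snd (axis k 1, 0))"
            then show "v \<in> ?E l" unfolding mem by (auto simp: uniq axis_def split: if_splits)
          qed
        qed (simp add: prod_eq_iff axis_eq_0_iff)
      next
        case (2 k)
        have uniq: "b j = l \<longleftrightarrow> j = k" "a j \<noteq> l" for j
          using 2 inj by (auto simp: inj_eq)
        show thesis
        proof (rule that[of "(0, axis k 1)"])
          show "v \<in> ?E l \<longleftrightarrow> (\<exists>c. F v = (c *s fst (0, axis k 1), c *s snd (0, axis k 1)))" for v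
          proof
            assume "v \<in> ?E l"
            then have "F v = (0, (snd (F v) $ k) *s axis k 1)"
              unfolding mem by (auto simp: uniq prod_eq_iff vec_eq_iff axis_def)
            then show "\<exists>c. F v = (c *s fst (0, axis k 1), c *s snd (0, axis k 1))" by auto
          next
            assume "\<exists>c. F v = (c *s fst (0, axis k 1), c *s snd (0, axis k 1))"
            then show "v \<in> ?E l" unfolding mem by (auto simp: uniq axis_def split: if_splits)
          qed
        qed (simp add: prod_eq_iff axis_eq_0_iff)
      qed
    qed
    obtain v0 where v0: "F v0 = p" using bij by (metis bij_def surjD)
    have "v0 \<noteq> 0" using v0 p(1) F0 by auto
    have "v \<in> ?E l \<longleftrightarrow> v \<in> vec.span {v0}" for v
    proof -
      have "v \<in> ?E l \<longleftrightarrow> (\<exists>c. F v = F (c *s v0))" unfolding p(2) scale v0 ..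
      then show ?thesis by (auto simp: F_eq vec.span_singleton)
    qed
    then have "?E l = vec.span {v0}" by blast
    then show ?thesis using dim_span_one[OF \<open>v0 \<noteq> 0\<close>] by simp
  qed
  show ?thesis
    unfolding principal_def
  proof (intro exI[of _ "7 / 2"] conjI allI impI)
    have "7 / 2 \<in> range a \<union> range b" unfolding vals by (rule image_eqI[of _ _ 0]) simp_all
    then show "?E (7 / 2) \<noteq> {0}" using dim_one_nonzero[OF line] by blast
    show "?E l = {0}" if "l > 7 / 2" for l
      using that by (intro zero) (auto simp: vals)
    show "vec.dim (?E (7 / 2 - real k)) = 1" if "real k \<le> 2 * (7 / 2)" for k
      using that by (intro line) (auto simp: vals)
  qed
qed

theorem proposition6p13:
  fixes G :: "(complex^'n^'n) set"
    and Q :: "rat^'v^'v"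
    and w :: int
    and \<pi> :: "complex^'n^'n \<Rightarrow> complex^'v^'v"
    and \<phi> :: "complex \<Rightarrow> complex^'n^'n"
    and \<iota> :: "complex^'n^'n \<Rightarrow> complex^4^4"
    and T\<phi> :: "complex^'n^'n"
    and S b :: "(complex^'n^'n) set"
    and \<sigma> :: "nat \<Rightarrow> complex^'n^'n \<Rightarrow> complex"
    and T :: "nat \<Rightarrow> complex^'n^'n"
  assumes "hodge_representation G Q w \<pi> \<phi>"
    and "lie_isomorphism (lie_algebra G) sl4 \<iota>"
    and "irreducible_real_module G \<pi>"
    and "grading_element G w \<pi> \<phi> T\<phi>"
    and "compact_maximal_torus G S" and "\<phi> ` sphere 0 1 \<subseteq> S"
    and "borel_subalgebra (lie_algebra G) b" and "lie_algebra S \<subseteq> b"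
    and "b \<subseteq> nonneg_ad_part (lie_algebra G) T\<phi>"
    and "ordered_simple_roots (lie_algebra G) (lie_algebra S) b \<sigma>"
    and "highest_weight (lie_algebra G) (lie_algebra S) b \<iota>
           (\<lambda>H. (3 * \<sigma> 1 H + 2 * \<sigma> 2 H + \<sigma> 3 H) / 4)"
    and "\<forall>j\<in>{1..3}. T j \<in> lie_algebra S"
    and "\<forall>i\<in>{1..3}. \<forall>j\<in>{1..3}. \<sigma> i (T j) = (if i = j then 1 else 0)"
    and "\<forall>i\<in>{1..3}. \<sigma> i T\<phi> \<in> \<real> \<and> 0 \<le> Re (\<sigma> i T\<phi>)"
  shows "principal G \<pi> T\<phi> \<longleftrightarrow>
           iso_standard_plus_dual G \<pi> \<iota> \<and>
           (T\<phi> = cscale 3 (T 1) + cscale 2 (T 2) + T 3 \<or>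
            T\<phi> = T 1 + cscale 2 (T 2) + cscale 3 (T 3))"
proof -
  let ?g = "lie_algebra G" and ?t = "lie_algebra S"
  have hr: "algebraic_group \<rat> G" "algebraic_hom \<rat> G (aut_form Q) \<pi>" "inj_on (differential G \<pi>) ?g"
    "circle_hom G \<phi>" "polarized_hodge_structure Q w (\<pi> \<circ> \<phi>)"
    using assms(1) by (simp_all add: hodge_representation_def)
  obtain P N0 where "rational_rep G \<pi> P N0"
    by (rule rational_rep_exists[OF hr(1,2)]) (simp add: aut_form_def)
  then interpret R: rational_rep G \<pi> P N0 .
  note dif = R.differential_eq_d\<pi>
  have inj: "inj_on R.d\<pi> ?g" using hr(3) inj_on_cong[of ?g "differential G \<pi>" R.d\<pi>] dif by blast
  have g: "cmat.subspace ?g" "\<And>X Y. X \<in> ?g \<Longrightarrow> Y \<in> ?g \<Longrightarrow> bracket X Y \<in> ?g"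
    using lie_algebra_subspace lie_algebra_bracket[OF R.group] by blast+
  have t: "cmat.subspace ?t" by (rule lie_algebra_subspace)
  have \<phi>G: "\<phi> z \<in> G" if "z \<in> sphere 0 1" for z
    using hr(4) that unfolding circle_hom_def real_points_def by blast
  have "\<phi> 1 = mat 1"
  proof -
    have one: "(1::complex) \<in> sphere 0 1" by simp
    have "\<phi> (1 * 1) = \<phi> 1 ** \<phi> 1" using hr(4) one unfolding circle_hom_def by blast
    then have "\<phi> 1 = \<phi> 1 ** \<phi> 1" by simp
    then have "matrix_inv (\<phi> 1) ** \<phi> 1 = matrix_inv (\<phi> 1) ** \<phi> 1 ** \<phi> 1"
      by (simp only: matrix_mul_assoc[symmetric])
    then show ?thesis
      unfolding matrix_inv_left[OF R.G_invertible[OF \<phi>G[OF one]]] matrix_mul_lid by simp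
  qed
  then have "(\<pi> \<circ> \<phi>) 1 = mat 1" by (simp add: R.\<pi>_one)
  note hodge_span = hodge_decomposition[OF hr(5) this]
  obtain X0 where X0: "X0 \<in> ?g" "T\<phi> = cscale \<i> X0"
    using assms(4) unfolding grading_element_def real_points_def by blast
  then have T\<phi>: "T\<phi> \<in> ?g" using g(1) by (simp add: cmat.subspace_scale)
  have eig: "R.d\<pi> T\<phi> *v v = (of_int (2 * p - w) / 2) *s v" if "v \<in> hodge_space (\<pi> \<circ> \<phi>) p (w - p)" for p v
  proof -
    have "differential G \<pi> T\<phi> *v v = (of_int (p - (w - p)) / 2) *s v"
      using assms(4) that unfolding grading_element_def by (metis add.commute diff_add_cancel)
    then show ?thesis using dif[OF T\<phi>] by simp
  qed
  have S: "S \<subseteq> G" "\<And>g h. g \<in> S \<Longrightarrow> h \<in> S \<Longrightarrow> g ** h = h ** g" and cartan: "cartan_subalgebra ?g ?t"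
    using assms(5) unfolding compact_maximal_torus_def compact_torus_def real_points_def by blast+
  have T\<phi>t: "T\<phi> \<in> ?t"
    by (rule R.grading_element_in_cartan[OF inj T\<phi> hodge_span eig S assms(6) cartan])
  have tg: "?t \<subseteq> ?g" and nil: "lie_nilpotent ?t" using cartan unfolding cartan_subalgebra_def by blast+
  have \<iota>: "bij_betw \<iota> ?g sl4" "\<And>X Y. X \<in> ?g \<Longrightarrow> Y \<in> ?g \<Longrightarrow> \<iota> (X + Y) = \<iota> X + \<iota> Y"
    "\<And>c X. X \<in> ?g \<Longrightarrow> \<iota> (cscale c X) = cscale c (\<iota> X)"
    "\<And>X Y. X \<in> ?g \<Longrightarrow> Y \<in> ?g \<Longrightarrow> \<iota> (bracket X Y) = bracket (\<iota> X) (\<iota> Y)"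
    using assms(2) unfolding lie_isomorphism_def by blast+
  have \<iota>_inj: "X = Y" if "X \<in> ?g" "Y \<in> ?g" "\<iota> X = \<iota> Y" for X Y
    using \<iota>(1) that by (meson bij_betw_imp_inj_on inj_onD)
  have \<iota>_tr: "trace (\<iota> X) = 0" if "X \<in> ?g" for X
    using bij_betwE[OF \<iota>(1)] that unfolding sl4_def by blast
  have g0: "0 \<in> ?g" using g(1) by (rule cmat.subspace_0)
  have \<iota>0: "\<iota> 0 = 0" using \<iota>(2)[OF g0 g0] by simp
  have \<sigma>_root: "\<sigma> i \<in> roots ?g ?t" if "i \<in> {1..3}" for i
    using assms(10) that unfolding ordered_simple_roots_def simple_roots_def positive_roots_def
    by (auto dest!: bij_betwE)
  have \<sigma>_lin: "\<sigma> i (H + H') = \<sigma> i H + \<sigma> i H'" "\<sigma> i (cscale c H) = c * \<sigma> i H"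
    if "i \<in> {1..3}" "H \<in> ?t" "H' \<in> ?t" for i H H' c
    using \<sigma>_root[OF that(1)] that(2,3) unfolding roots_def dual_space_def by blast+
  have "\<exists>X. X \<in> ?g \<and> X \<noteq> 0 \<and> (\<forall>H\<in>?t. bracket H X = cscale (\<sigma> i H) X)" if i: "i \<in> {1..3}" for i
  proof -
    have "root_space ?g ?t (\<sigma> i) \<noteq> {0}" using \<sigma>_root[OF i] unfolding roots_def by blast
    moreover have "0 \<in> root_space ?g ?t (\<sigma> i)" using g0 by (simp add: root_space_def bracket_def)
    ultimately obtain X where "X \<in> root_space ?g ?t (\<sigma> i)" "X \<noteq> 0" by blast
    then show ?thesis unfolding root_space_def by blast
  qed
  then obtain X where X: "\<And>i. i \<in> {1..3} \<Longrightarrow> X i \<in> ?g \<and> X i \<noteq> 0 \<and> (\<forall>H\<in>?t. bracket H (X i) = cscale (\<sigma> i H) (X i))"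
    by metis
  obtain y0 where y0: "y0 \<noteq> 0" "\<And>H. H \<in> ?t \<Longrightarrow> \<iota> H *v y0 = ((3 * \<sigma> 1 H + 2 * \<sigma> 2 H + \<sigma> 3 H) / 4) *s y0"
    using assms(11) unfolding highest_weight_def by blast
  obtain n where n: "\<And>H H'. H \<in> ?t \<Longrightarrow> H' \<in> ?t \<Longrightarrow> (bracket H ^^ n) H' = 0"
    using nilpotent_bracket[OF nil] by blast
  have \<iota>_pow: "(bracket H ^^ k) H' \<in> ?g \<and> \<iota> ((bracket H ^^ k) H') = (bracket (\<iota> H) ^^ k) (\<iota> H')"
    if "H \<in> ?g" "H' \<in> ?g" for H H' k
    by (induction k) (use that g(2) \<iota>(4) in auto)
  obtain P0 R0 :: "complex^4^4" and \<epsilon> :: "4 \<Rightarrow> complex^'n^'n \<Rightarrow> complex" where P0: "P0 ** R0 = mat 1" "R0 ** P0 = mat 1"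
    and diag: "\<And>H. H \<in> ?t \<Longrightarrow> \<iota> H = P0 ** (\<chi> i j. if i = j then \<epsilon> i H else 0) ** R0"
    and \<sigma>\<epsilon>: "\<And>H. H \<in> ?t \<Longrightarrow> \<sigma> 1 H = \<epsilon> 1 H - \<epsilon> 2 H" "\<And>H. H \<in> ?t \<Longrightarrow> \<sigma> 2 H = \<epsilon> 2 H - \<epsilon> 3 H"
      "\<And>H. H \<in> ?t \<Longrightarrow> \<sigma> 3 H = \<epsilon> 3 H - \<epsilon> 4 H"
    and \<epsilon>_sum: "\<And>H. H \<in> ?t \<Longrightarrow> (\<Sum>k\<in>UNIV. \<epsilon> k H) = 0"
  proof (rule diagonal_frame[of ?t \<iota> \<sigma> T "\<lambda>i. \<iota> (X i)" y0 n])
    fix P R :: "complex^4^4" and \<epsilon> :: "4 \<Rightarrow> complex^'n^'n \<Rightarrow> complex"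
    assume "P ** R = mat 1" "R ** P = mat 1"
      "\<And>H. H \<in> ?t \<Longrightarrow> \<iota> H = P ** (\<chi> i j. if i = j then \<epsilon> i H else 0) ** R"
      "\<And>H. H \<in> ?t \<Longrightarrow> \<sigma> 1 H = \<epsilon> 1 H - \<epsilon> 2 H" "\<And>H. H \<in> ?t \<Longrightarrow> \<sigma> 2 H = \<epsilon> 2 H - \<epsilon> 3 H"
      "\<And>H. H \<in> ?t \<Longrightarrow> \<sigma> 3 H = \<epsilon> 3 H - \<epsilon> 4 H" "\<And>H. H \<in> ?t \<Longrightarrow> (\<Sum>k\<in>UNIV. \<epsilon> k H) = 0"
    then show thesis by (rule that)
  next
    show "cmat.subspace ?t" by (rule t)
    show "\<iota> (H + H') = \<iota> H + \<iota> H'" if "H \<in> ?t" "H' \<in> ?t" for H H' using \<iota>(2) that tg by blast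
    show "\<iota> (cscale c H) = cscale c (\<iota> H)" if "H \<in> ?t" for c H using \<iota>(3) that tg by blast
    show "trace (\<iota> H) = 0" if "H \<in> ?t" for H using \<iota>_tr that tg by blast
    show "\<sigma> i (H + H') = \<sigma> i H + \<sigma> i H'" if "i \<in> {1..3}" "H \<in> ?t" "H' \<in> ?t" for i H H'
      by (rule \<sigma>_lin(1)[OF that])
    show "\<sigma> i (cscale c H) = c * \<sigma> i H" if "i \<in> {1..3}" "H \<in> ?t" for i c H
      by (rule \<sigma>_lin(2)[OF that that(2)])
    show "\<forall>j\<in>{1..3}. T j \<in> ?t" by (rule assms(12))
    show "\<forall>i\<in>{1..3}. \<forall>j\<in>{1..3}. \<sigma> i (T j) = (if i = j then 1 else 0)" by (rule assms(13))
    show "\<iota> (X i) \<noteq> 0" if "i \<in> {1..3}" for i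
      using X[OF that] \<iota>_inj[OF _ g0] \<iota>0 by metis
    show "bracket (\<iota> H) (\<iota> (X i)) = cscale (\<sigma> i H) (\<iota> (X i))" if "i \<in> {1..3}" "H \<in> ?t" for i H
      using X[OF that(1)] \<iota>(4)[of H "X i"] \<iota>(3)[of "X i" "\<sigma> i H"] that(2) tg by auto
    show "y0 \<noteq> 0" by (rule y0)
    show "\<iota> H *v y0 = ((3 * \<sigma> 1 H + 2 * \<sigma> 2 H + \<sigma> 3 H) / 4) *s y0" if "H \<in> ?t" for H by (rule y0(2)[OF that])
    show "(bracket (\<iota> H) ^^ n) (\<iota> H') = 0" if "H \<in> ?t" "H' \<in> ?t" for H H'
    proof -
      have HG: "H \<in> ?g" "H' \<in> ?g" using that tg by blast+
      have "(bracket (\<iota> H) ^^ n) (\<iota> H') = \<iota> ((bracket H ^^ n) H')" using \<iota>_pow[OF HG, of n] by simp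
      then show ?thesis using n[OF that] \<iota>0 by simp
    qed
  qed
  \<comment> \<open>The diagonal entries are real: their successive differences are real by the
    normalization, and their sum is zero.\<close>
  define t4 where "t4 = (\<lambda>k. Re (\<epsilon> k T\<phi>))"
  have \<sigma>T\<phi>: "\<sigma> i T\<phi> \<in> \<real>" "0 \<le> Re (\<sigma> i T\<phi>)" if "i \<in> {1..3}" for i using assms(14) that by blast+
  have \<epsilon>_real: "\<epsilon> k T\<phi> = of_real (t4 k)" for k
  proof -
    have "Im (\<epsilon> 1 T\<phi>) = Im (\<epsilon> 2 T\<phi>)" "Im (\<epsilon> 2 T\<phi>) = Im (\<epsilon> 3 T\<phi>)" "Im (\<epsilon> 3 T\<phi>) = Im (\<epsilon> 4 T\<phi>)"
      using \<sigma>T\<phi>(1)[of 1] \<sigma>T\<phi>(1)[of 2] \<sigma>T\<phi>(1)[of 3] \<sigma>\<epsilon>[OF T\<phi>t] by (simp_all add: complex_is_Real_iff)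
    moreover have "Im (\<Sum>k\<in>UNIV. \<epsilon> k T\<phi>) = 0" using \<epsilon>_sum[OF T\<phi>t] by simp
    then have "Im (\<epsilon> 1 T\<phi>) + Im (\<epsilon> 2 T\<phi>) + Im (\<epsilon> 3 T\<phi>) + Im (\<epsilon> 4 T\<phi>) = 0" by (simp add: sum_4)
    ultimately have "Im (\<epsilon> 1 T\<phi>) = 0" "Im (\<epsilon> 2 T\<phi>) = 0" "Im (\<epsilon> 3 T\<phi>) = 0" "Im (\<epsilon> 4 T\<phi>) = 0" by linarith+
    then have "Im (\<epsilon> k T\<phi>) = 0" using exhaust_4[of k] by auto
    then show ?thesis by (simp add: t4_def complex_eq_iff)
  qed
  have t4_diff: "\<sigma> 1 T\<phi> = of_real (t4 1 - t4 2)" "\<sigma> 2 T\<phi> = of_real (t4 2 - t4 3)" "\<sigma> 3 T\<phi> = of_real (t4 3 - t4 4)"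
    using \<sigma>\<epsilon>[OF T\<phi>t] by (simp_all add: \<epsilon>_real)
  have t4_mono: "t4 2 \<le> t4 1" "t4 3 \<le> t4 2" "t4 4 \<le> t4 3"
    using \<sigma>T\<phi>(2)[of 1] \<sigma>T\<phi>(2)[of 2] \<sigma>T\<phi>(2)[of 3] t4_diff by simp_all
  have t4_sum: "(\<Sum>k\<in>UNIV. t4 k) = 0"
  proof -
    have "complex_of_real (\<Sum>k\<in>UNIV. t4 k) = 0" using \<epsilon>_sum[OF T\<phi>t] by (simp add: \<epsilon>_real)
    then show ?thesis by (simp only: of_real_eq_0_iff)
  qed
  have t4_det: "t4 = wt4 a b c d \<longleftrightarrow> \<sigma> 1 T\<phi> = of_real (a - b) \<and> \<sigma> 2 T\<phi> = of_real (b - c) \<and> \<sigma> 3 T\<phi> = of_real (c - d)"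
    if "a + b + c + d = 0" for a b c d
  proof -
    have "t4 1 + t4 2 + t4 3 + t4 4 = 0" using t4_sum by (simp add: sum_4)
    with that show ?thesis unfolding t4_diff of_real_eq_iff by (auto simp: fun4_eq wt4_simps)
  qed
  have T_in: "T 1 \<in> ?t" "T 2 \<in> ?t" "T 3 \<in> ?t" using assms(12) by auto
  \<comment> \<open>The three root values fix the differences of the diagonal entries, the trace
    fixes the entries, and injectivity of the isomorphism fixes the element.\<close>
  have comb: "T\<phi> = cscale x (T 1) + cscale y (T 2) + cscale z (T 3) \<longleftrightarrow> \<sigma> 1 T\<phi> = x \<and> \<sigma> 2 T\<phi> = y \<and> \<sigma> 3 T\<phi> = z" for x y z
  proof -
    define H where "H = cscale x (T 1) + cscale y (T 2) + cscale z (T 3)"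
    have c: "cscale a (T 1) \<in> ?t" "cscale a (T 2) \<in> ?t" "cscale a (T 3) \<in> ?t" for a
      using T_in t by (auto intro: cmat.subspace_scale)
    have c2: "cscale x (T 1) + cscale y (T 2) \<in> ?t" using c t by (auto intro: cmat.subspace_add)
    then have Ht: "H \<in> ?t" unfolding H_def using c t by (auto intro: cmat.subspace_add)
    have \<sigma>H: "\<sigma> i H = x * \<sigma> i (T 1) + y * \<sigma> i (T 2) + z * \<sigma> i (T 3)" if "i \<in> {1..3}" for i
      unfolding H_def \<sigma>_lin(1)[OF that c2 c(3)] \<sigma>_lin(1)[OF that c(1) c(2)]
        \<sigma>_lin(2)[OF that T_in(1) T_in(1)] \<sigma>_lin(2)[OF that T_in(2) T_in(2)] \<sigma>_lin(2)[OF that T_in(3) T_in(3)] ..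
    have \<sigma>H': "\<sigma> 1 H = x" "\<sigma> 2 H = y" "\<sigma> 3 H = z"
      using \<sigma>H[of 1] \<sigma>H[of 2] \<sigma>H[of 3] assms(13) by simp_all
    have "T\<phi> = H" if "\<sigma> 1 T\<phi> = \<sigma> 1 H" "\<sigma> 2 T\<phi> = \<sigma> 2 H" "\<sigma> 3 T\<phi> = \<sigma> 3 H"
    proof -
      have s4: "\<epsilon> 1 A + \<epsilon> 2 A + \<epsilon> 3 A + \<epsilon> 4 A = 0" if "A \<in> ?t" for A
        using \<epsilon>_sum[OF that] by (simp add: sum_4)
      define \<delta> where "\<delta> = (\<lambda>k. \<epsilon> k T\<phi> - \<epsilon> k H)"
      have "\<delta> 1 - \<delta> 2 = \<sigma> 1 T\<phi> - \<sigma> 1 H" "\<delta> 2 - \<delta> 3 = \<sigma> 2 T\<phi> - \<sigma> 2 H" "\<delta> 3 - \<delta> 4 = \<sigma> 3 T\<phi> - \<sigma> 3 H"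
        unfolding \<sigma>\<epsilon>[OF T\<phi>t] \<sigma>\<epsilon>[OF Ht] \<delta>_def by simp_all
      then have \<delta>: "\<delta> 1 = \<delta> 2" "\<delta> 2 = \<delta> 3" "\<delta> 3 = \<delta> 4" using that by simp_all
      have "\<delta> 1 + \<delta> 2 + \<delta> 3 + \<delta> 4 = (\<epsilon> 1 T\<phi> + \<epsilon> 2 T\<phi> + \<epsilon> 3 T\<phi> + \<epsilon> 4 T\<phi>) - (\<epsilon> 1 H + \<epsilon> 2 H + \<epsilon> 3 H + \<epsilon> 4 H)"
        unfolding \<delta>_def by simp
      then have "\<delta> 1 + \<delta> 2 + \<delta> 3 + \<delta> 4 = 0" unfolding s4[OF T\<phi>t] s4[OF Ht] by simp
      then have "4 * \<delta> 1 = 0" using \<delta> by simp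
      then have "\<delta> k = 0" for k using \<delta> exhaust_4[of k] by auto
      then have "\<epsilon> k T\<phi> = \<epsilon> k H" for k by (simp add: \<delta>_def)
      then have "\<iota> T\<phi> = \<iota> H" using diag[OF T\<phi>t] diag[OF Ht] by (simp cong: if_cong)
      then show ?thesis using \<iota>_inj T\<phi>t Ht tg by blast
    qed
    then show ?thesis using \<sigma>H' unfolding H_def[symmetric] by metis
  qed
  \<comment> \<open>Gaps 3, 2, 1 with sum zero mean 7/2, 1/2, -3/2, -5/2; the other element has the
    reversed gaps.\<close>
  have cases: "(T\<phi> = cscale 3 (T 1) + cscale 2 (T 2) + T 3 \<or> T\<phi> = T 1 + cscale 2 (T 2) + cscale 3 (T 3)) \<longleftrightarrow>
      (t4 = wt4 (7/2) (1/2) (- 3/2) (- 5/2) \<or> t4 = wt4 (5/2) (3/2) (- 1/2) (- 7/2))"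
    using comb[of 3 2 1] comb[of 1 2 3] t4_det[of "7/2" "1/2" "- 3/2" "- 5/2"] t4_det[of "5/2" "3/2" "- 1/2" "- 7/2"]
    by simp
  have conj_diag: "R0 ** \<iota> T\<phi> ** P0 = (\<chi> i j. if i = j then of_real (t4 i) else 0)"
  proof -
    have "R0 ** \<iota> T\<phi> ** P0 = (R0 ** P0) ** (\<chi> i j. if i = j then \<epsilon> i T\<phi> else 0) ** (R0 ** P0)"
      unfolding diag[OF T\<phi>t] by (simp only: matrix_mul_assoc)
    then show ?thesis by (simp add: P0 \<epsilon>_real cong: if_cong)
  qed
  show ?thesis
  proof
    assume "principal G \<pi> T\<phi>"
    then obtain m where m: "grading_eigenspace G \<pi> T\<phi> m \<noteq> {0}"
      "\<And>l. l > m \<Longrightarrow> grading_eigenspace G \<pi> T\<phi> l = {0}"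
      "\<And>k::nat. real k \<le> 2 * m \<Longrightarrow> vec.dim (grading_eigenspace G \<pi> T\<phi> (m - real k)) = 1"
      unfolding principal_def by blast
    define D where "D = (\<lambda>x. R.d\<pi> T\<phi> *v x)"
    have D0: "D 0 = 0" by (simp add: D_def)
    have eigsp: "grading_eigenspace G \<pi> T\<phi> l = {v. D v = of_real l *s v}" for l
      by (simp add: grading_eigenspace_def D_def dif[OF T\<phi>])
    obtain e where e: "\<And>i j. e i j \<in> ?g"
      "\<And>i j p q. bracket (e i j) (e p q) = (if j = p then e i q else 0) - (if q = i then e p j else 0)"
      "(\<Sum>k\<in>UNIV. e k k) = 0" "\<And>i j. i \<noteq> j \<Longrightarrow> e i j \<noteq> 0"
      "\<And>X. X \<in> ?g \<Longrightarrow> X = (\<Sum>i\<in>UNIV. \<Sum>j\<in>UNIV. cscale ((R0 ** \<iota> X ** P0) $ i $ j) (e i j))"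
      by (rule matrix_unit_frame[OF g assms(2) P0]) (assumption+, rule that)
    define E where "E = (\<lambda>i j x. R.d\<pi> (e i j) *v x)"
    have L_add: "R.d\<pi> (A + C) *v x = R.d\<pi> A *v x + R.d\<pi> C *v x"
      and L_scale: "R.d\<pi> (cscale c A) *v x = c *s (R.d\<pi> A *v x)" for A C c x
      by (simp_all add: R.d\<pi>_add R.d\<pi>_scale matrix_vector_mult_add_rdistrib cscale_vector)
    have L0: "R.d\<pi> 0 *v x = 0" for x using L_add[of 0 0 x] by simp
    have L_sum: "R.d\<pi> (\<Sum>k\<in>K. f k) *v x = (\<Sum>k\<in>K. R.d\<pi> (f k) *v x)" for K :: "4 set" and f x
      by (induction K rule: infinite_finite_induct) (simp_all add: L0 L_add)
    have act: "R.d\<pi> X *v x = (\<Sum>i\<in>UNIV. \<Sum>j\<in>UNIV. (R0 ** \<iota> X ** P0) $ i $ j *s E i j x)" if X: "X \<in> ?g" for X x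
    proof -
      have "R.d\<pi> X *v x = R.d\<pi> (\<Sum>i\<in>UNIV. \<Sum>j\<in>UNIV. cscale ((R0 ** \<iota> X ** P0) $ i $ j) (e i j)) *v x"
        by (rule arg_cong[OF e(5)[OF X], of "\<lambda>A. R.d\<pi> A *v x"])
      then show ?thesis by (simp only: L_sum L_scale E_def)
    qed
    have grade: "(\<Sum>k\<in>UNIV. of_real (t4 k) *s E k k x) = D x" for x
    proof -
      have "(\<Sum>j\<in>UNIV. (if i = j then of_real (t4 i) else 0) *s E i j x) = of_real (t4 i) *s E i i x" for i
      proof -
        have "(if i = j then of_real (t4 i) else 0) *s E i j x = (if j = i then of_real (t4 i) *s E i i x else 0)" for j
          by auto
        then show ?thesis by simp
      qed
      then show ?thesis unfolding D_def act[OF T\<phi>] conj_diag by simp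
    qed
    let ?B = "complex_form Q"
    have B_inv: "?B (R.d\<pi> X *v u) v = - ?B u (R.d\<pi> X *v v)" if "X \<in> ?g" for X u v
    proof -
      have "?B (R.d\<pi> X *v u) v + ?B u (R.d\<pi> X *v v) = 0"
        unfolding complex_form_def
      proof (rule R.d\<pi>_form[OF _ that])
        fix h u v assume "h \<in> G"
        then have "\<pi> h \<in> aut_form Q" using hr(2) unfolding algebraic_hom_def by blast
        then show "bilinear_form (map_matrix of_rat Q) (\<pi> h *v u) (\<pi> h *v v) = bilinear_form (map_matrix of_rat Q) u v"
          unfolding aut_form_def complex_form_def by blast
      qed
      then show ?thesis by (simp add: eq_neg_iff_add_eq_0)
    qed
    have B_sym: "?B x y = (- 1) powi w * ?B y x" for x y
      using hr(5) polarization_skew unfolding polarized_hodge_structure_def by blast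
    have B_add_right: "?B x (y + z) = ?B x y + ?B x z" and B_scale_right: "?B x (c *s y) = c * ?B x y" for x y z c
      by (simp_all add: complex_form_def bilinear_form_def algebra_simps sum.distrib sum_distrib_left)
    have B_nondeg: "\<exists>y. ?B x y \<noteq> 0" if "x \<noteq> 0" for x
    proof -
      have "0 < Re (?B x ((\<pi> \<circ> \<phi>) \<i> *v cnj_vec x))"
        using hr(5) that unfolding polarized_hodge_structure_def by blast
      then have "?B x ((\<pi> \<circ> \<phi>) \<i> *v cnj_vec x) \<noteq> 0" by auto
      then show ?thesis by blast
    qed
    have D_hodge: "D v = of_real ((2 * real_of_int p - real_of_int w) / 2) *s v"
      if "v \<in> hodge_space (\<pi> \<circ> \<phi>) p (w - p)" for p v
      using eig[OF that] by (simp add: D_def)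
    have pairing: "\<exists>p y. D y = of_real ((2 * real_of_int p - real_of_int w) / 2) *s y \<and> ?B x y \<noteq> 0"
      if x: "x \<noteq> 0" for x
    proof (rule ccontr)
      assume none: "\<not> ?thesis"
      obtain y where y: "?B x y \<noteq> 0" using B_nondeg[OF x] by blast
      have "?B x y = 0"
        using hodge_span[of y]
      proof (induction rule: vec.span_induct_alt)
        case base
        show ?case using B_scale_right[of x 0 0] by simp
      next
        case (step c v y)
        then have "?B x v = 0" using none D_hodge by blast
        then show ?case using step by (simp add: B_add_right B_scale_right)
      qed
      then show False using y by blast
    qed
    \<comment> \<open>Invariance of the form pairs level \<open>l\<close> with -l only. So the
      levels are symmetric about zero, and 2l is an integer of the parity of
      \<open>w\<close>.\<close>
    have level: "\<exists>p::int. l = (2 * real_of_int p - real_of_int w) / 2 \<and> (\<exists>y. y \<noteq> 0 \<and> D y = of_real (- l) *s y)"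
      if x: "x \<noteq> 0" and l: "D x = of_real l *s x" for x l
    proof -
      obtain p y where py: "D y = of_real ((2 * real_of_int p - real_of_int w) / 2) *s y" "?B x y \<noteq> 0"
        using pairing[OF x] by blast
      let ?l = "(2 * real_of_int p - real_of_int w) / 2"
      have "of_real l * ?B x y = - (of_real ?l * ?B x y)"
        using B_inv[OF T\<phi>, of x y] l py(1) unfolding D_def by (simp only: complex_form_scale B_scale_right)
      then have "complex_of_real (l + ?l) * ?B x y = 0" by (simp only: of_real_add ring_distribs) simp
      then have "complex_of_real (l + ?l) = 0" using py(2) by (simp only: mult_eq_0_iff) simp
      then have ll: "?l = - l" by (simp only: of_real_eq_0_iff)
      then have "l = (2 * real_of_int (w - p) - real_of_int w) / 2" by simp
      moreover have "y \<noteq> 0" using py(2) B_scale_right[of x 0 0] by auto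
      ultimately show ?thesis using py(1) unfolding ll by blast
    qed
    have m_top: "l \<le> m" if "x \<noteq> 0" "D x = of_real l *s x" for x l
      using m(2)[of l] that unfolding eigsp by force
    have "0 \<in> grading_eigenspace G \<pi> T\<phi> m" by (simp add: eigsp D0)
    then obtain xm where xm: "xm \<noteq> 0" "D xm = of_real m *s xm" using m(1) unfolding eigsp by blast
    obtain pm :: int and ym where pm: "m = (2 * real_of_int pm - real_of_int w) / 2" "ym \<noteq> 0" "D ym = of_real (- m) *s ym"
      using level[OF xm] by blast
    have "- m \<le> m" using m_top[OF pm(2,3)] .
    moreover have "real_of_int (2 * pm - w) = 2 * m" using pm(1) by simp
    ultimately have "0 \<le> real_of_int (2 * pm - w)" by linarith
    then have "0 \<le> 2 * pm - w" by (simp only: of_int_0_le_iff)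
    \<comment> \<open>This is N = 2m. It is not negative because -m is a level as well, and its
      parity is that of the weight \<open>w\<close>, which decides the sign of the form.\<close>
    then obtain N :: nat where N: "2 * pm - w = int N" by (metis nonneg_int_cases)
    then have mN: "m = real N / 2" using pm(1) by (metis of_int_diff of_int_mult of_int_numeral of_int_of_nat_eq)
    interpret M: principal_module E t4 ?B "(- 1) powi w" N
    proof (unfold_locales, unfold grade)
      show "E i j (x + y) = E i j x + E i j y" "E i j (c *s x) = c *s E i j x" for i j x y c
        by (simp_all add: E_def matrix_vector_right_distrib vec.scale)
      show "E i j (E p q x) = E p q (E i j x) + (if j = p then E i q x else 0) - (if q = i then E p j x else 0)" for i j p q x
      proof -
        have "R.d\<pi> (bracket (e i j) (e p q)) *v x = E i j (E p q x) - E p q (E i j x)"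
          unfolding R.d\<pi>_bracket[OF e(1) e(1)] E_def
          by (simp add: bracket_def matrix_vector_mult_diff_rdistrib matrix_vector_mul_assoc)
        moreover have "R.d\<pi> ((if j = p then e i q else 0) - (if q = i then e p j else 0)) *v x =
            (if j = p then E i q x else 0) - (if q = i then E p j x else 0)"
        proof -
          have neg: "R.d\<pi> (A - C) *v x = R.d\<pi> A *v x - R.d\<pi> C *v x" for A C
            using L_add[of "A - C" C x] by (simp add: eq_diff_eq)
          show ?thesis unfolding neg by (auto simp: L0 E_def)
        qed
        ultimately show ?thesis unfolding e(2) by (simp add: algebra_simps)
      qed
      show "(\<Sum>k\<in>UNIV. E k k x) = 0" for x
        unfolding E_def L_sum[symmetric] e(3) by (rule L0)
      show "t4 2 \<le> t4 1" "t4 3 \<le> t4 2" "t4 4 \<le> t4 3" by (rule t4_mono)+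
      show "(\<Sum>k\<in>UNIV. t4 k) = 0" by (rule t4_sum)
      show "?B (x + y) z = ?B x z + ?B y z" "?B (c *s x) z = c * ?B x z" for x y z c
        by (rule complex_form_add complex_form_scale)+
      show "?B x y = (- 1) powi w * ?B y x" for x y by (rule B_sym)
      show "?B (E i j x) y = - ?B x (E i j y)" for i j x y unfolding E_def by (rule B_inv[OF e(1)])
      show "\<exists>y. ?B x y \<noteq> 0" if "x \<noteq> 0" for x by (rule B_nondeg[OF that])
      show "x \<in> vec.span {v. \<exists>l. D v = of_real l *s v}" for x
      proof -
        have "(\<Union>p. hodge_space (\<pi> \<circ> \<phi>) p (w - p)) \<subseteq> {v. \<exists>l. D v = of_real l *s v}" using D_hodge by blast
        then show ?thesis using hodge_span[of x] vec.span_mono by blast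
      qed
      have range: "\<exists>k\<le>N. l = real N / 2 - real k" if x: "x \<noteq> 0" "D x = of_real l *s x" for x l
      proof -
        obtain p :: int and y where p: "l = (2 * real_of_int p - real_of_int w) / 2" "y \<noteq> 0" "D y = of_real (- l) *s y"
          using level[OF x] by blast
        have "l \<le> m" "- l \<le> m" using m_top[OF x] m_top[OF p(2,3)] by blast+
        moreover have d: "m - l = real_of_int (pm - p)" using pm(1) p(1) by simp
        ultimately have "0 \<le> pm - p" "real_of_int (pm - p) \<le> real N" using mN by linarith+
        then obtain k where k: "pm - p = int k" by (metis nonneg_int_cases)
        have "k \<le> N" using \<open>real_of_int (pm - p) \<le> real N\<close> unfolding k by simp
        moreover have "l = real N / 2 - real k" using d mN unfolding k by simp
        ultimately show ?thesis by blast
      qed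
      then show "\<exists>k\<le>N. l = real N / 2 - real k" if "x \<noteq> 0" "D x = of_real l *s x" for x l
        using that by blast
      have dim: "vec.dim {v. D v = of_real (real N / 2 - real k) *s v} = 1" if "k \<le> N" for k
        using m(3)[of k] that unfolding eigsp mN by simp
      show "\<exists>c. y = c *s x" if x: "x \<noteq> 0" "D x = of_real l *s x" "D y = of_real l *s y" for x y l
      proof -
        obtain k where k: "k \<le> N" "l = real N / 2 - real k" using range[OF x(1,2)] by blast
        show ?thesis by (rule dim_one_line[OF dim[OF k(1)] _ x(1)]) (use x k in simp_all)
      qed
      show "\<exists>x. x \<noteq> 0 \<and> D x = of_real (real N / 2 - real k) *s x" if "k \<le> N" for k
        using dim_one_nonzero[OF dim[OF that]] by blast
      show "(- 1) powi w = (- 1 :: complex)" if "odd N"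
      proof -
        have "odd w"
        proof
          assume "even w"
          then have "even (int N)" unfolding N[symmetric] by simp
          then show False using that by simp
        qed
        then show ?thesis by (simp add: power_int_minus_left)
      qed
      show "x = 0" if x: "\<And>i j. E i j x = 0" for x
      proof (rule R.invariants_trivial[OF assms(3) inj e(1)[of 1 2] e(4)])
        show "R.d\<pi> X *v x = 0" if "X \<in> ?g" for X unfolding act[OF that] x by simp
      qed simp
      show "\<exists>x. E i j x \<noteq> 0" if "i \<noteq> j" for i j
      proof (rule ccontr)
        assume "\<not> ?thesis"
        then have "R.d\<pi> (e i j) *v x = R.d\<pi> 0 *v x" for x using L0 by (auto simp: E_def)
        then have "R.d\<pi> (e i j) = R.d\<pi> 0" by (simp add: matrix_eq)
        then have "e i j = 0" using inj e(1) g0 by (meson inj_onD)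
        then show False using e(4)[OF that] by blast
      qed
    qed
    obtain F where F: "bij F" "\<And>x y. F (x + y) = F x + F y" "\<And>c x. F (c *s x) = (c *s fst (F x), c *s snd (F x))"
      "\<And>i j x. fst (F (E i j x)) = (\<chi> k. (if k = i then fst (F x) $ j else 0) - (if i = j then fst (F x) $ k / 4 else 0))"
      "\<And>i j x. snd (F (E i j x)) = (\<chi> k. (if i = j then snd (F x) $ k / 4 else 0) - (if k = j then snd (F x) $ i else 0))"
      by (rule M.standard_plus_dual[OF conjunct1[OF M.classification]]) blast
    have F_sum: "F (\<Sum>k\<in>K. f k) = (\<Sum>k\<in>K. F (f k))" for K :: "4 set" and f
    proof -
      have "F 0 = 0" using F(2)[of 0 0] by simp
      then show ?thesis by (induction K rule: infinite_finite_induct) (simp_all add: F(2))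
    qed
    have F_act: "fst (F (R.d\<pi> X *v x)) = (R0 ** \<iota> X ** P0) *v fst (F x)"
      "snd (F (R.d\<pi> X *v x)) = - (transpose (R0 ** \<iota> X ** P0) *v snd (F x))" if X: "X \<in> ?g" for X x
    proof -
      define M where "M = R0 ** \<iota> X ** P0"
      have trM: "(\<Sum>i\<in>UNIV. M $ i $ i) = 0"
      proof -
        have "trace M = trace (P0 ** (R0 ** \<iota> X))" unfolding M_def by (rule trace_mul_sym)
        then have "trace M = trace (\<iota> X)" by (simp only: matrix_mul_assoc P0 matrix_mul_lid)
        then show ?thesis using \<iota>_tr[OF X] by (simp add: trace_def)
      qed
      have Fx: "F (R.d\<pi> X *v x) = (\<Sum>i\<in>UNIV. \<Sum>j\<in>UNIV. F (M $ i $ j *s E i j x))"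
        unfolding act[OF X] M_def[symmetric] F_sum ..
      have "fst (F (R.d\<pi> X *v x)) $ k = (M *v fst (F x)) $ k" for k
      proof -
        have "(\<Sum>j\<in>UNIV. M $ i $ j * ((if k = i then fst (F x) $ j else 0) - (if i = j then fst (F x) $ k / 4 else 0))) =
            (if i = k then (\<Sum>j\<in>UNIV. M $ k $ j * fst (F x) $ j) else 0) - M $ i $ i * (fst (F x) $ k / 4)" for i
        proof -
          have "M $ i $ j * ((if k = i then fst (F x) $ j else 0) - (if i = j then fst (F x) $ k / 4 else 0)) =
              (if i = k then M $ k $ j * fst (F x) $ j else 0) - (if j = i then M $ i $ i * (fst (F x) $ k / 4) else 0)" for j
            by (auto simp: algebra_simps)
          then show ?thesis by (simp add: sum_subtractf)
        qed
        then have "fst (F (R.d\<pi> X *v x)) $ k = (\<Sum>i\<in>UNIV. (if i = k then (\<Sum>j\<in>UNIV. M $ k $ j * fst (F x) $ j) else 0) -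
            M $ i $ i * (fst (F x) $ k / 4))"
          unfolding Fx fst_sum sum_component F(3) fst_conv vector_smult_component F(4) vec_lambda_beta by (simp only:)
        also have "\<dots> = (\<Sum>j\<in>UNIV. M $ k $ j * fst (F x) $ j) - (\<Sum>i\<in>UNIV. M $ i $ i) * (fst (F x) $ k / 4)"
          by (simp add: sum_subtractf sum_distrib_right)
        finally show ?thesis unfolding trM by (simp add: matrix_vector_mult_def)
      qed
      then show "fst (F (R.d\<pi> X *v x)) = (R0 ** \<iota> X ** P0) *v fst (F x)"
        unfolding M_def by (simp only: vec_eq_iff) simp
      have "snd (F (R.d\<pi> X *v x)) $ k = - (transpose M *v snd (F x)) $ k" for k
      proof -
        have "(\<Sum>j\<in>UNIV. M $ i $ j * ((if i = j then snd (F x) $ k / 4 else 0) - (if k = j then snd (F x) $ i else 0))) =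
            M $ i $ i * (snd (F x) $ k / 4) - M $ i $ k * snd (F x) $ i" for i
        proof -
          have "M $ i $ j * ((if i = j then snd (F x) $ k / 4 else 0) - (if k = j then snd (F x) $ i else 0)) =
              (if j = i then M $ i $ i * (snd (F x) $ k / 4) else 0) - (if j = k then M $ i $ k * snd (F x) $ i else 0)" for j
            by (auto simp: algebra_simps)
          then show ?thesis by (simp add: sum_subtractf)
        qed
        then have "snd (F (R.d\<pi> X *v x)) $ k = (\<Sum>i\<in>UNIV. M $ i $ i * (snd (F x) $ k / 4) - M $ i $ k * snd (F x) $ i)"
          unfolding Fx snd_sum sum_component F(3) snd_conv vector_smult_component F(5) vec_lambda_beta by (simp only:)
        also have "\<dots> = (\<Sum>i\<in>UNIV. M $ i $ i) * (snd (F x) $ k / 4) - (\<Sum>i\<in>UNIV. M $ i $ k * snd (F x) $ i)"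
          by (simp add: sum_subtractf sum_distrib_right)
        finally show ?thesis unfolding trM by (simp add: matrix_vector_mult_def transpose_def)
      qed
      then show "snd (F (R.d\<pi> X *v x)) = - (transpose (R0 ** \<iota> X ** P0) *v snd (F x))"
        unfolding M_def by (simp only: vec_eq_iff vector_uminus_component) simp
    qed
    \<comment> \<open>So far the action is that of the conjugated matrix. Returning to the original
      frame takes \<open>P0\<close> on the standard summand and its inverse transpose on the
      dual.\<close>
    define F' where "F' = (\<lambda>x. (P0 *v fst (F x), transpose R0 *v snd (F x)))"
    have RP: "transpose R0 ** transpose P0 = mat 1" "transpose P0 ** transpose R0 = mat 1"
      unfolding matrix_transpose_mul[symmetric] P0 by (simp_all add: transpose_mat)
    have "bij (\<lambda>p. (P0 *v fst p, transpose R0 *v snd p))"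
      by (rule o_bij[of "\<lambda>p. (R0 *v fst p, transpose P0 *v snd p)"])
        (simp_all add: fun_eq_iff matrix_vector_mul_assoc P0 RP del: transpose_matrix_vector)
    then have "bij F'" using bij_comp[OF F(1)] unfolding F'_def comp_def by blast
    moreover have "F' (u + v) = F' u + F' v" for u v
      by (simp add: F'_def F(2) matrix_vector_right_distrib del: transpose_matrix_vector)
    moreover have "F' (c *s v) = (c *s fst (F' v), c *s snd (F' v))" for c v
      by (simp add: F'_def F(3) vec.scale del: transpose_matrix_vector)
    moreover have "F' (differential G \<pi> X *v v) = (\<iota> X *v fst (F' v), - (transpose (\<iota> X) *v snd (F' v)))"
      if X: "X \<in> ?g" for X v
    proof -
      have 1: "P0 ** (R0 ** \<iota> X ** P0) = \<iota> X ** P0"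
        by (simp add: matrix_mul_assoc P0)
      have "(R0 ** \<iota> X ** P0) ** R0 = R0 ** \<iota> X ** (P0 ** R0)" by (simp only: matrix_mul_assoc)
      then have 2: "transpose R0 ** transpose (R0 ** \<iota> X ** P0) = transpose (\<iota> X) ** transpose R0"
        unfolding matrix_transpose_mul[symmetric] P0 by simp
      have neg: "transpose R0 *v (- z) = - (transpose R0 *v z)" for z :: "complex^4"
        using vec.scale[of "transpose R0" "- 1" z] by simp
      show ?thesis
        unfolding F'_def dif[OF X] F_act[OF X] fst_conv snd_conv neg matrix_vector_mul_assoc 1 2 ..
    qed
    ultimately have "iso_standard_plus_dual G \<pi> \<iota>"
      unfolding iso_standard_plus_dual_def by (intro exI[of _ F'] conjI allI ballI)
    then show "iso_standard_plus_dual G \<pi> \<iota> \<and>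
           (T\<phi> = cscale 3 (T 1) + cscale 2 (T 2) + T 3 \<or> T\<phi> = T 1 + cscale 2 (T 2) + cscale 3 (T 3))"
      unfolding cases using M.classification by blast
  next
    assume rhs: "iso_standard_plus_dual G \<pi> \<iota> \<and>
           (T\<phi> = cscale 3 (T 1) + cscale 2 (T 2) + T 3 \<or> T\<phi> = T 1 + cscale 2 (T 2) + cscale 3 (T 3))"
    then obtain F :: "complex^'v \<Rightarrow> (complex^4) \<times> (complex^4)" where F: "bij F"
      "\<And>u v. F (u + v) = F u + F v" "\<And>c v. F (c *s v) = (c *s fst (F v), c *s snd (F v))"
      "\<And>X v. X \<in> ?g \<Longrightarrow> F (differential G \<pi> X *v v) = (\<iota> X *v fst (F v), - (transpose (\<iota> X) *v snd (F v)))"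
      unfolding iso_standard_plus_dual_def by blast
    \<comment> \<open>The opposite change of frame makes the grading element diagonal, with entries
      \<open>t4\<close> on the standard summand and their negatives on the dual.\<close>
    define F' where "F' = (\<lambda>x. (R0 *v fst (F x), transpose P0 *v snd (F x)))"
    have RP: "transpose R0 ** transpose P0 = mat 1" "transpose P0 ** transpose R0 = mat 1"
      unfolding matrix_transpose_mul[symmetric] P0 by (simp_all add: transpose_mat)
    have "bij (\<lambda>p. (R0 *v fst p, transpose P0 *v snd p))"
      by (rule o_bij[of "\<lambda>p. (P0 *v fst p, transpose R0 *v snd p)"])
        (simp_all add: fun_eq_iff matrix_vector_mul_assoc P0 RP del: transpose_matrix_vector)
    then have bij: "bij F'" using bij_comp[OF F(1)] unfolding F'_def comp_def by blast
    let ?M = "(\<chi> i j. if i = j then of_real (t4 i) else 0) :: complex^4^4"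
    have M_v: "(?M *v y) = (\<chi> k. of_real (t4 k) * y $ k)" for y :: "complex^4"
      by (simp add: matrix_vector_mult_def vec_eq_iff if_distrib[of "\<lambda>c. c * _"] cong: if_cong)
    have M_t: "transpose ?M = ?M" by (auto simp: transpose_def vec_eq_iff)
    have D: "F' (differential G \<pi> T\<phi> *v v) =
        ((\<chi> k. of_real (t4 k) * fst (F' v) $ k), (\<chi> k. of_real (- t4 k) * snd (F' v) $ k))" for v
    proof -
      have "R0 ** \<iota> T\<phi> = R0 ** \<iota> T\<phi> ** (P0 ** R0)" by (simp add: P0)
      also have "\<dots> = ?M ** R0" unfolding conj_diag[symmetric] by (simp only: matrix_mul_assoc)
      finally have 1: "R0 ** \<iota> T\<phi> = ?M ** R0" .
      have "\<iota> T\<phi> ** P0 = (P0 ** R0) ** \<iota> T\<phi> ** P0" by (simp add: P0)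
      also have "\<dots> = P0 ** ?M" unfolding conj_diag[symmetric] by (simp only: matrix_mul_assoc)
      finally have "transpose (\<iota> T\<phi> ** P0) = transpose (P0 ** ?M)" by simp
      then have 2: "transpose P0 ** transpose (\<iota> T\<phi>) = ?M ** transpose P0"
        unfolding matrix_transpose_mul M_t .
      have neg: "transpose P0 *v (- z) = - (transpose P0 *v z)" for z :: "complex^4"
        using vec.scale[of "transpose P0" "- 1" z] by simp
      have "F' (differential G \<pi> T\<phi> *v v) = (?M *v fst (F' v), - (?M *v snd (F' v)))"
        unfolding F'_def F(4)[OF T\<phi>] fst_conv snd_conv neg matrix_vector_mul_assoc 1 2 ..
      then show ?thesis unfolding M_v by (simp add: vec_eq_iff)
    qed
    have range4: "range f = {f 1, f 2, f 3, f 4}" for f :: "4 \<Rightarrow> real"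
      using exhaust_4 by (auto intro: range_eqI) (metis (full_types))
    have vals: "(\<lambda>k. 7 / 2 - real k) ` {..7} = {7/2, 5/2, 3/2, 1/2, - 1/2, - 3/2, - 5/2, - 7/2}"
    proof -
      have "{..7} = {0, 1, 2, 3, 4, 5, 6, 7::nat}" by auto
      then show ?thesis by simp
    qed
    from rhs have t4: "t4 = wt4 (7/2) (1/2) (- 3/2) (- 5/2) \<or> t4 = wt4 (5/2) (3/2) (- 1/2) (- 7/2)"
      unfolding cases by blast
    show "principal G \<pi> T\<phi>"
    proof (rule principal_diagonal[OF bij _ _ D])
      show "F' (u + v) = F' u + F' v" for u v by (simp add: F'_def F(2) matrix_vector_right_distrib del: transpose_matrix_vector)
      show "F' (c *s v) = (c *s fst (F' v), c *s snd (F' v))" for c v by (simp add: F'_def F(3) vec.scale del: transpose_matrix_vector)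
      show "range t4 \<union> range (\<lambda>k. - t4 k) = (\<lambda>k. 7 / 2 - real k) ` {..7}"
        unfolding vals range4 using t4 by (auto simp: wt4_simps)
      show "inj t4" using t4 by (auto simp: inj_def forall_4 wt4_simps)
      then show "inj (\<lambda>k. - t4 k)" by (auto simp: inj_def)
      show "range t4 \<inter> range (\<lambda>k. - t4 k) = {}"
        unfolding range4 using t4 by (auto simp: wt4_simps)
    qed
  qed
qed

end
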